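(* Let $k\ge1$ and let $[\bar z_1,\dots,\bar z_k]\in\pi_k(X_{2k})$ be such that the associated sum operator $[S_1\cdots S_{k+1}]\in L[N_0\times\cdots\times N_k,\bar B]$ is surjective ($k$-regularity), with $k\ge1$ minimal with respect to surjectivity of the sum operator (i.e. $[S_1\cdots S_k]$ is not surjective). Then for every $l\ge1$: (i) $$\pi_{k+l}(\bar X_{2k+l-1})\supsetneq\pi_{k+l}(\bar X_{2k+l})=\pi_{k+l}(\bar X_\infty),$$ i.e. $\pi_{k+l}(\bar X_i)$ stabilizes exactly at $i=2k+l$, then agreeing with $\pi_{k+l}(\bar X_\infty)$. (ii) The set $\bar X_{2k+l}$ is explicitly parametrized by the subspace $N_1\times\cdots\times N_k\times(N_{k+1})^l\subset B^{k+l}$: there are $P_1\in B$ and operators $P_i(\cdot)$, $2\le i\le l+k$, given by compositions of multilinear mappings, such that $\bar X_{2k+l}$ consists exactly of the tuples $[z_1,\dots,z_{2k+l}]$ with $[z_1,\dots,z_k]=[\bar z_1,\dots,\bar z_k]$ and $$\begin{aligned} z_{k+1}&=P_1+q_1, & q_1&\in N_{k+1},\\ z_{k+2}&=P_2(q_1)+q_2, & q_2&\in N_{k+1},\\ &\ \,\vdots\\ z_{k+l}&=P_l(q_1,\dots,q_{l-1})+q_l, & q_l&\in N_{k+1},\\ z_{k+l+1}&=P_{l+1}(q_1,\dots,q_l)+n_k, & n_k&\in N_k,\\ z_{k+l+2}&=P_{l+2}(q_1,\dots,q_l,n_k)+n_{k-1}, & n_{k-1}&\in N_{k-1},\\ &\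 \,\vdots\\ z_{k+l+k}&=P_{l+k}(q_1,\dots,q_l,n_k,\dots,n_2)+n_1, & n_1&\in N_1 . \end{aligned}$$ If $B$ and $\bar B$ are finite dimensional, then the $P_i(\cdot)$ can be represented, with respect to chosen coordinates, by polynomials (of increasing degree in $i$).
   Context: $\mathbb K\in\{\mathbb R,\mathbb C\}$; $B,\bar B$ are Banach spaces over $\mathbb K$; $G:B\to\bar B$ is analytic near $0$ with $G[0]=0$. $L[\cdot,\cdot]$ denotes bounded linear operators. System of undetermined coefficients: $T^i[z_1,\dots,z_i]:=\frac{d^i}{d\varepsilon^i}\big|_{\varepsilon=0}G\big[\sum_{j=1}^{i}\frac1{j!}\varepsilon^jz_j\big]$. $X_n\subset B^n$ is the set of $[z_1,\dots,z_n]$ with $T^1[z_1]=0,\dots,T^n[z_1,\dots,z_n]=0$; $X_\infty$ is the set of sequences $(z_i)_{i\in\mathbb N}$ in $B$ with $T^n[z_1,\dots,z_n]=0$ for all $n\ge1$. $\pi_l$ denotes truncation to the first $l$ components. For a fixed $[\bar z_1,\dots,\bar z_k]\in\pi_k(X_{2k})$ and $n\ge k$ (or $n=\infty$), $\bar X_n$ is the set of elements of $X_n$ whose first $k$ components are $\bar z_1,\dots,\bar z_k$. Operators and decompositions: define $A_0,\dots,A_k\in L[B,\bar B]$ as the coefficients of $\varepsilon^0,\dots,\varepsilon^k$ in the expansion $G'\big[\sum_{j=1}^k\frac1{j!}\varepsilon^j\bar z_j\big]=\sum_{i\ge0}\varepsilon^iA_i$ (so $A_0=G'[0]$). Put $N_0:=B$,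 $R_0^c:=\bar B$, $S_1:=A_0$. Recursively for $i=1,\dots,k+1$, $N_i\subset N_{i-1}$ is the kernel and $R_i\subset R_{i-1}^c$ the range of $S_i\in L[N_{i-1},R_{i-1}^c]$; it is a standing assumption that there are direct sums of closed subspaces $N_{i-1}=N_i^c\oplus N_i$ and $R_{i-1}^c=R_i\oplus R_i^c$, with $S_i:N_i^c\to R_i$ a continuous bijection (complements fixed once and for all). For $1\le i\le k$ the next operator $S_{i+1}\in L[N_i,R_i^c]$ is defined as follows: for $v_0\in N_i$ there exist $v_1,\dots,v_{i-1}\in B$ with $\sum_{j=0}^{s}A_jv_{s-j}=0$ for $s=0,\dots,i-1$, and $S_{i+1}v_0:=\tfrac{(2i)!}{i!}P_{R_i^c}\sum_{j=1}^{i}A_jv_{i-j}$, where $P_{R_i^c}$ is the projection onto $R_i^c$ along $R_1\oplus\cdots\oplus R_i$; this does not depend on the choice of $v_1,\dots,v_{i-1}$. The sum operator is $[S_1\cdots S_{k+1}](n_0,\dots,n_k)=S_1n_0+\cdots+S_{k+1}n_k$ on $N_0\times\cdots\times N_k$ (and $[S_1\cdots S_k]$ analogously on $N_0\times\cdots\times N_{k-1}$). *)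

theory Defs
  imports "HOL-Analysis.Analysis"
begin

(* The scalar field is a type 'k of class real_normed_field: real and complex are instances, and by
   Gelfand-Mazur there are no others up to isomorphism.  A Banach space over 'k is a type of class
   banach with a scalar multiplication by 'k that is compatible with the norm and with scaleR. *)
locale normed_space_over = vector_space scale
  for scale :: "'k::real_normed_field \<Rightarrow> 'a::real_normed_vector \<Rightarrow> 'a" +
  assumes norm_scale: "norm (scale c x) = norm c * norm x"
    and scale_of_real: "scale (of_real r) x = r *\<^sub>R x"

section \<open>Multilinear mappings and analyticity\<close>

(* An n-linear mapping takes its arguments x 0, ..., x (n - 1) from a sequence and ignores the rest
   of that sequence; a 0-linear mapping is a constant. *)
definition multilinear ::
  "('k::field \<Rightarrow> 'a::ab_group_add \<Rightarrow> 'a) \<Rightarrow> ('k \<Rightarrow> 'b::ab_group_add \<Rightarrow> 'b) \<Rightarrow> nat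
    \<Rightarrow> ((nat \<Rightarrow> 'a) \<Rightarrow> 'b) \<Rightarrow> bool" where
  "multilinear s s' n m \<longleftrightarrow>
     (\<forall>x y. (\<forall>i<n. x i = y i) \<longrightarrow> m x = m y) \<and>
     (\<forall>i<n. \<forall>x. Vector_Spaces.linear s s' (\<lambda>u. m (x(i := u))))"

definition bounded_multilinear ::
  "('k::field \<Rightarrow> 'a::real_normed_vector \<Rightarrow> 'a) \<Rightarrow> ('k \<Rightarrow> 'b::real_normed_vector \<Rightarrow> 'b) \<Rightarrow> nat
    \<Rightarrow> ((nat \<Rightarrow> 'a) \<Rightarrow> 'b) \<Rightarrow> bool" where
  "bounded_multilinear s s' n m \<longleftrightarrow>
     multilinear s s' n m \<and> (\<exists>C. \<forall>x. norm (m x) \<le> C * (\<Prod>i<n. norm (x i)))"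

(* Near 0, G is the sum of a power series of bounded symmetric n-linear mappings a n (with norms
   at most c n) that converges normally on a ball of positive radius. *)
definition analytic_near_0 ::
  "('k::field \<Rightarrow> 'a::real_normed_vector \<Rightarrow> 'a) \<Rightarrow> ('k \<Rightarrow> 'b::real_normed_vector \<Rightarrow> 'b)
    \<Rightarrow> ('a \<Rightarrow> 'b) \<Rightarrow> bool" where
  "analytic_near_0 s s' G \<longleftrightarrow>
     (\<exists>a c r. r > 0 \<and> summable (\<lambda>n. c n * r ^ n) \<and>
        (\<forall>n. multilinear s s' n (a n) \<and>
             (\<forall>p x. p permutes {..<n} \<longrightarrow> a n (x \<circ> p) = a n x) \<and>
             (\<forall>x. norm (a n x) \<le> c n * (\<Prod>i<n. norm (x i)))) \<and>
        (\<forall>x. norm x < r \<longrightarrow> (\<lambda>n. a n (\<lambda>_. x)) sums G x))"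

section \<open>The system of undetermined coefficients\<close>

(* Derivative of a curve with respect to its parameter in the field 'k. *)
definition curve_deriv ::
  "('k::real_normed_field \<Rightarrow> 'b::real_normed_vector \<Rightarrow> 'b) \<Rightarrow> ('k \<Rightarrow> 'b) \<Rightarrow> 'k \<Rightarrow> 'b" where
  "curve_deriv s f x = (THE D. (f has_derivative (\<lambda>h. s h D)) (at x))"

definition curve ::
  "('k::real_normed_field \<Rightarrow> 'a::real_normed_vector \<Rightarrow> 'a) \<Rightarrow> nat \<Rightarrow> (nat \<Rightarrow> 'a) \<Rightarrow> 'k \<Rightarrow> 'a" where
  "curve s n z \<epsilon> = (\<Sum>j=1..n. s (\<epsilon> ^ j / fact j) (z j))"

definition T ::
  "('k::real_normed_field \<Rightarrow> 'a::real_normed_vector \<Rightarrow> 'a)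
    \<Rightarrow> ('k \<Rightarrow> 'b::real_normed_vector \<Rightarrow> 'b) \<Rightarrow> ('a \<Rightarrow> 'b) \<Rightarrow> nat \<Rightarrow> (nat \<Rightarrow> 'a) \<Rightarrow> 'b" where
  "T s s' G i z = (curve_deriv s' ^^ i) (\<lambda>\<epsilon>. G (curve s i z \<epsilon>)) 0"

(* A tuple [z_1, ..., z_n] is a function that is extensional on {1..n}; a sequence
   (z_i) with i \<ge> 1 is a function that is extensional on {1..}. *)
definition X ::
  "('k::real_normed_field \<Rightarrow> 'a::real_normed_vector \<Rightarrow> 'a)
    \<Rightarrow> ('k \<Rightarrow> 'b::real_normed_vector \<Rightarrow> 'b) \<Rightarrow> ('a \<Rightarrow> 'b) \<Rightarrow> nat \<Rightarrow> (nat \<Rightarrow> 'a) set" where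
  "X s s' G n = {z \<in> {1..n} \<rightarrow>\<^sub>E UNIV. \<forall>i\<in>{1..n}. T s s' G i z = 0}"

definition X_inf ::
  "('k::real_normed_field \<Rightarrow> 'a::real_normed_vector \<Rightarrow> 'a)
    \<Rightarrow> ('k \<Rightarrow> 'b::real_normed_vector \<Rightarrow> 'b) \<Rightarrow> ('a \<Rightarrow> 'b) \<Rightarrow> (nat \<Rightarrow> 'a) set" where
  "X_inf s s' G = {z \<in> {1..} \<rightarrow>\<^sub>E UNIV. \<forall>i\<ge>1. T s s' G i z = 0}"

definition trunc :: "nat \<Rightarrow> (nat \<Rightarrow> 'a) \<Rightarrow> nat \<Rightarrow> 'a" where
  "trunc l z = restrict z {1..l}"

definition Xbar ::
  "('k::real_normed_field \<Rightarrow> 'a::real_normed_vector \<Rightarrow> 'a)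
    \<Rightarrow> ('k \<Rightarrow> 'b::real_normed_vector \<Rightarrow> 'b) \<Rightarrow> ('a \<Rightarrow> 'b) \<Rightarrow> nat \<Rightarrow> (nat \<Rightarrow> 'a) \<Rightarrow> nat
    \<Rightarrow> (nat \<Rightarrow> 'a) set" where
  "Xbar s s' G k zb n = {z \<in> X s s' G n. \<forall>i\<in>{1..k}. z i = zb i}"

definition Xbar_inf ::
  "('k::real_normed_field \<Rightarrow> 'a::real_normed_vector \<Rightarrow> 'a)
    \<Rightarrow> ('k \<Rightarrow> 'b::real_normed_vector \<Rightarrow> 'b) \<Rightarrow> ('a \<Rightarrow> 'b) \<Rightarrow> nat \<Rightarrow> (nat \<Rightarrow> 'a)
    \<Rightarrow> (nat \<Rightarrow> 'a) set" where
  "Xbar_inf s s' G k zb = {z \<in> X_inf s s' G. \<forall>i\<in>{1..k}. z i = zb i}"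

section \<open>Operators and decompositions\<close>

(* The series converges in operator norm; the A i are linear over 'k, whereas the type of
   bounded linear functions only knows real linearity. *)
definition expansion_coeffs ::
  "('k::real_normed_field \<Rightarrow> 'a::real_normed_vector \<Rightarrow> 'a)
    \<Rightarrow> ('k \<Rightarrow> 'b::real_normed_vector \<Rightarrow> 'b) \<Rightarrow> ('a \<Rightarrow> 'b) \<Rightarrow> nat \<Rightarrow> (nat \<Rightarrow> 'a)
    \<Rightarrow> (nat \<Rightarrow> 'a \<Rightarrow> 'b) \<Rightarrow> bool" where
  "expansion_coeffs s s' G k zb A \<longleftrightarrow>
     (\<forall>i. Vector_Spaces.linear s s' (A i) \<and> bounded_linear (A i)) \<and>
     (\<exists>r>0. \<forall>\<epsilon>. norm \<epsilon> < r \<longrightarrow>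
        (\<lambda>i. Blinfun (\<lambda>v. s' (\<epsilon> ^ i) (A i v)))
          sums Blinfun (frechet_derivative G (at (curve s k zb \<epsilon>))))"

definition closed_direct_sum ::
  "('k::field \<Rightarrow> 'v::real_normed_vector \<Rightarrow> 'v) \<Rightarrow> 'v set \<Rightarrow> 'v set \<Rightarrow> 'v set \<Rightarrow> bool" where
  "closed_direct_sum s W U V \<longleftrightarrow>
     module.subspace s U \<and> closed U \<and> module.subspace s V \<and> closed V \<and>
     U \<inter> V = {0} \<and> W = {u + v | u v. u \<in> U \<and> v \<in> V}"

definition projection_along :: "'v::ab_group_add set \<Rightarrow> 'v set \<Rightarrow> 'v \<Rightarrow> 'v" where
  "projection_along U V w = (THE u. u \<in> U \<and> w - u \<in> V)"

definition sum_of_subspaces :: "(nat \<Rightarrow> 'v::ab_group_add set) \<Rightarrow> nat \<Rightarrow> 'v set" where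
  "sum_of_subspaces R i = {\<Sum>j=1..i. r j | r. \<forall>j\<in>{1..i}. r j \<in> R j}"

(* The value of S_(i+1) at v0.  Only the entries v 0, ..., v (i - 1) of the chosen v matter, and the
   value is independent of the choice. *)
definition next_operator ::
  "('k::field_char_0 \<Rightarrow> 'b::ab_group_add \<Rightarrow> 'b) \<Rightarrow> (nat \<Rightarrow> 'a::ab_group_add \<Rightarrow> 'b) \<Rightarrow> (nat \<Rightarrow> 'b set)
    \<Rightarrow> (nat \<Rightarrow> 'b set) \<Rightarrow> nat \<Rightarrow> 'a \<Rightarrow> 'b" where
  "next_operator s' A R Rc i v0 =
     (let v = (SOME v. v 0 = v0 \<and> (\<forall>t<i. (\<Sum>j=0..t. A j (v (t - j))) = 0))
      in s' (fact (2 * i) / fact i)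
           (projection_along (Rc i) (sum_of_subspaces R i) (\<Sum>j=1..i. A j (v (i - j)))))"

(* S i, Nc i, R i matter for 1 \<le> i \<le> k + 1 and N i, Rc i for 0 \<le> i \<le> k + 1; each S (Suc i) matters
   on N i only. *)
definition operator_chain ::
  "('k::real_normed_field \<Rightarrow> 'a::real_normed_vector \<Rightarrow> 'a)
    \<Rightarrow> ('k \<Rightarrow> 'b::real_normed_vector \<Rightarrow> 'b) \<Rightarrow> nat \<Rightarrow> (nat \<Rightarrow> 'a \<Rightarrow> 'b) \<Rightarrow> (nat \<Rightarrow> 'a \<Rightarrow> 'b)
    \<Rightarrow> (nat \<Rightarrow> 'a set) \<Rightarrow> (nat \<Rightarrow> 'a set) \<Rightarrow> (nat \<Rightarrow> 'b set) \<Rightarrow> (nat \<Rightarrow> 'b set) \<Rightarrow> bool" where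
  "operator_chain s s' k A S N Nc R Rc \<longleftrightarrow>
     N 0 = UNIV \<and> Rc 0 = UNIV \<and> S 1 = A 0 \<and>
     (\<forall>i\<in>{1..k}. \<forall>v\<in>N i. S (Suc i) v = next_operator s' A R Rc i v) \<and>
     (\<forall>i\<in>{1..k+1}.
        N i = {v \<in> N (i - 1). S i v = 0} \<and>
        R i = S i ` N (i - 1) \<and>
        closed_direct_sum s (N (i - 1)) (Nc i) (N i) \<and>
        closed_direct_sum s' (Rc (i - 1)) (R i) (Rc i) \<and>
        continuous_on (Nc i) (S i) \<and>
        bij_betw (S i) (Nc i) (R i))"

(* Surjectivity of [S_1 ... S_m] on the product of N_0, ..., N_(m-1). *)
definition sum_operator_surj ::
  "nat \<Rightarrow> (nat \<Rightarrow> 'a \<Rightarrow> 'b::ab_group_add) \<Rightarrow> (nat \<Rightarrow> 'a set) \<Rightarrow> bool" where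
  "sum_operator_surj m S N \<longleftrightarrow>
     (\<lambda>n. \<Sum>i<m. S (Suc i) (n i)) ` Pi\<^sub>E {..<m} N = UNIV"

section \<open>Compositions of multilinear mappings and polynomials\<close>

(* Mappings of the variables p i, i in V, generated by the variables, addition (itself linear on
   a product of two spaces) and bounded multilinear mappings; 0-linear ones give the constants.
   Mappings that pass through another Banach space and come back are not listed separately:
   composing a multilinear mapping with a bounded linear one is multilinear again. *)
inductive multilinear_composition ::
  "('k::field \<Rightarrow> 'a::real_normed_vector \<Rightarrow> 'a) \<Rightarrow> nat set \<Rightarrow> ((nat \<Rightarrow> 'a) \<Rightarrow> 'a) \<Rightarrow> bool"
  for s V where
  var: "i \<in> V \<Longrightarrow> multilinear_composition s V (\<lambda>p. p i)"
| add: "multilinear_composition s V f \<Longrightarrow> multilinear_composition s V g \<Longrightarrow>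
     multilinear_composition s V (\<lambda>p. f p + g p)"
| comp: "bounded_multilinear s s m M \<Longrightarrow> (\<And>j. j < m \<Longrightarrow> multilinear_composition s V (f j)) \<Longrightarrow>
     multilinear_composition s V (\<lambda>p. M (\<lambda>j. f j p))"

(* Polynomial of total degree at most d in the finitely many variables x v, v in V; the
   elements of E are the exponent vectors of the monomials. *)
definition polynomial_of_degree_le :: "'v set \<Rightarrow> nat \<Rightarrow> (('v \<Rightarrow> 'k::field) \<Rightarrow> 'k) \<Rightarrow> bool" where
  "polynomial_of_degree_le V d f \<longleftrightarrow>
     (\<exists>E c. finite E \<and> (\<forall>e\<in>E. (\<Sum>v\<in>V. e v) \<le> d) \<and>
        (\<forall>x. f x = (\<Sum>e\<in>E. c e * (\<Prod>v\<in>V. x v ^ e v))))"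

end

theory Submission
  imports Defs
begin

text \<open>
  Write a curve as \<open>\<Sum>j. \<epsilon> ^ j y j\<close> with \<open>y j = z j / j!\<close>. Then \<open>T i z\<close> is \<open>i!\<close> times the coefficient of
  \<open>\<epsilon> ^ i\<close> in the expansion of \<open>G\<close> along the curve (\<open>T_eq_series_coeff\<close>), a finite sum of multilinear terms
  over the compositions of \<open>i\<close>. With \<open>y 1, \<dots>, y k\<close> given and \<open>w m = y (k + m)\<close> unknown, the coefficient of
  \<open>\<epsilon> ^ (k + m)\<close> is a constant, plus \<open>A 0 w\<^sub>m + A 1 w\<^sub>m\<^sub>-\<^sub>1 + \<dots>\<close>, plus terms with at least two unknowns
  (\<open>series_coeff_split\<close>). Two unknowns carry a factor \<open>\<epsilon> ^ (2 * k)\<close>, so the last terms only involve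
  \<open>w 1, \<dots>, w (m - k - 1)\<close>. The system is therefore a triangular Toeplitz system in the operators \<open>A j\<close>, with
  a right-hand side that lags \<open>k\<close> places behind.

  The chain of operators describes the Toeplitz system. The set \<open>N i\<close> consists of the first entries of the
  solutions of its first \<open>i\<close> homogeneous equations, and \<open>R 1 \<oplus> \<dots> \<oplus> R (i + 1)\<close> consists of the values that
  equation \<open>i + 1\<close> takes on such solutions. Both facts are proved together with the construction of bounded
  operators that produce these solutions (\<open>lifts_and_correctors\<close>); boundedness comes from the
  bounded inverse theorem and the closed direct sums. It follows that \<open>i\<close> consecutive equations, if
  solvable, determine their first unknown up to an element of \<open>N i\<close>, as a bounded linear function of the
  right-hand sides (\<open>head_of_solution\<close>). If the sum of the ranges is everything, a further equation can always
  be satisfied by changing only the last \<open>k + 1\<close> unknowns (\<open>regular_solvable\<close>).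

  Consequently \<open>w m\<close> is restricted only by the equations \<open>m, \<dots>, m + k\<close>, as far as they are imposed, and
  their right-hand sides only involve earlier unknowns. Imposing the first \<open>M\<close> equations thus amounts to
  \<open>w m\<close> lying, for every \<open>m \<le> M\<close>, in a coset of \<open>N (min (k + 1) (M + 1 - m))\<close> that is determined by
  \<open>w 1, \<dots>, w (m - 1)\<close> (\<open>solves_all_iff\<close>). For \<open>M = k + l\<close> this is the parametrization: the first \<open>l\<close> unknowns
  have freedom \<open>N (k + 1)\<close>, the last \<open>k\<close> have freedom \<open>N k, \<dots>, N 1\<close>. The conditions on \<open>w 1, \<dots>, w l\<close>
  do not change when more equations are imposed, which gives stabilization. With one equation less, \<open>w l\<close>
  moves in a coset of \<open>N k\<close>, which is larger than \<open>N (k + 1)\<close> by the minimality of \<open>k\<close>.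

  For the degrees, give the unknown \<open>w m\<close> the weight \<open>m\<close>. The right-hand side of equation \<open>m\<close> has weighted
  degree at most \<open>m - k\<close>, so the value prescribed for \<open>w m\<close> has weighted degree at most \<open>m\<close>.
\<close>

section \<open>Bounded inverses and bounded projections\<close>

text \<open>The step of the open mapping theorem that uses completeness of the target. By Baire, the
  closure of the image of some ball has an interior point in \<open>V\<close>; subtracting two points and
  rescaling, every \<open>y\<close> is approximated up to \<open>norm y / 2\<close> by an image \<open>f x\<close> with \<open>norm x\<close>
  controlled by \<open>norm y\<close>.\<close>

lemma surj_almost_open:
  fixes f :: "'a::banach \<Rightarrow> 'b::banach"
  assumes U: "subspace U"
    and V: "subspace V" "closed V"
    and add: "\<And>x y. x \<in> U \<Longrightarrow> y \<in> U \<Longrightarrow> f (x + y) = f x + f y"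
    and scale: "\<And>c x. x \<in> U \<Longrightarrow> f (c *\<^sub>R x) = c *\<^sub>R f x"
    and im: "f ` U = V"
  obtains C where "C \<ge> 0"
    and "\<And>y. y \<in> V \<Longrightarrow> \<exists>x\<in>U. norm x \<le> C * norm y \<and> norm (y - f x) \<le> norm y / 2"
proof -
  define D where "D n = closure (f ` (U \<inter> cball 0 (real n)))" for n :: nat
  have fV: "f x \<in> V" if "x \<in> U" for x
    using im that by auto
  have D_sub: "D n \<subseteq> V" for n
    unfolding D_def using V fV by (intro closure_minimal) auto
  have cover: "\<Union>(range D) = V"
  proof
    show "\<Union>(range D) \<subseteq> V" using D_sub by auto
    show "V \<subseteq> \<Union>(range D)"
    proof
      fix y assume "y \<in> V"
      then obtain x where x: "x \<in> U" "y = f x" using im by auto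
      obtain n :: nat where "norm x \<le> real n" using real_arch_simple by blast
      then have "y \<in> D n" unfolding D_def using x by (intro closure_subset[THEN subsetD]) auto
      then show "y \<in> \<Union>(range D)" by blast
    qed
  qed
  have cm: "completely_metrizable_space (top_of_set V)"
    using completely_metrizable_space_closedin[OF completely_metrizable_space_euclidean] V by simp
  have "\<exists>n. (top_of_set V) interior_of (D n) \<noteq> {}"
  proof (rule ccontr)
    assume none: "\<not> ?thesis"
    then have "(top_of_set V) interior_of \<Union>(range D) = {}"
    proof (intro Baire_category_alt)
      show "completely_metrizable_space (top_of_set V) \<or>
            locally_compact_space (top_of_set V) \<and> regular_space (top_of_set V)"
        using cm by blast
      fix T assume "T \<in> range D"
      then obtain n where T: "T = D n" by auto
      have "closedin (top_of_set V) T"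
        unfolding T by (rule closed_subset[OF D_sub]) (simp add: D_def)
      then show "closedin (top_of_set V) T \<and> (top_of_set V) interior_of T = {}"
        using none T by auto
    qed auto
    then have "(top_of_set V) interior_of V = {}" using cover by simp
    moreover have "(top_of_set V) interior_of V = V"
      using interior_of_topspace[of "top_of_set V"] by simp
    ultimately show False using subspace_0[OF V(1)] by auto
  qed
  then obtain n y0 where "y0 \<in> (top_of_set V) interior_of (D n)" by blast
  then obtain W where W: "openin (top_of_set V) W" "y0 \<in> W" "W \<subseteq> D n"
    by (auto simp: interior_of_def)
  then have y0: "y0 \<in> V" using D_sub by auto
  obtain e where e: "e > 0" "ball y0 e \<inter> V \<subseteq> W"
    using W(1,2) by (auto simp: openin_contains_ball)
  have near: "\<exists>x\<in>U. norm x \<le> real n \<and> norm (z - f x) < d" if z: "z \<in> D n" "d > 0" for z d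
  proof -
    have "\<forall>e>0. \<exists>w\<in>f ` (U \<inter> cball 0 (real n)). dist w z < e"
      using z(1) by (simp only: D_def closure_approachable)
    then obtain w where "w \<in> f ` (U \<inter> cball 0 (real n))" "dist w z < d"
      using z(2) by blast
    then show ?thesis by (auto simp: dist_norm norm_minus_commute)
  qed
  have small: "\<exists>x\<in>U. norm x \<le> 2 * real n \<and> norm (y - f x) < d"
    if y: "y \<in> V" "norm y < e" and d: "d > 0" for y d
  proof -
    have "y0 + y \<in> V" using y0 y subspace_add[OF V(1)] by blast
    moreover have "y0 + y \<in> ball y0 e" using y(2) by (simp add: dist_norm)
    ultimately have "y0 + y \<in> D n" using W(3) e(2) by blast
    then obtain x1 where x1: "x1 \<in> U" "norm x1 \<le> real n" "norm (y0 + y - f x1) < d / 2"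
      using near[of "y0 + y" "d/2"] d by auto
    obtain x2 where x2: "x2 \<in> U" "norm x2 \<le> real n" "norm (y0 - f x2) < d / 2"
      using near[of y0 "d/2"] d W by auto
    have m: "- 1 *\<^sub>R x2 \<in> U" using x2 subspace_scale[OF U] by blast
    have "f (x1 - x2) = f x1 - f x2"
      using add[OF x1(1) m] scale[OF x2(1), of "-1"] by simp
    then have eq: "y - f (x1 - x2) = (y0 + y - f x1) - (y0 - f x2)" by simp
    have "norm (y - f (x1 - x2)) < d"
      unfolding eq using norm_triangle_ineq4[of "y0 + y - f x1" "y0 - f x2"] x1(3) x2(3) by linarith
    moreover have "norm (x1 - x2) \<le> 2 * real n"
      using norm_triangle_ineq4[of x1 x2] x1 x2 by linarith
    moreover have "x1 - x2 \<in> U" using x1 x2 subspace_diff[OF U] by blast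
    ultimately show ?thesis by blast
  qed
  \<comment> \<open>Scaling \<open>y\<close> by \<open>c = e / (2 * norm y)\<close> brings it into the ball, where \<open>2 * real n\<close> bounds the
    approximate preimages; undoing the scaling gives this factor.\<close>
  define C where "C = 4 * real n / e"
  show thesis
  proof
    show "C \<ge> 0" using e by (simp add: C_def)
    fix y assume y: "y \<in> V"
    show "\<exists>x\<in>U. norm x \<le> C * norm y \<and> norm (y - f x) \<le> norm y / 2"
    proof (cases "y = 0")
      case True
      then show ?thesis using subspace_0[OF U] scale[of 0 0] by (intro bexI[of _ 0]) auto
    next
      case False
      define c where "c = e / (2 * norm y)"
      have c: "c > 0" using False e by (simp add: c_def)
      have "c *\<^sub>R y \<in> V" using y subspace_scale[OF V(1)] by blast
      moreover have "norm (c *\<^sub>R y) < e" using c False e by (simp add: c_def)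
      moreover have "c * (norm y / 2) > 0" using c False by simp
      ultimately obtain x where x: "x \<in> U" "norm x \<le> 2 * real n" "norm (c *\<^sub>R y - f x) < c * (norm y / 2)"
        using small[of "c *\<^sub>R y" "c * (norm y / 2)"] by auto
      let ?x = "inverse c *\<^sub>R x"
      have "?x \<in> U" using x subspace_scale[OF U] by blast
      moreover have "norm ?x \<le> C * norm y"
      proof -
        have "norm ?x = inverse c * norm x" using c by simp
        also have "\<dots> \<le> inverse c * (2 * real n)" using c x by (intro mult_left_mono) auto
        also have "\<dots> = C * norm y" using e by (simp add: c_def C_def field_simps)
        finally show ?thesis .
      qed
      moreover have "norm (y - f ?x) \<le> norm y / 2"
      proof -
        have "y - f ?x = inverse c *\<^sub>R (c *\<^sub>R y - f x)"
          using c scale[OF x(1)] by (simp add: algebra_simps)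
        then have "norm (y - f ?x) = inverse c * norm (c *\<^sub>R y - f x)" using c by simp
        also have "\<dots> \<le> inverse c * (c * (norm y / 2))" using c x by (intro mult_left_mono) auto
        also have "\<dots> = norm y / 2" using c by simp
        finally show ?thesis .
      qed
      ultimately show ?thesis by blast
    qed
  qed
qed

text \<open>Iterating the approximation gives a geometric series of preimages, which converges in \<open>U\<close>
  to an exact preimage; injectivity says that it is the given point.\<close>

lemma bounded_inverse:
  fixes f :: "'a::banach \<Rightarrow> 'b::banach"
  assumes U: "subspace U" "closed U"
    and V: "subspace V" "closed V"
    and add: "\<And>x y. x \<in> U \<Longrightarrow> y \<in> U \<Longrightarrow> f (x + y) = f x + f y"
    and scale: "\<And>c x. x \<in> U \<Longrightarrow> f (c *\<^sub>R x) = c *\<^sub>R f x"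
    and cont: "continuous_on U f"
    and bij: "bij_betw f U V"
  obtains C where "C \<ge> 0" and "\<And>x. x \<in> U \<Longrightarrow> norm x \<le> C * norm (f x)"
proof -
  have im: "f ` U = V" and inj: "inj_on f U" using bij by (auto simp: bij_betw_def)
  obtain C where C: "C \<ge> 0"
    "\<And>y. y \<in> V \<Longrightarrow> \<exists>x\<in>U. norm x \<le> C * norm y \<and> norm (y - f x) \<le> norm y / 2"
    using surj_almost_open[OF U(1) V add scale im] by metis
  then obtain g where g: "\<And>y. y \<in> V \<Longrightarrow> g y \<in> U" "\<And>y. y \<in> V \<Longrightarrow> norm (g y) \<le> C * norm y"
    "\<And>y. y \<in> V \<Longrightarrow> norm (y - f (g y)) \<le> norm y / 2"
    by metis
  show thesis
  proof
    show "2 * C \<ge> 0" using C by simp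
    fix x0 assume x0: "x0 \<in> U"
    \<comment> \<open>the defect left after \<open>k\<close> approximation steps\<close>
    define y where "y k = ((\<lambda>y. y - f (g y)) ^^ k) (f x0)" for k
    have y_Suc: "y (Suc k) = y k - f (g (y k))" for k by (simp add: y_def)
    have yV: "y k \<in> V" for k
    proof (induction k)
      case 0 then show ?case using x0 im by (auto simp: y_def)
    next
      case (Suc k)
      then show ?case using g(1) im subspace_diff[OF V(1)] y_Suc by auto
    qed
    have y_bd: "norm (y k) \<le> norm (f x0) * (1/2) ^ k" for k
    proof (induction k)
      case 0 then show ?case by (simp add: y_def)
    next
      case (Suc k)
      then show ?case using g(3)[OF yV[of k]] y_Suc[of k] by simp
    qed
    have g_bd: "norm (g (y k)) \<le> C * norm (f x0) * (1/2) ^ k" for k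
      using g(2)[OF yV[of k]] mult_left_mono[OF y_bd[of k] C(1)] by (simp add: mult.assoc)
    have geo: "(\<lambda>k. C * norm (f x0) * (1/2) ^ k) sums (C * norm (f x0) * 2)"
      using sums_mult[OF geometric_sums[of "1/2::real"], of "C * norm (f x0)"] by simp
    have sm: "summable (\<lambda>k. norm (g (y k)))"
      by (rule summable_comparison_test'[OF sums_summable[OF geo], of 0]) (simp add: g_bd)
    define x where "x = (\<Sum>k. g (y k))"
    have lim: "(\<lambda>n. \<Sum>k<n. g (y k)) \<longlonglongrightarrow> x"
      using summable_norm_cancel[OF sm] summable_LIMSEQ x_def by metis
    have partU: "(\<Sum>k<n. g (y k)) \<in> U" for n
      using g(1) yV by (intro subspace_sum[OF U(1)]) auto
    have xU: "x \<in> U"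
      by (rule closed_sequentially[OF U(2) partU lim])
    have tele: "f (\<Sum>k<n. g (y k)) = f x0 - y n" for n
    proof (induction n)
      case 0
      have "f 0 = 0" using scale[of 0 0] subspace_0[OF U(1)] by simp
      then show ?case by (simp add: y_def)
    next
      case (Suc n)
      then show ?case using add[OF partU g(1)[OF yV[of n]], of n] y_Suc[of n] by simp
    qed
    have "(\<lambda>n. norm (f x0) * (1/2) ^ n) \<longlonglongrightarrow> norm (f x0) * 0"
      by (intro tendsto_intros LIMSEQ_realpow_zero) auto
    then have "y \<longlonglongrightarrow> 0"
      by (intro Lim_null_comparison[of y "\<lambda>n. norm (f x0) * (1/2) ^ n"]) (use y_bd in auto)
    then have "(\<lambda>n. f (\<Sum>k<n. g (y k))) \<longlonglongrightarrow> f x0 - 0"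
      unfolding tele by (intro tendsto_intros)
    moreover have "(\<lambda>n. f (\<Sum>k<n. g (y k))) \<longlonglongrightarrow> f x"
      using continuous_on_tendsto_compose[OF cont lim xU] partU by simp
    ultimately have "f x = f x0" using LIMSEQ_unique by fastforce
    then have "x = x0" using inj x0 xU by (auto simp: inj_on_def)
    moreover have "norm x \<le> (\<Sum>k. C * norm (f x0) * (1/2) ^ k)"
      unfolding x_def by (intro order_trans[OF summable_norm[OF sm]] suminf_le g_bd sm sums_summable[OF geo])
    ultimately show "norm x0 \<le> 2 * C * norm (f x0)"
      using sums_unique[OF geo] by simp
  qed
qed

text \<open>The bounded inverse of addition \<open>U \<times> V \<rightarrow> U + V\<close>.\<close>

lemma direct_sum_component_bounded:
  fixes U V :: "'a::banach set"
  assumes U: "subspace U" "closed U" and V: "subspace V" "closed V"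
    and disj: "U \<inter> V = {0}" and cl: "closed {u + v |u v. u \<in> U \<and> v \<in> V}"
  obtains C where "C \<ge> 0" and "\<And>u v. u \<in> U \<Longrightarrow> v \<in> V \<Longrightarrow> norm u \<le> C * norm (u + v)"
proof -
  let ?W = "{u + v |u v. u \<in> U \<and> v \<in> V}"
  let ?f = "\<lambda>x::'a \<times> 'a. fst x + snd x"
  have sub: "subspace (U \<times> V)" by (rule subspace_Times[OF U(1) V(1)])
  have W: "subspace ?W" by (rule subspace_sums[OF U(1) V(1)])
  have inj: "inj_on ?f (U \<times> V)"
  proof (rule inj_onI, clarsimp)
    fix a b c d assume h: "a \<in> U" "c \<in> U" "b \<in> V" "d \<in> V" "a + b = c + d"
    then have eq: "a - c = d - b" by (simp add: algebra_simps)
    have "a - c \<in> U" using h subspace_diff[OF U(1)] by blast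
    moreover have "a - c \<in> V" unfolding eq using h subspace_diff[OF V(1)] by blast
    ultimately have "a - c = 0" using disj by blast
    then show "a = c \<and> b = d" using eq by simp
  qed
  have bij: "bij_betw ?f (U \<times> V) ?W"
    using inj by (force simp: bij_betw_def)
  obtain C where C: "C \<ge> 0" "\<And>x. x \<in> U \<times> V \<Longrightarrow> norm x \<le> C * norm (?f x)"
    by (rule bounded_inverse[OF sub closed_Times[OF U(2) V(2)] W cl _ _ _ bij])
      (auto simp: algebra_simps intro!: continuous_intros)
  show thesis
  proof (rule that[OF C(1)])
    fix u v assume "u \<in> U" "v \<in> V"
    then show "norm u \<le> C * norm (u + v)"
      using C(2)[of "(u, v)"] norm_fst_le[of u v] by auto
  qed
qed

section \<open>Multilinear mappings\<close>

lemma linear_over_field_scaleR: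
  assumes "normed_space_over s" "normed_space_over s'" "Vector_Spaces.linear s s' f"
  shows "f (c *\<^sub>R x) = c *\<^sub>R f x"
  using module_hom.scale[of s s' f "of_real c" x] assms normed_space_over.scale_of_real
  by (metis linear_iff_module_hom)

lemma multilinear_cong:
  "multilinear s s' n m \<Longrightarrow> (\<And>i. i < n \<Longrightarrow> x i = y i) \<Longrightarrow> m x = m y"
  by (simp add: multilinear_def)

lemma multilinear_upd:
  "multilinear s s' n m \<Longrightarrow> i < n \<Longrightarrow> module_hom s s' (\<lambda>u. m (x(i := u)))"
  by (simp add: multilinear_def linear_iff_module_hom)

lemma multilinear_upd_sum:
  "multilinear s s' n m \<Longrightarrow> i < n \<Longrightarrow> m (x(i := \<Sum>j\<in>J. g j)) = (\<Sum>j\<in>J. m (x(i := g j)))"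
  using module_hom.sum[OF multilinear_upd[of s s' n m i x]] by simp

lemma multilinear_eq_0:
  assumes "multilinear s s' n m" "i < n" "x i = 0"
  shows "m x = 0"
  using module_hom.zero[OF multilinear_upd[OF assms(1,2), of x]] assms(3)
  by (simp add: fun_upd_idem)

lemma sum_PiE_insert:
  assumes "d \<notin> D"
  shows "(\<Sum>\<phi>\<in>PiE (insert d D) J. F \<phi>) = (\<Sum>\<phi>\<in>PiE D J. \<Sum>j\<in>J d. F (\<phi>(d := j)))"
proof -
  have "(\<Sum>\<phi>\<in>PiE (insert d D) J. F \<phi>)
      = (\<Sum>(j, \<phi>)\<in>J d \<times> PiE D J. F (\<phi>(d := j)))"
    unfolding PiE_insert_eq sum.reindex[OF inj_combinator[OF assms]]
    by (simp add: o_def case_prod_unfold)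
  also have "\<dots> = (\<Sum>j\<in>J d. \<Sum>\<phi>\<in>PiE D J. F (\<phi>(d := j)))"
    by (rule sum.cartesian_product[symmetric])
  finally show ?thesis by (simp add: sum.swap[of _ "J d"])
qed

text \<open>Only the arguments with index in \<open>D\<close> are expanded, so that the expansion can be proved one
  argument at a time.\<close>

lemma multilinear_sum_on:
  assumes m: "multilinear s s' n m" and D: "finite D" "D \<subseteq> {..<n}"
  shows "m (\<lambda>i. if i \<in> D then \<Sum>j\<in>J i. y i j else u i)
    = (\<Sum>\<phi>\<in>PiE D J. m (\<lambda>i. if i \<in> D then y i (\<phi> i) else u i))"
  using D
proof (induction D arbitrary: u rule: finite_induct)
  case (insert d D)
  let ?S = "\<Sum>j\<in>J d. y d j"
  have "m (\<lambda>i. if i \<in> insert d D then \<Sum>j\<in>J i. y i j else u i)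
      = m (\<lambda>i. if i \<in> D then \<Sum>j\<in>J i. y i j else (u(d := ?S)) i)"
    by (rule arg_cong[of _ _ m]) (auto simp: fun_eq_iff)
  also have "\<dots> = (\<Sum>\<phi>\<in>PiE D J. m (\<lambda>i. if i \<in> D then y i (\<phi> i) else (u(d := ?S)) i))"
    using insert by simp
  also have "\<dots> = (\<Sum>\<phi>\<in>PiE D J. \<Sum>j\<in>J d. m (\<lambda>i. if i \<in> insert d D then y i ((\<phi>(d := j)) i) else u i))"
  proof (rule sum.cong[OF refl])
    fix \<phi>
    have "m (\<lambda>i. if i \<in> D then y i (\<phi> i) else (u(d := ?S)) i)
        = m ((\<lambda>i. if i \<in> D then y i (\<phi> i) else u i)(d := ?S))"
      using insert by (intro arg_cong[of _ _ m]) auto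
    also have "\<dots> = (\<Sum>j\<in>J d. m ((\<lambda>i. if i \<in> D then y i (\<phi> i) else u i)(d := y d j)))"
      using insert by (intro multilinear_upd_sum[OF m]) auto
    also have "\<dots> = (\<Sum>j\<in>J d. m (\<lambda>i. if i \<in> insert d D then y i ((\<phi>(d := j)) i) else u i))"
      using insert by (intro sum.cong[OF refl] arg_cong[of _ _ m]) auto
    finally show "m (\<lambda>i. if i \<in> D then y i (\<phi> i) else (u(d := ?S)) i) = \<dots>" .
  qed
  also have "\<dots> = (\<Sum>\<phi>\<in>PiE (insert d D) J. m (\<lambda>i. if i \<in> insert d D then y i (\<phi> i) else u i))"
    using insert by (simp add: sum_PiE_insert)
  finally show ?case .
qed simp

lemma multilinear_sum:
  assumes m: "multilinear s s' n m"
  shows "m (\<lambda>i. \<Sum>j\<in>J i. y i j) = (\<Sum>\<phi>\<in>PiE {..<n} J. m (\<lambda>i. y i (\<phi> i)))"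
proof -
  have "m (\<lambda>i. \<Sum>j\<in>J i. y i j) = m (\<lambda>i. if i \<in> {..<n} then \<Sum>j\<in>J i. y i j else undefined)"
    by (rule multilinear_cong[OF m]) simp
  also have "\<dots> = (\<Sum>\<phi>\<in>PiE {..<n} J. m (\<lambda>i. if i \<in> {..<n} then y i (\<phi> i) else undefined))"
    by (rule multilinear_sum_on[OF m]) auto
  also have "\<dots> = (\<Sum>\<phi>\<in>PiE {..<n} J. m (\<lambda>i. y i (\<phi> i)))"
    by (intro sum.cong[OF refl] multilinear_cong[OF m]) simp
  finally show ?thesis .
qed

lemma multilinear_scale:
  assumes m: "multilinear s s' n m" and "vector_space s'"
  shows "m (\<lambda>i. s (c i) (x i)) = s' (\<Prod>i<n. c i) (m x)"
proof -
  interpret vector_space s' by fact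
  have "m (\<lambda>i. if i \<in> D then s (c i) (x i) else x i) = s' (\<Prod>i\<in>D. c i) (m x)"
    if "finite D" "D \<subseteq> {..<n}" for D
    using that
  proof (induction D rule: finite_induct)
    case (insert d D)
    let ?x = "\<lambda>i. if i \<in> D then s (c i) (x i) else x i"
    have "m (\<lambda>i. if i \<in> insert d D then s (c i) (x i) else x i) = m (?x(d := s (c d) (x d)))"
      by (rule arg_cong[of _ _ m]) auto
    also have "\<dots> = s' (c d) (m (?x(d := x d)))"
      using module_hom.scale[OF multilinear_upd[OF m, of d ?x]] insert by simp
    also have "?x(d := x d) = ?x" using insert by auto
    finally show ?case using insert by simp
  qed simp
  from this[of "{..<n}"] show ?thesis
    using multilinear_cong[OF m, of "\<lambda>i. s (c i) (x i)" "\<lambda>i. if i \<in> {..<n} then s (c i) (x i) else x i"]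
    by simp
qed

text \<open>The same insertion serves for the arguments of a multilinear mapping and for the compositions that
  index the terms of a power series; by \<open>ins_comp\<close> the two agree. The positions of \<open>ins i v x\<close> other
  than \<open>i\<close> are enumerated by \<open>skip i\<close>.\<close>

definition ins :: "nat \<Rightarrow> 'a \<Rightarrow> (nat \<Rightarrow> 'a) \<Rightarrow> nat \<Rightarrow> 'a" where
  "ins i v x j = (if j < i then x j else if j = i then v else x (j - 1))"

definition skip :: "nat \<Rightarrow> nat \<Rightarrow> nat" where
  "skip i j = (if j < i then j else Suc j)"

lemma ins_skip [simp]: "ins i v x (skip i j) = x j" and ins_same [simp]: "ins i v x i = v"
  by (auto simp: ins_def skip_def)

lemma ins_const: "ins i v (\<lambda>_. x) = (\<lambda>_. x)(i := v)"
  by (auto simp: ins_def)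

lemma ins_comp: "(\<lambda>j. f (ins i v x j)) = ins i (f v) (\<lambda>j. f (x j))"
  by (auto simp: ins_def)

lemma ins_upd: "ins i v (x(j := u)) = (ins i v x)(skip i j := u)"
  by (auto simp: ins_def skip_def fun_eq_iff)

lemma skip_less: "j < n \<Longrightarrow> skip i j < Suc n"
  by (simp add: skip_def)

lemma bij_betw_skip: "i \<le> n \<Longrightarrow> bij_betw (skip i) {..<n} ({..<Suc n} - {i})"
  by (rule bij_betwI[of _ _ _ "\<lambda>j. if j < i then j else j - 1"]) (auto simp: skip_def split: if_splits)

lemma prod_ins:
  fixes f :: "'a \<Rightarrow> 'c::comm_monoid_mult"
  assumes "i \<le> n"
  shows "(\<Prod>j<Suc n. f (ins i v x j)) = f v * (\<Prod>j<n. f (x j))"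
  using prod.remove[of "{..<Suc n}" i "\<lambda>j. f (ins i v x j)"] assms
    prod.reindex_bij_betw[OF bij_betw_skip[OF assms], of "\<lambda>j. f (ins i v x j)"] by simp

lemma sum_ins:
  fixes f :: "'a \<Rightarrow> 'c::comm_monoid_add"
  assumes "i \<le> n"
  shows "(\<Sum>j<Suc n. f (ins i v x j)) = f v + (\<Sum>j<n. f (x j))"
  using sum.remove[of "{..<Suc n}" i "\<lambda>j. f (ins i v x j)"] assms
    sum.reindex_bij_betw[OF bij_betw_skip[OF assms], of "\<lambda>j. f (ins i v x j)"] by simp

section \<open>Differentiating power series of multilinear mappings\<close>

text \<open>A function \<open>\<phi>\<close> to the truth values stands for a term in the expansion of \<open>m (x + h, \<dots>, x + h)\<close>:
  \<open>\<phi> i\<close> says whether the \<open>i\<close>-th argument is \<open>h\<close>.\<close>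

lemma sum_at_least_two_true:
  fixes f :: "(nat \<Rightarrow> bool) \<Rightarrow> 'c::ab_group_add" and n :: nat
  defines "none \<equiv> restrict (\<lambda>_. False) {..<n}" and "single \<equiv> \<lambda>i. restrict (\<lambda>j. j = i) {..<n}"
  shows "sum f (PiE {..<n} (\<lambda>_. UNIV) - insert none (single ` {..<n}))
    = sum f (PiE {..<n} (\<lambda>_. UNIV)) - f none - (\<Sum>i<n. f (single i))"
proof -
  have sub: "insert none (single ` {..<n}) \<subseteq> PiE {..<n} (\<lambda>_. UNIV)"
    by (auto simp: none_def single_def)
  have fin: "finite (PiE {..<n} (\<lambda>_. UNIV :: bool set))" by (intro finite_PiE) auto
  have at: "single i i" "\<not> none i" "j \<noteq> i \<Longrightarrow> \<not> single j i" if "i < n" for i j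
    using that by (auto simp: single_def none_def)
  have inj: "inj_on single {..<n}"
  proof (rule inj_onI)
    fix i j assume "i \<in> {..<n}" "j \<in> {..<n}" "single i = single j"
    then show "i = j" using at(1)[of i] at(3)[of i j] by auto
  qed
  have nz: "none \<notin> single ` {..<n}"
    using at(1,2) by (metis (no_types, lifting) imageE lessThan_iff)
  show ?thesis
    using sum.subset_diff[OF sub fin, of f] nz sum.reindex[OF inj, of f] by simp
qed

text \<open>Expand \<open>m (x + h, \<dots>, x + h)\<close> by multilinearity. What remains after the terms with at most one
  \<open>h\<close> is bounded term by term by the same remainder of the scalar power \<open>(norm x + norm h) ^ n\<close>.\<close>

lemma multilinear_diagonal_remainder:
  fixes m :: "(nat \<Rightarrow> 'a::real_normed_vector) \<Rightarrow> 'b::real_normed_vector"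
  assumes m: "multilinear s s' n m" and bd: "\<And>x. norm (m x) \<le> c * (\<Prod>i<n. norm (x i))"
  shows "norm (m (\<lambda>_. x + h) - m (\<lambda>_. x) - (\<Sum>i<n. m ((\<lambda>_. x)(i := h))))
    \<le> c * ((norm x + norm h) ^ n - norm x ^ n - real n * norm x ^ (n - 1) * norm h)"
proof -
  define y where "y b = (if b then h else x)" for b
  let ?z = "restrict (\<lambda>_. False) {..<n}" and ?o = "\<lambda>i. restrict (\<lambda>j. j = i) {..<n}"
  define \<Psi> where "\<Psi> = PiE {..<n} (\<lambda>_. UNIV) - insert ?z (?o ` {..<n})"
  let ?m = "\<lambda>\<phi>. m (\<lambda>i. y (\<phi> i))" and ?p = "\<lambda>\<phi>. \<Prod>i<n. norm (y (\<phi> i))"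
  have "m (\<lambda>_. x + h) = m (\<lambda>i. \<Sum>b\<in>UNIV. y b)" by (simp add: UNIV_bool y_def add.commute)
  also have "\<dots> = (\<Sum>\<phi>\<in>PiE {..<n} (\<lambda>_. UNIV). ?m \<phi>)" by (rule multilinear_sum[OF m])
  finally have m1: "m (\<lambda>_. x + h) = (\<Sum>\<phi>\<in>PiE {..<n} (\<lambda>_. UNIV). ?m \<phi>)" .
  have m2: "m (\<lambda>_. x) = ?m ?z" and m3: "m ((\<lambda>_. x)(i := h)) = ?m (?o i)" for i
    by (auto intro!: multilinear_cong[OF m] simp: y_def)
  have "(norm x + norm h) ^ n = (\<Prod>i<n. \<Sum>b\<in>UNIV. norm (y b))"
    by (simp add: UNIV_bool y_def add.commute)
  also have "\<dots> = (\<Sum>\<phi>\<in>PiE {..<n} (\<lambda>_. UNIV). ?p \<phi>)" by (rule prod_sum_PiE) auto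
  finally have p1: "(norm x + norm h) ^ n = (\<Sum>\<phi>\<in>PiE {..<n} (\<lambda>_. UNIV). ?p \<phi>)" .
  have p2: "norm x ^ n = ?p ?z" by (simp add: y_def)
  have p3: "norm x ^ (n - 1) * norm h = ?p (?o i)" if "i < n" for i
  proof -
    have "?p (?o i) = (\<Prod>j<n. if j = i then norm h else norm x)"
      by (rule prod.cong) (auto simp: y_def)
    also have "\<dots> = norm h * (\<Prod>j\<in>{..<n} - {i}. if j = i then norm h else norm x)"
      using that by (subst prod.remove[of _ i]) auto
    also have "(\<Prod>j\<in>{..<n} - {i}. if j = i then norm h else norm x) = (\<Prod>j\<in>{..<n} - {i}. norm x)"
      by (rule prod.cong) auto
    also have "\<dots> = norm x ^ (n - 1)" using that by simp
    finally show ?thesis by simp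
  qed
  have "real n * norm x ^ (n - 1) * norm h = (\<Sum>i<n. norm x ^ (n - 1) * norm h)" by simp
  also have "\<dots> = (\<Sum>i<n. ?p (?o i))" using p3 by (intro sum.cong) auto
  finally have p4: "real n * norm x ^ (n - 1) * norm h = (\<Sum>i<n. ?p (?o i))" .
  have "norm (sum ?m \<Psi>) \<le> (\<Sum>\<phi>\<in>\<Psi>. c * ?p \<phi>)" by (rule sum_norm_le) (rule bd)
  also have "\<dots> = c * sum ?p \<Psi>" by (simp add: sum_distrib_left)
  finally show ?thesis
    using sum_at_least_two_true[of ?m n] sum_at_least_two_true[of ?p n]
    unfolding \<Psi>_def m1 m2 m3 p1 p2 p4 by simp
qed

lemma multilinear_upd_bound:
  fixes m :: "(nat \<Rightarrow> 'a::real_normed_vector) \<Rightarrow> 'b::real_normed_vector"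
  assumes bd: "\<And>x. norm (m x) \<le> c * (\<Prod>i<n. norm (x i))"
  shows "norm (\<Sum>i<n. m ((\<lambda>_. x)(i := h))) \<le> real n * c * norm x ^ (n - 1) * norm h"
proof -
  have "norm (m ((\<lambda>_. x)(i := h))) \<le> c * norm x ^ (n - 1) * norm h" if "i < n" for i
  proof -
    have "(\<Prod>j<n. norm (((\<lambda>_. x)(i := h)) j)) = norm h * (\<Prod>j\<in>{..<n} - {i}. norm (((\<lambda>_. x)(i := h)) j))"
      using that by (subst prod.remove[of _ i]) auto
    also have "(\<Prod>j\<in>{..<n} - {i}. norm (((\<lambda>_. x)(i := h)) j)) = (\<Prod>j\<in>{..<n} - {i}. norm x)"
      by (rule prod.cong) auto
    also have "\<dots> = norm x ^ (n - 1)" using that by simp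
    finally show ?thesis using bd[of "(\<lambda>_. x)(i := h)"] by (simp add: mult_ac)
  qed
  then have "norm (\<Sum>i<n. m ((\<lambda>_. x)(i := h))) \<le> (\<Sum>i<n. c * norm x ^ (n - 1) * norm h)"
    by (intro sum_norm_le) auto
  then show ?thesis by simp
qed

text \<open>The numbers \<open>c n\<close> are the coefficients of a scalar majorant. The locale is used for \<open>G\<close> itself, for
  the derivative of \<open>G\<close> in a fixed direction, and for power series in one scalar variable.\<close>

locale multilinear_power_series = s: normed_space_over s + s': normed_space_over s'
  for s :: "'k::real_normed_field \<Rightarrow> 'a::real_normed_vector \<Rightarrow> 'a"
    and s' :: "'k \<Rightarrow> 'b::banach \<Rightarrow> 'b" +
  fixes a :: "nat \<Rightarrow> (nat \<Rightarrow> 'a) \<Rightarrow> 'b" and c :: "nat \<Rightarrow> real" and r :: real and F :: "'a \<Rightarrow> 'b"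
  assumes ml: "\<And>n. multilinear s s' n (a n)"
    and bd: "\<And>n x. norm (a n x) \<le> c n * (\<Prod>i<n. norm (x i))"
    and sm: "\<And>t. \<bar>t\<bar> < r \<Longrightarrow> summable (\<lambda>n. c n * t ^ n)"
    and r: "r > 0"
    and F: "\<And>x. norm x < r \<Longrightarrow> (\<lambda>n. a n (\<lambda>_. x)) sums F x"

text \<open>The remainder of the series is dominated by that of the scalar power series
  \<open>\<Sum>n. c n * t ^ n\<close> at \<open>t = norm x\<close>, so its differentiability is inherited.\<close>

lemma (in multilinear_power_series) has_derivative_termwise:
  assumes x: "norm x < r"
  shows "(F has_derivative (\<lambda>h. \<Sum>n. \<Sum>i<n. a n ((\<lambda>_. x)(i := h)))) (at x)"
    and "summable (\<lambda>n. \<Sum>i<n. a n ((\<lambda>_. x)(i := h)))"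
proof -
  define X where "X = norm x"
  define D where "D n h = (\<Sum>i<n. a n ((\<lambda>_. x)(i := h)))" for n h
  define g where "g t = (\<Sum>n. c n * t ^ n)" for t
  define g' where "g' = (\<Sum>n. diffs c n * X ^ n)"
  have "summable (\<lambda>n. diffs c n * X ^ n)"
    by (rule termdiff_converges[of _ r]) (use sm x in \<open>auto simp: X_def\<close>)
  from diffs_equiv[OF this] have g': "(\<lambda>n. real n * c n * X ^ (n - 1)) sums g'"
    by (simp add: g'_def)
  have D_bd: "norm (D n h) \<le> real n * c n * X ^ (n - 1) * norm h" for n h
    unfolding D_def X_def by (rule multilinear_upd_bound[OF bd])
  have D_sm: "summable (\<lambda>n. D n h)" for h
    by (rule summable_comparison_test'[OF summable_mult2[OF sums_summable[OF g']], of 0])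
      (rule D_bd)
  then show "summable (\<lambda>n. \<Sum>i<n. a n ((\<lambda>_. x)(i := h)))" by (simp add: D_def)
  have lin: "module_hom s s' (D n)" for n
    unfolding D_def
  proof (rule module_hom.intro)
    show "module s" "module s'" by (rule s.module_axioms s'.module_axioms)+
    show "module_hom_axioms s s' (\<lambda>h. \<Sum>i<n. a n ((\<lambda>_. x)(i := h)))"
      by unfold_locales
        (auto simp: sum.distrib module_hom.add[OF multilinear_upd[OF ml]]
          module_hom.scale[OF multilinear_upd[OF ml]] s'.scale_sum_right)
  qed
  have "bounded_linear (\<lambda>h. \<Sum>n. D n h)"
  proof (rule bounded_linear_intro[where K = g'])
    fix u v
    show "(\<Sum>n. D n (u + v)) = (\<Sum>n. D n u) + (\<Sum>n. D n v)"
      using suminf_add[OF D_sm D_sm] module_hom.add[OF lin] by simp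
    fix t :: real
    show "(\<Sum>n. D n (t *\<^sub>R u)) = t *\<^sub>R (\<Sum>n. D n u)"
      using suminf_scaleR_right[OF D_sm[of u], of t]
        linear_over_field_scaleR[OF s.normed_space_over_axioms s'.normed_space_over_axioms lin[unfolded module_hom_iff_linear]] by simp
    show "norm (\<Sum>n. D n u) \<le> norm u * g'"
      using norm_sums_le[OF summable_sums[OF D_sm] sums_mult2[OF g', of "norm u"] D_bd]
      by (simp add: mult.commute)
  qed
  moreover have "(\<lambda>h. norm (F (x + h) - F x - (\<Sum>n. D n h)) / norm h) \<midarrow>0\<rightarrow> 0"
  proof -
    have dg: "(g has_field_derivative g') (at X)"
      unfolding g_def g'_def by (rule termdiffs_strong'[of r]) (use sm x in \<open>auto simp: X_def\<close>)
    then have "(\<lambda>u. (g (X + u) - g X) / u) \<midarrow>0\<rightarrow> g'" by (simp add: DERIV_def)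
    moreover have "filterlim (\<lambda>h::'a. norm h) (at 0) (at 0)"
      unfolding filterlim_at using tendsto_norm_zero[OF tendsto_ident_at] by (auto simp: eventually_at_filter)
    ultimately have "(\<lambda>h::'a. (g (X + norm h) - g X) / norm h) \<midarrow>0\<rightarrow> g'"
      by (rule filterlim_compose)
    then have lim: "(\<lambda>h::'a. (g (X + norm h) - g X) / norm h - g') \<midarrow>0\<rightarrow> 0"
      using LIM_zero by blast
    have bound: "norm (F (x + h) - F x - (\<Sum>n. D n h)) / norm h \<le> (g (X + norm h) - g X) / norm h - g'"
      if h: "h \<noteq> 0" "norm h < r - X" for h
    proof -
      have xh: "norm (x + h) < r" using norm_triangle_ineq[of x h] h by (simp add: X_def)
      have gs: "(\<lambda>n. c n * t ^ n) sums g t" if "\<bar>t\<bar> < r" for t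
        using sm[OF that] by (simp add: g_def summable_sums)
      have "(\<lambda>n. a n (\<lambda>_. x + h) - a n (\<lambda>_. x) - D n h) sums (F (x + h) - F x - (\<Sum>n. D n h))"
        by (intro sums_diff F xh x summable_sums D_sm)
      moreover have "(\<lambda>n. c n * (X + norm h) ^ n - c n * X ^ n - real n * c n * X ^ (n - 1) * norm h)
          sums (g (X + norm h) - g X - g' * norm h)"
        by (intro sums_diff gs sums_mult2 g') (use h x in \<open>auto simp: X_def\<close>)
      ultimately have "norm (F (x + h) - F x - (\<Sum>n. D n h)) \<le> g (X + norm h) - g X - g' * norm h"
      proof (rule norm_sums_le)
        fix n
        show "norm (a n (\<lambda>_. x + h) - a n (\<lambda>_. x) - D n h)
            \<le> c n * (X + norm h) ^ n - c n * X ^ n - real n * c n * X ^ (n - 1) * norm h"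
          using multilinear_diagonal_remainder[OF ml bd, of n x h] by (simp add: D_def X_def algebra_simps del: fun_upd_apply)
      qed
      then show ?thesis using h by (simp add: field_simps)
    qed
    show ?thesis
    proof (rule Lim_null_comparison[OF _ lim])
      have "\<forall>\<^sub>F h in at (0::'a). h \<noteq> 0 \<and> norm h < r - X"
        unfolding eventually_at using x by (intro exI[of _ "r - X"]) (auto simp: X_def)
      then show "\<forall>\<^sub>F h in at 0. norm (norm (F (x + h) - F x - (\<Sum>n. D n h)) / norm h)
          \<le> (g (X + norm h) - g X) / norm h - g'"
        by eventually_elim (use bound in simp)
    qed
  qed
  ultimately have "(F has_derivative (\<lambda>h. \<Sum>n. D n h)) (at x)"
    by (simp add: has_derivative_at)
  then show "(F has_derivative (\<lambda>h. \<Sum>n. \<Sum>i<n. a n ((\<lambda>_. x)(i := h)))) (at x)"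
    by (simp add: D_def)
qed

section \<open>Power series of a scalar variable with vector coefficients\<close>

text \<open>Normal convergence is part of the notion, since it is what survives differentiation term by term;
  by \<open>expands_asI\<close> below it comes for free.\<close>

definition expands_as ::
  "('k::real_normed_field \<Rightarrow> 'b::real_normed_vector \<Rightarrow> 'b) \<Rightarrow> real \<Rightarrow> ('k \<Rightarrow> 'b) \<Rightarrow> (nat \<Rightarrow> 'b) \<Rightarrow> bool" where
  "expands_as s r f c \<longleftrightarrow> (\<forall>\<epsilon>. norm \<epsilon> < r \<longrightarrow>
     summable (\<lambda>m. norm (c m) * norm \<epsilon> ^ m) \<and> (\<lambda>m. s (\<epsilon> ^ m) (c m)) sums f \<epsilon>)"

lemma norm_term_le:
  assumes "normed_space_over s"
  shows "norm (s (\<epsilon> ^ m) c) = norm c * norm \<epsilon> ^ m"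
  using assms by (simp add: normed_space_over.norm_scale norm_power mult.commute)

lemma expands_as_summable:
  fixes s :: "'k::real_normed_field \<Rightarrow> 'b::real_normed_vector \<Rightarrow> 'b"
  assumes f: "expands_as s r f c" and t: "\<bar>t\<bar> < r"
  shows "summable (\<lambda>n. norm (c n) * t ^ n)"
proof (rule summable_norm_cancel)
  have "norm (of_real t :: 'k) < r" using t by simp
  then have "summable (\<lambda>n. norm (c n) * norm (of_real t :: 'k) ^ n)"
    using f unfolding expands_as_def by blast
  then show "summable (\<lambda>n. norm (norm (c n) * t ^ n))"
    by (simp add: abs_mult power_abs)
qed

text \<open>The scalar field is a space over itself, and \<open>\<epsilon>\<^sub>1, \<dots>, \<epsilon>\<^sub>m \<mapsto> (\<epsilon>\<^sub>1 \<cdots> \<epsilon>\<^sub>m) c m\<close> is multilinear, so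
  differentiating a series in \<open>\<epsilon>\<close> term by term is an instance of differentiating a power series
  of multilinear mappings.\<close>

lemma expands_as_has_derivative:
  fixes s :: "'k::real_normed_field \<Rightarrow> 'b::banach \<Rightarrow> 'b"
  assumes s: "normed_space_over s" and f: "expands_as s r f c" and e: "norm \<epsilon> < r"
  shows "\<exists>D. (\<lambda>m. s (\<epsilon> ^ m) (s (of_nat (Suc m)) (c (Suc m)))) sums D \<and>
    (f has_derivative (\<lambda>h. s h D)) (at \<epsilon>)"
proof -
  interpret vector_space s using s by (rule normed_space_over.axioms)
  have vk: "vector_space ((*) :: 'k \<Rightarrow> 'k \<Rightarrow> 'k)"
    by unfold_locales (auto simp: algebra_simps)
  have k: "normed_space_over ((*) :: 'k \<Rightarrow> 'k \<Rightarrow> 'k)"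
    by unfold_locales (auto simp: norm_mult scaleR_conv_of_real)
  define a where "a m x = s (\<Prod>i<m. x i) (c m)" for m and x :: "nat \<Rightarrow> 'k"
  have upd: "(\<Prod>j<m. (x(i := u)) j) = u * (\<Prod>j\<in>{..<m} - {i}. x j)" if "i < m" for m i u and x :: "nat \<Rightarrow> 'k"
  proof -
    have "(\<Prod>j<m. (x(i := u)) j) = u * (\<Prod>j\<in>{..<m} - {i}. (x(i := u)) j)"
      using that by (subst prod.remove[of _ i]) auto
    also have "(\<Prod>j\<in>{..<m} - {i}. (x(i := u)) j) = (\<Prod>j\<in>{..<m} - {i}. x j)"
      by (rule prod.cong) auto
    finally show ?thesis .
  qed
  have ml: "multilinear (*) s m (a m)" for m
    unfolding multilinear_def
  proof (intro conjI allI impI)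
    fix x y :: "nat \<Rightarrow> 'k" assume "\<forall>i<m. x i = y i"
    then show "a m x = a m y" by (simp add: a_def)
  next
    fix i x assume "i < m"
    then show "Vector_Spaces.linear (*) s (\<lambda>u. a m (x(i := u)))"
      unfolding a_def upd[OF \<open>i < m\<close>]
      by (simp add: Vector_Spaces.linear_iff vk vector_space_axioms algebra_simps)
  qed
  have bd: "norm (a m x) \<le> norm (c m) * (\<Prod>i<m. norm (x i))" for m x
    by (simp add: a_def normed_space_over.norm_scale[OF s] prod_norm mult.commute)
  have sm: "summable (\<lambda>n. norm (c n) * t ^ n)" if "\<bar>t\<bar> < r" for t
    using expands_as_summable[OF f that] .
  have F: "(\<lambda>m. a m (\<lambda>_. x)) sums f x" if "norm x < r" for x
    using f that by (simp add: a_def expands_as_def)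
  define D where "D = (\<Sum>m. s (\<epsilon> ^ m) (s (of_nat (Suc m)) (c (Suc m))))"
  have direction: "(\<Sum>i<Suc m. a (Suc m) ((\<lambda>_. \<epsilon>)(i := h)))
      = s h (s (\<epsilon> ^ m) (s (of_nat (Suc m)) (c (Suc m))))" for m h
  proof -
    have "a (Suc m) ((\<lambda>_. \<epsilon>)(i := h)) = s (h * \<epsilon> ^ m) (c (Suc m))" if "i < Suc m" for i
      unfolding a_def upd[OF that] using that by simp
    then have "(\<Sum>i<Suc m. a (Suc m) ((\<lambda>_. \<epsilon>)(i := h))) = (\<Sum>i<Suc m. s (h * \<epsilon> ^ m) (c (Suc m)))"
      by (intro sum.cong) auto
    also have "\<dots> = s (of_nat (Suc m)) (s (h * \<epsilon> ^ m) (c (Suc m)))"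
      unfolding sum_constant_scale by simp
    finally show ?thesis by (simp add: mult_ac)
  qed
  have "multilinear_power_series (*) s a (\<lambda>m. norm (c m)) r f"
    by (intro multilinear_power_series.intro multilinear_power_series_axioms.intro k s ml bd sm F)
      (use le_less_trans[OF norm_ge_zero e] in auto)
  note pd = multilinear_power_series.has_derivative_termwise[OF this e]
  have sums: "(\<lambda>m. \<Sum>i<Suc m. a (Suc m) ((\<lambda>_. \<epsilon>)(i := h))) sums (\<Sum>m. \<Sum>i<m. a m ((\<lambda>_. \<epsilon>)(i := h)))" for h
    using summable_sums[OF pd(2), of h] by (subst sums_Suc_iff) simp
  have D: "(\<lambda>m. s (\<epsilon> ^ m) (s (of_nat (Suc m)) (c (Suc m)))) sums D"
    using sums_summable[OF sums[of 1]] unfolding direction D_def by (simp add: summable_sums)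
  have lin: "bounded_linear (s h)" for h
    by (rule bounded_linear_intro[of _ "norm h"])
      (auto simp: algebra_simps normed_space_over.norm_scale[OF s]
        normed_space_over.scale_of_real[OF s, symmetric])
  have "(\<Sum>m. \<Sum>i<m. a m ((\<lambda>_. \<epsilon>)(i := h))) = s h D" for h
    using bounded_linear.sums[OF lin D, of h] sums[of h] sums_unique2 unfolding direction by blast
  then show ?thesis using pd(1) D by auto
qed

lemma expands_as_curve_deriv:
  fixes s :: "'k::real_normed_field \<Rightarrow> 'b::banach \<Rightarrow> 'b"
  assumes s: "normed_space_over s" and f: "expands_as s r f c"
  shows "expands_as s r (curve_deriv s f) (\<lambda>m. s (of_nat (Suc m)) (c (Suc m)))"
  unfolding expands_as_def
proof (intro allI impI conjI)
  fix \<epsilon> :: 'k assume e: "norm \<epsilon> < r"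
  interpret vector_space s using s by (rule normed_space_over.axioms)
  obtain D where D: "(\<lambda>m. s (\<epsilon> ^ m) (s (of_nat (Suc m)) (c (Suc m)))) sums D"
    "(f has_derivative (\<lambda>h. s h D)) (at \<epsilon>)"
    using expands_as_has_derivative[OF s f e] by blast
  have "D' = D" if "(f has_derivative (\<lambda>h. s h D')) (at \<epsilon>)" for D'
    using fun_cong[OF has_derivative_unique[OF that D(2)], of 1] by simp
  then have "curve_deriv s f \<epsilon> = D" unfolding curve_deriv_def using D(2) by blast
  then show "(\<lambda>m. s (\<epsilon> ^ m) (s (of_nat (Suc m)) (c (Suc m)))) sums curve_deriv s f \<epsilon>"
    using D(1) by simp
  have "summable (\<lambda>m. diffs (\<lambda>m. norm (c m)) m * norm \<epsilon> ^ m)"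
  proof (rule termdiff_converges[of _ r])
    show "norm (norm \<epsilon>) < r" using e by simp
    fix t :: real assume "norm t < r"
    then show "summable (\<lambda>n. norm (c n) * t ^ n)"
      using expands_as_summable[OF f] by simp
  qed
  then show "summable (\<lambda>m. norm (s (of_nat (Suc m)) (c (Suc m))) * norm \<epsilon> ^ m)"
    by (simp add: diffs_def normed_space_over.norm_scale[OF s] del: of_nat_Suc)
qed

lemma expands_as_iterated_deriv_0:
  fixes s :: "'k::real_normed_field \<Rightarrow> 'b::banach \<Rightarrow> 'b"
  assumes s: "normed_space_over s" and r: "r > 0" and f: "expands_as s r f c"
  shows "(curve_deriv s ^^ i) f 0 = s (fact i) (c i)"
proof -
  interpret vector_space s using s by (rule normed_space_over.axioms)
  have "expands_as s r ((curve_deriv s ^^ i) f) (\<lambda>m. s (fact (m + i) / fact m) (c (m + i)))"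
  proof (induction i)
    case 0
    then show ?case using f by simp
  next
    case (Suc i)
    have "of_nat (Suc m) * (fact (Suc m + i) / fact (Suc m)) = (fact (m + Suc i) / fact m :: 'k)" for m
      by (simp add: field_simps del: of_nat_Suc)
    then have "s (of_nat (Suc m)) (s (fact (Suc m + i) / fact (Suc m)) (c (Suc m + i)))
        = s (fact (m + Suc i) / fact m) (c (m + Suc i))" for m
      by (simp only: scale_scale add_Suc add_Suc_right)
    then show ?case using expands_as_curve_deriv[OF s Suc] by (simp only: funpow.simps o_apply)
  qed
  then have "(\<lambda>m. s (0 ^ m) (s (fact (m + i) / fact m) (c (m + i)))) sums (curve_deriv s ^^ i) f 0"
    using r by (simp add: expands_as_def)
  moreover have "(\<lambda>m. s (0 ^ m) (s (fact (m + i) / fact m) (c (m + i)))) sums (s (fact i) (c i))"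
  proof -
    have "(\<lambda>m. s (0 ^ m) (s (fact (m + i) / fact m) (c (m + i))))
        = (\<lambda>m. if m = 0 then s (fact i) (c i) else 0)"
      by (auto simp: fun_eq_iff)
    then show ?thesis using sums_single[of 0 "\<lambda>_. s (fact i) (c i)"] by simp
  qed
  ultimately show ?thesis using sums_unique2 by blast
qed

lemma expands_as_unique:
  fixes s :: "'k::real_normed_field \<Rightarrow> 'b::banach \<Rightarrow> 'b"
  assumes s: "normed_space_over s" and "r > 0" "expands_as s r f c" "r' > 0" "expands_as s r' f c'"
  shows "c = c'"
proof
  interpret vector_space s using s by (rule normed_space_over.axioms)
  fix i
  have "s (fact i) (c i) = s (fact i) (c' i)"
    using expands_as_iterated_deriv_0[OF s] assms by metis
  then show "c i = c' i" by simp
qed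

text \<open>Convergence at points of the disc alone already gives normal convergence: the terms at a
  larger real point are bounded.\<close>

lemma expands_asI:
  fixes s :: "'k::real_normed_field \<Rightarrow> 'b::banach \<Rightarrow> 'b"
  assumes s: "normed_space_over s" and f: "\<And>\<epsilon>. norm \<epsilon> < r \<Longrightarrow> (\<lambda>m. s (\<epsilon> ^ m) (c m)) sums f \<epsilon>"
  shows "expands_as s r f c"
  unfolding expands_as_def
proof (intro allI impI conjI)
  fix \<epsilon> :: 'k assume e: "norm \<epsilon> < r"
  then show "(\<lambda>m. s (\<epsilon> ^ m) (c m)) sums f \<epsilon>" by (rule f)
  obtain t where t: "norm \<epsilon> < t" "t < r" using e dense by blast
  then have t0: "t > 0" using norm_ge_zero[of \<epsilon>] by linarith
  have "summable (\<lambda>m. s (of_real t ^ m) (c m))"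
    using f[of "of_real t"] t t0 sums_summable by auto
  then obtain M where M: "\<And>m. norm (s (of_real t ^ m) (c m)) \<le> M"
    using summable_imp_Bseq BseqE by metis
  have "summable (\<lambda>m. M * (norm \<epsilon> / t) ^ m)"
    using t t0 by (intro summable_mult summable_geometric) auto
  then show "summable (\<lambda>m. norm (c m) * norm \<epsilon> ^ m)"
  proof (rule summable_comparison_test'[of _ 0])
    fix m
    have "norm (c m) * norm \<epsilon> ^ m = norm (c m) * t ^ m * (norm \<epsilon> / t) ^ m"
      using t0 by (simp add: power_divide)
    also have "\<dots> \<le> M * (norm \<epsilon> / t) ^ m"
      using M[of m] t0 by (intro mult_right_mono) (auto simp: norm_term_le[OF s])
    finally show "norm (norm (c m) * norm \<epsilon> ^ m) \<le> M * (norm \<epsilon> / t) ^ m" by simp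
  qed
qed

section \<open>Rearranging by degree\<close>

text \<open>A family of vectors is grouped in two ways into finite blocks: by the order \<open>N\<close> of the multilinear
  term that it comes from, and by its degree \<open>d\<close> in the scalar variable. The first grouping is the
  one in which convergence is known; absolute summability transfers it to the second.\<close>

lemma abs_summable_on_blocks:
  fixes t :: "'i \<Rightarrow> 'b::banach" and N :: "'i \<Rightarrow> nat"
  assumes fin: "\<And>n. finite {i \<in> I. N i = n}"
    and B: "\<And>n. (\<Sum>i\<in>{i \<in> I. N i = n}. norm (t i)) \<le> B n" "summable B"
  shows "t abs_summable_on I"
proof (rule nonneg_bdd_above_summable_on)
  have B0: "B n \<ge> 0" for n using order_trans[OF sum_nonneg B(1)[of n]] by simp
  have "sum (\<lambda>i. norm (t i)) F \<le> suminf B" if F: "finite F" "F \<subseteq> I" for F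
  proof -
    have "(\<Sum>i\<in>F. norm (t i)) = (\<Sum>n\<in>N ` F. \<Sum>i\<in>{i \<in> F. N i = n}. norm (t i))"
      by (rule sum.image_gen[OF F(1)])
    also have "\<dots> \<le> (\<Sum>n\<in>N ` F. B n)"
    proof (rule sum_mono)
      fix n
      have "(\<Sum>i\<in>{i \<in> F. N i = n}. norm (t i)) \<le> (\<Sum>i\<in>{i \<in> I. N i = n}. norm (t i))"
        using F by (intro sum_mono2 fin) auto
      then show "(\<Sum>i\<in>{i \<in> F. N i = n}. norm (t i)) \<le> B n" using B(1) order_trans by blast
    qed
    also have "\<dots> \<le> suminf B" using F B0 by (intro sum_le_suminf B(2)) auto
    finally show ?thesis .
  qed
  then show "bdd_above (sum (\<lambda>i. norm (t i)) ` {F. F \<subseteq> I \<and> finite F})"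
    by (intro bdd_aboveI[of _ "suminf B"]) auto
qed simp

lemma abs_summable_on_sums_fibres:
  fixes t :: "'i \<Rightarrow> 'b::banach" and d :: "'i \<Rightarrow> nat"
  assumes t: "t abs_summable_on I" and fin: "\<And>m. finite {i \<in> I. d i = m}"
  shows "(\<lambda>m. \<Sum>i\<in>{i \<in> I. d i = m}. t i) sums (infsum t I)"
proof -
  let ?S = "Sigma UNIV (\<lambda>m. {i \<in> I. d i = m})"
  have "bij_betw snd ?S I"
    by (rule bij_betwI[of _ _ _ "\<lambda>i. (d i, i)"]) auto
  moreover have "(t has_sum infsum t I) I" using t abs_summable_summable has_sum_infsum by blast
  ultimately have hs: "((\<lambda>p. t (snd p)) has_sum infsum t I) ?S"
    by (subst has_sum_reindex_bij_betw)
  have "((\<lambda>m. \<Sum>i\<in>{i \<in> I. d i = m}. t i) has_sum infsum t I) UNIV"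
    by (rule has_sum_Sigma[OF isUCont_plus hs]) (use fin in \<open>auto intro!: has_sum_finite\<close>)
  then show ?thesis by (rule has_sum_imp_sums)
qed

lemma expands_as_by_degree:
  fixes s :: "'k::real_normed_field \<Rightarrow> 'b::banach \<Rightarrow> 'b" and N d :: "'i \<Rightarrow> nat"
  assumes s: "normed_space_over s"
    and fin: "\<And>n. finite {i \<in> I. N i = n}" "\<And>m. finite {i \<in> I. d i = m}"
    and B: "\<And>n. (\<Sum>i\<in>{i \<in> I. N i = n}. norm (t i) * r ^ d i) \<le> B n" "summable B"
    and f: "\<And>\<epsilon>. norm \<epsilon> < r \<Longrightarrow> (\<lambda>n. \<Sum>i\<in>{i \<in> I. N i = n}. s (\<epsilon> ^ d i) (t i)) sums f \<epsilon>"
  shows "expands_as s r f (\<lambda>m. \<Sum>i\<in>{i \<in> I. d i = m}. t i)"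
proof (rule expands_asI[OF s])
  interpret vector_space s using s by (rule normed_space_over.axioms)
  fix \<epsilon> :: 'k assume e: "norm \<epsilon> < r"
  have "(\<Sum>i\<in>{i \<in> I. N i = n}. norm (s (\<epsilon> ^ d i) (t i))) \<le> B n" for n
  proof -
    have "(\<Sum>i\<in>{i \<in> I. N i = n}. norm (s (\<epsilon> ^ d i) (t i))) \<le> (\<Sum>i\<in>{i \<in> I. N i = n}. norm (t i) * r ^ d i)"
      using e by (intro sum_mono) (auto simp: norm_term_le[OF s] intro!: mult_left_mono power_mono)
    then show ?thesis using B(1) order_trans by blast
  qed
  then have as: "(\<lambda>i. s (\<epsilon> ^ d i) (t i)) abs_summable_on I"
    by (rule abs_summable_on_blocks[OF fin(1) _ B(2)])
  have "f \<epsilon> = infsum (\<lambda>i. s (\<epsilon> ^ d i) (t i)) I"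
    using abs_summable_on_sums_fibres[OF as fin(1)] f[OF e] sums_unique2 by blast
  moreover have "(\<Sum>i\<in>{i \<in> I. d i = m}. s (\<epsilon> ^ d i) (t i)) = s (\<epsilon> ^ m) (\<Sum>i\<in>{i \<in> I. d i = m}. t i)" for m
    by (simp add: scale_sum_right)
  ultimately show "(\<lambda>m. s (\<epsilon> ^ m) (\<Sum>i\<in>{i \<in> I. d i = m}. t i)) sums f \<epsilon>"
    using abs_summable_on_sums_fibres[OF as fin(2)] by simp
qed

section \<open>Coefficients of an analytic mapping along a curve\<close>

text \<open>A composition of \<open>m\<close> into \<open>n\<close> positive parts selects, in the \<open>n\<close>-linear term of a power series, a
  coefficient of the curve for each argument, with total degree \<open>m\<close>. The functions are extensional so
  that each composition occurs once.\<close>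

definition compositions :: "nat \<Rightarrow> (nat \<times> (nat \<Rightarrow> nat)) set" where
  "compositions m = {(n, \<phi>). \<phi> \<in> PiE {..<n} (\<lambda>_. {1..}) \<and> (\<Sum>i<n. \<phi> i) = m}"

lemma compositionsD:
  assumes "(n, \<phi>) \<in> compositions m"
  shows "\<And>i. i < n \<Longrightarrow> 1 \<le> \<phi> i" "\<And>i. i < n \<Longrightarrow> \<phi> i \<le> m" "n \<le> m" "\<phi> \<in> extensional {..<n}"
    "(\<Sum>i<n. \<phi> i) = m"
proof -
  show 1: "1 \<le> \<phi> i" if "i < n" for i using assms that by (auto simp: compositions_def)
  show sum: "(\<Sum>i<n. \<phi> i) = m" and "\<phi> \<in> extensional {..<n}"
    using assms by (auto simp: compositions_def PiE_def)
  show "\<phi> i \<le> m" if "i < n" for i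
    using member_le_sum[of i "{..<n}" \<phi>] that sum by simp
  have "(\<Sum>i<n. 1) \<le> (\<Sum>i<n. \<phi> i)" using 1 by (intro sum_mono) auto
  then show "n \<le> m" using sum by simp
qed

lemma finite_compositions: "finite (compositions m)"
proof (rule finite_subset)
  show "compositions m \<subseteq> Sigma {..m} (\<lambda>n. PiE {..<n} (\<lambda>_. {..m}))"
  proof
    fix p assume "p \<in> compositions m"
    moreover obtain n \<phi> where "p = (n, \<phi>)" by (cases p)
    ultimately show "p \<in> Sigma {..m} (\<lambda>n. PiE {..<n} (\<lambda>_. {..m}))"
      using compositionsD[of n \<phi> m] by (auto simp: PiE_def)
  qed
  show "finite (Sigma {..m} (\<lambda>n. PiE {..<n} (\<lambda>_. {..m})))"
    by (intro finite_SigmaI finite_PiE) auto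
qed

text \<open>The coefficient of \<open>\<epsilon> ^ m\<close> in \<open>\<Sum>n. a n (x(\<epsilon>), \<dots>, x(\<epsilon>))\<close> for \<open>x(\<epsilon>) = \<Sum>j. \<epsilon> ^ j y j\<close>.\<close>

definition series_coeff :: "(nat \<Rightarrow> (nat \<Rightarrow> 'a) \<Rightarrow> 'b::comm_monoid_add) \<Rightarrow> (nat \<Rightarrow> 'a) \<Rightarrow> nat \<Rightarrow> 'b" where
  "series_coeff a y m = (\<Sum>(n, \<phi>)\<in>compositions m. a n (\<lambda>i. y (\<phi> i)))"

lemma series_coeff_cong:
  assumes "\<And>n. multilinear s s' n (a n)" "\<And>j. 1 \<le> j \<Longrightarrow> j \<le> m \<Longrightarrow> y j = y' j"
  shows "series_coeff a y m = series_coeff a y' m"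
  unfolding series_coeff_def
proof (intro sum.cong refl, clarify)
  fix n \<phi> assume "(n, \<phi>) \<in> compositions m"
  then show "a n (\<lambda>i. y (\<phi> i)) = a n (\<lambda>i. y' (\<phi> i))"
    using compositionsD(1,2) assms(2) by (intro multilinear_cong[OF assms(1)]) blast
qed

text \<open>The terms of the derivative of the power series \<open>a\<close> in the direction \<open>v\<close>.\<close>

definition derived :: "(nat \<Rightarrow> (nat \<Rightarrow> 'a) \<Rightarrow> 'b::comm_monoid_add) \<Rightarrow> 'a \<Rightarrow> nat \<Rightarrow> (nat \<Rightarrow> 'a) \<Rightarrow> 'b" where
  "derived a v n x = (\<Sum>i\<le>n. a (Suc n) (ins i v x))"

lemma multilinear_derived:
  fixes a :: "nat \<Rightarrow> (nat \<Rightarrow> 'a::ab_group_add) \<Rightarrow> 'b::ab_group_add"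
  assumes ml: "\<And>n. multilinear s s' n (a n)" and "module s" "module s'"
  shows "multilinear s s' n (derived a v n)"
  unfolding multilinear_def
proof (intro conjI allI impI)
  fix x y :: "nat \<Rightarrow> 'a" assume "\<forall>i<n. x i = y i"
  then show "derived a v n x = derived a v n y"
    unfolding derived_def by (intro sum.cong refl multilinear_cong[OF ml]) (auto simp: ins_def)
next
  interpret s: module s by fact
  interpret s': module s' by fact
  fix j x assume j: "j < n"
  have "module_hom s s' (\<lambda>u. a (Suc n) (ins i v (x(j := u))))" for i
    unfolding ins_upd by (rule multilinear_upd[OF ml]) (rule skip_less[OF j])
  note m = module_hom.add[OF this] module_hom.scale[OF this]
  have "module_hom s s' (\<lambda>u. derived a v n (x(j := u)))"
    unfolding derived_def
    by unfold_locales (simp_all add: m sum.distrib s'.scale_sum_right)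
  then show "Vector_Spaces.linear s s' (\<lambda>u. derived a v n (x(j := u)))"
    by (simp add: module_hom_iff_linear)
qed

context multilinear_power_series
begin

lemma Sigma_fibre: "{p \<in> Sigma UNIV P. fst p = n} = Pair n ` P n"
  by auto

lemma small_radius:
  "\<exists>\<rho>>0. (\<Sum>j=1..K. \<rho> ^ j * norm (y j)) < r \<and>
    (\<forall>\<epsilon>. norm \<epsilon> \<le> \<rho> \<longrightarrow> norm (\<Sum>j=1..K. s (\<epsilon> ^ j) (y j)) < r)"
proof -
  define M where "M = (\<Sum>j=1..K. norm (y j))"
  have M: "M \<ge> 0" by (simp add: M_def sum_nonneg)
  \<comment> \<open>For \<open>t \<le> 1\<close> the sum is at most \<open>t * M\<close>; adding \<open>1\<close> to \<open>M\<close> avoids a division by zero.\<close>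
  define \<rho> where "\<rho> = min 1 (r / (2 * (1 + M)))"
  have \<rho>: "\<rho> > 0" "\<rho> \<le> 1" using M r by (auto simp: \<rho>_def)
  have le: "(\<Sum>j=1..K. t ^ j * norm (y j)) \<le> t * M" if "0 \<le> t" "t \<le> 1" for t
    unfolding M_def sum_distrib_left
    using that power_decreasing[of 1 _ t] by (intro sum_mono mult_right_mono) auto
  have "\<rho> * M \<le> r / (2 * (1 + M)) * M" using M by (intro mult_right_mono) (auto simp: \<rho>_def)
  also have "\<dots> < r" using M r by (simp add: field_simps add_strict_increasing2)
  finally have lt: "\<rho> * M < r" .
  show ?thesis
  proof (intro exI[of _ \<rho>] conjI allI impI)
    show "\<rho> > 0" by (rule \<rho>)
    show "(\<Sum>j=1..K. \<rho> ^ j * norm (y j)) < r" using le[of \<rho>] lt \<rho> by simp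
    fix \<epsilon> :: 'k assume e: "norm \<epsilon> \<le> \<rho>"
    have "norm (\<Sum>j=1..K. s (\<epsilon> ^ j) (y j)) \<le> (\<Sum>j=1..K. norm \<epsilon> ^ j * norm (y j))"
      by (rule sum_norm_le) (simp add: s.norm_scale norm_power)
    also have "\<dots> \<le> norm \<epsilon> * M" using le[of "norm \<epsilon>"] e \<rho> by simp
    also have "\<dots> \<le> \<rho> * M" using e M by (intro mult_right_mono) auto
    finally show "norm (\<Sum>j=1..K. s (\<epsilon> ^ j) (y j)) < r" using lt by linarith
  qed
qed

text \<open>Substituting a polynomial curve into each \<open>a n\<close> gives a family indexed by an order \<open>n\<close> and
  a choice \<open>\<phi>\<close> of a monomial of the curve for each argument. It is absolutely summable for small
  \<open>\<epsilon>\<close>, since the norms sum to at most \<open>\<Sum>n. c n * (\<Sum>j. \<bar>\<epsilon>\<bar> ^ j * norm (y j)) ^ n\<close>, and may be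
  rearranged by the total degree of the choice.\<close>

lemma expands_along_curve:
  "\<exists>\<rho>>0. expands_as s' \<rho> (\<lambda>\<epsilon>. F (\<Sum>j=1..K. s (\<epsilon> ^ j) (y j)))
    (series_coeff a (\<lambda>j. if j \<le> K then y j else 0))"
proof -
  let ?y = "\<lambda>j. if j \<le> K then y j else 0"
  obtain \<rho> where \<rho>: "\<rho> > 0" "(\<Sum>j=1..K. \<rho> ^ j * norm (y j)) < r"
    "\<And>\<epsilon>. norm \<epsilon> \<le> \<rho> \<Longrightarrow> norm (\<Sum>j=1..K. s (\<epsilon> ^ j) (y j)) < r"
    using small_radius[where K = K and y = y] by blast
  define Y where "Y = (\<Sum>j=1..K. \<rho> ^ j * norm (y j))"
  have "Y \<ge> 0" unfolding Y_def using \<rho>(1) by (intro sum_nonneg) simp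
  moreover have "Y < r" using \<rho>(2) by (simp only: Y_def)
  ultimately have "\<bar>Y\<bar> < r" by simp
  define I where "I = Sigma (UNIV :: nat set) (\<lambda>n. PiE {..<n} (\<lambda>_. {1..K}))"
  define d where "d p = (\<Sum>i<fst p. snd p i)" for p :: "nat \<times> (nat \<Rightarrow> nat)"
  define t where "t p = a (fst p) (\<lambda>i. y (snd p i))" for p :: "nat \<times> (nat \<Rightarrow> nat)"
  have block: "{p \<in> I. fst p = n} = Pair n ` PiE {..<n} (\<lambda>_. {1..K})" for n
    unfolding I_def by (rule Sigma_fibre)
  have block_sum: "(\<Sum>p\<in>{p \<in> I. fst p = n}. h p) = (\<Sum>\<phi>\<in>PiE {..<n} (\<lambda>_. {1..K}). h (n, \<phi>))"
    for n and h :: "_ \<Rightarrow> 'z::comm_monoid_add"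
    unfolding block by (subst sum.reindex) (auto simp: inj_on_def)
  have fin1: "finite {p \<in> I. fst p = n}" for n
    unfolding block by (intro finite_imageI finite_PiE) auto
  have inI: "(n, \<phi>) \<in> I \<longleftrightarrow> \<phi> \<in> extensional {..<n} \<and> (\<forall>i<n. 1 \<le> \<phi> i \<and> \<phi> i \<le> K)" for n \<phi>
    unfolding I_def mem_Sigma_iff PiE_iff by auto
  have d_pair: "d (n, \<phi>) = (\<Sum>i<n. \<phi> i)" for n \<phi>
    by (simp add: d_def)
  have sub: "{p \<in> I. d p = m} \<subseteq> compositions m" for m
  proof
    fix p assume p: "p \<in> {p \<in> I. d p = m}"
    obtain n \<phi> where "p = (n, \<phi>)" by (cases p)
    then show "p \<in> compositions m"
      using p inI[of n \<phi>] d_pair[of n \<phi>] by (simp add: compositions_def PiE_iff)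
  qed
  have ex: "expands_as s' \<rho> (\<lambda>\<epsilon>. F (\<Sum>j=1..K. s (\<epsilon> ^ j) (y j))) (\<lambda>m. \<Sum>p\<in>{p \<in> I. d p = m}. t p)"
  proof (rule expands_as_by_degree[OF s'.normed_space_over_axioms fin1])
    show "finite {p \<in> I. d p = m}" for m
      using finite_subset[OF sub finite_compositions] .
    show "summable (\<lambda>n. c n * Y ^ n)" using \<open>\<bar>Y\<bar> < r\<close> by (rule sm)
    show "(\<Sum>p\<in>{p \<in> I. fst p = n}. norm (t p) * \<rho> ^ d p) \<le> c n * Y ^ n" for n
    proof -
      have "(\<Sum>p\<in>{p \<in> I. fst p = n}. norm (t p) * \<rho> ^ d p)
          = (\<Sum>\<phi>\<in>PiE {..<n} (\<lambda>_. {1..K}). norm (a n (\<lambda>i. y (\<phi> i))) * (\<Prod>i<n. \<rho> ^ \<phi> i))"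
        unfolding block_sum by (simp add: t_def d_def power_sum)
      also have "\<dots> \<le> (\<Sum>\<phi>\<in>PiE {..<n} (\<lambda>_. {1..K}). c n * (\<Prod>i<n. norm (y (\<phi> i))) * (\<Prod>i<n. \<rho> ^ \<phi> i))"
        using \<rho>(1) by (intro sum_mono mult_right_mono bd prod_nonneg) auto
      also have "\<dots> = c n * (\<Sum>\<phi>\<in>PiE {..<n} (\<lambda>_. {1..K}). \<Prod>i<n. \<rho> ^ \<phi> i * norm (y (\<phi> i)))"
        by (simp add: sum_distrib_left prod.distrib mult_ac)
      also have "(\<Sum>\<phi>\<in>PiE {..<n} (\<lambda>_. {1..K}). \<Prod>i<n. \<rho> ^ \<phi> i * norm (y (\<phi> i)))
          = (\<Prod>i<n. \<Sum>j\<in>{1..K}. \<rho> ^ j * norm (y j))"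
        by (rule prod_sum_PiE[symmetric]) auto
      finally show ?thesis by (simp add: Y_def)
    qed
    show "(\<lambda>n. \<Sum>p\<in>{p \<in> I. fst p = n}. s' (\<epsilon> ^ d p) (t p)) sums F (\<Sum>j=1..K. s (\<epsilon> ^ j) (y j))"
      if "norm \<epsilon> < \<rho>" for \<epsilon>
    proof -
      have "a n (\<lambda>_. \<Sum>j=1..K. s (\<epsilon> ^ j) (y j)) = (\<Sum>p\<in>{p \<in> I. fst p = n}. s' (\<epsilon> ^ d p) (t p))" for n
      proof -
        have "a n (\<lambda>_. \<Sum>j=1..K. s (\<epsilon> ^ j) (y j))
            = (\<Sum>\<phi>\<in>PiE {..<n} (\<lambda>_. {1..K}). a n (\<lambda>i. s (\<epsilon> ^ \<phi> i) (y (\<phi> i))))"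
          by (rule multilinear_sum[OF ml])
        also have "\<dots> = (\<Sum>\<phi>\<in>PiE {..<n} (\<lambda>_. {1..K}). s' (\<epsilon> ^ d (n, \<phi>)) (t (n, \<phi>)))"
          by (simp add: multilinear_scale[OF ml s'.vector_space_axioms] d_def t_def power_sum)
        finally show ?thesis by (simp add: block_sum)
      qed
      then show ?thesis using F[OF \<rho>(3)[of \<epsilon>]] that by simp
    qed
  qed
  have "(\<Sum>p\<in>{p \<in> I. d p = m}. t p) = series_coeff a ?y m" for m
  proof -
    have "series_coeff a ?y m = (\<Sum>p\<in>compositions m. a (fst p) (\<lambda>i. ?y (snd p i)))"
      by (simp add: series_coeff_def case_prod_unfold)
    also have "\<dots> = (\<Sum>p\<in>{p \<in> I. d p = m}. a (fst p) (\<lambda>i. ?y (snd p i)))"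
    proof (rule sum.mono_neutral_right[OF finite_compositions sub], rule ballI)
      fix p assume p: "p \<in> compositions m - {p \<in> I. d p = m}"
      obtain n \<phi> where pe: "p = (n, \<phi>)" by (cases p)
      have c: "(n, \<phi>) \<in> compositions m" using p pe by simp
      have "\<exists>i<n. \<phi> i > K"
      proof (rule ccontr)
        assume "\<not> ?thesis"
        then have "\<forall>i<n. \<phi> i \<le> K" by (meson not_le)
        then have "(n, \<phi>) \<in> I" "d (n, \<phi>) = m"
          using compositionsD[OF c] by (simp_all add: inI d_pair)
        then show False using p pe by simp
      qed
      then obtain i where i: "i < n" "\<phi> i > K" by blast
      then show "a (fst p) (\<lambda>i. ?y (snd p i)) = 0"
        unfolding pe fst_conv snd_conv by (intro multilinear_eq_0[OF ml i(1)]) simp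
    qed
    also have "\<dots> = (\<Sum>p\<in>{p \<in> I. d p = m}. t p)"
    proof (rule sum.cong[OF refl])
      fix p assume p: "p \<in> {p \<in> I. d p = m}"
      obtain n \<phi> where "p = (n, \<phi>)" by (cases p)
      then show "a (fst p) (\<lambda>i. ?y (snd p i)) = t p"
        unfolding t_def using p inI[of n \<phi>] by (intro multilinear_cong[OF ml]) simp
    qed
    finally show ?thesis by simp
  qed
  then show ?thesis using ex \<rho>(1) by auto
qed

text \<open>The factorials in the curve are absorbed into its Taylor coefficients \<open>z j / j!\<close>. Only those up to
  \<open>i\<close> enter the coefficient of \<open>\<epsilon> ^ i\<close>, so truncating the curve after \<open>i\<close> terms is harmless.\<close>

lemma T_eq_series_coeff:
  "T s s' F i z = s' (fact i) (series_coeff a (\<lambda>j. s (1 / fact j) (z j)) i)"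
proof -
  have "curve s i z \<epsilon> = (\<Sum>j=1..i. s (\<epsilon> ^ j) (s (1 / fact j) (z j)))" for \<epsilon>
    by (simp add: curve_def)
  then obtain \<rho> where "\<rho> > 0" "expands_as s' \<rho> (\<lambda>\<epsilon>. F (curve s i z \<epsilon>))
      (series_coeff a (\<lambda>j. if j \<le> i then s (1 / fact j) (z j) else 0))"
    using expands_along_curve[where K = i and y = "\<lambda>j. s (1 / fact j) (z j)"] by auto
  from expands_as_iterated_deriv_0[OF s'.normed_space_over_axioms this]
  have "T s s' F i z = s' (fact i) (series_coeff a (\<lambda>j. if j \<le> i then s (1 / fact j) (z j) else 0) i)"
    by (simp add: T_def)
  also have "series_coeff a (\<lambda>j. if j \<le> i then s (1 / fact j) (z j) else 0) i
      = series_coeff a (\<lambda>j. s (1 / fact j) (z j)) i"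
    by (rule series_coeff_cong[OF ml]) auto
  finally show ?thesis .
qed

lemma derived_sums_frechet_derivative:
  assumes x: "norm x < r"
  shows "(\<lambda>n. derived a v n (\<lambda>_. x)) sums frechet_derivative F (at x) v"
    and "bounded_linear (frechet_derivative F (at x))"
proof -
  note d = has_derivative_termwise[OF x]
  have fd: "frechet_derivative F (at x) = (\<lambda>h. \<Sum>n. \<Sum>i<n. a n ((\<lambda>_. x)(i := h)))"
    using frechet_derivative_at[OF d(1)] by simp
  show "bounded_linear (frechet_derivative F (at x))"
    unfolding fd by (rule has_derivative_bounded_linear[OF d(1)])
  have "(\<lambda>n. \<Sum>i<Suc n. a (Suc n) ((\<lambda>_. x)(i := v))) sums frechet_derivative F (at x) v"
    unfolding fd using summable_sums[OF d(2), of v] by (subst sums_Suc_iff) simp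
  moreover have "derived a v n (\<lambda>_. x) = (\<Sum>i<Suc n. a (Suc n) ((\<lambda>_. x)(i := v)))" for n
    unfolding derived_def ins_const by (simp only: lessThan_Suc_atMost)
  ultimately show "(\<lambda>n. derived a v n (\<lambda>_. x)) sums frechet_derivative F (at x) v" by simp
qed

text \<open>Hence the expansion along a curve applies to the derivative as well.\<close>

lemma derived_power_series:
  "multilinear_power_series s s' (derived a v) (\<lambda>n. real (Suc n) * c (Suc n) * norm v) r
    (\<lambda>x. frechet_derivative F (at x) v)"
proof unfold_locales
  show "multilinear s s' n (derived a v n)" for n
    by (rule multilinear_derived[OF ml s.module_axioms s'.module_axioms])
  show "norm (derived a v n x) \<le> real (Suc n) * c (Suc n) * norm v * (\<Prod>i<n. norm (x i))" for n x
  proof -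
    have "norm (a (Suc n) (ins i v x)) \<le> c (Suc n) * norm v * (\<Prod>j<n. norm (x j))" if "i \<le> n" for i
      using bd[of "Suc n" "ins i v x"] prod_ins[OF that, of norm v x] by (simp add: mult.assoc del: prod.lessThan_Suc)
    then have "norm (derived a v n x) \<le> (\<Sum>i\<le>n. c (Suc n) * norm v * (\<Prod>j<n. norm (x j)))"
      unfolding derived_def by (intro sum_norm_le) auto
    then show ?thesis by (simp add: algebra_simps)
  qed
  show "summable (\<lambda>n. real (Suc n) * c (Suc n) * norm v * t ^ n)" if "\<bar>t\<bar> < r" for t
  proof -
    have "summable (\<lambda>n. diffs c n * t ^ n)"
      by (rule termdiff_converges[of _ r]) (use sm that in auto)
    then show ?thesis
      using summable_mult2[of "\<lambda>n. diffs c n * t ^ n" "norm v"] by (simp add: diffs_def mult_ac)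
  qed
qed (rule r, rule derived_sums_frechet_derivative(1))

text \<open>For fixed \<open>v\<close>, both sides are the coefficients of the same function of \<open>\<epsilon>\<close>, the derivative of
  \<open>F\<close> along the curve in the direction \<open>v\<close>.\<close>

lemma expansion_coeffs_eq:
  assumes A: "expansion_coeffs s s' F k zb A"
  shows "A i v = series_coeff (derived a v) (\<lambda>j. if j \<le> k then s (1 / fact j) (zb j) else 0) i"
proof -
  have cv: "curve s k zb \<epsilon> = (\<Sum>j=1..k. s (\<epsilon> ^ j) (s (1 / fact j) (zb j)))" for \<epsilon>
    by (simp add: curve_def)
  let ?f = "\<lambda>\<epsilon>. frechet_derivative F (at (curve s k zb \<epsilon>)) v"
  obtain \<rho>1 where \<rho>1: "\<rho>1 > 0" "expands_as s' \<rho>1 ?f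
      (series_coeff (derived a v) (\<lambda>j. if j \<le> k then s (1 / fact j) (zb j) else 0))"
    using multilinear_power_series.expands_along_curve[OF derived_power_series, where K = k and y = "\<lambda>j. s (1 / fact j) (zb j)"]
    unfolding cv by auto
  obtain \<rho>2 where \<rho>2: "\<rho>2 > 0" "\<And>\<epsilon>. norm \<epsilon> \<le> \<rho>2 \<Longrightarrow> norm (curve s k zb \<epsilon>) < r"
    unfolding cv using small_radius[where K = k and y = "\<lambda>j. s (1 / fact j) (zb j)"] by blast
  obtain \<rho>3 where \<rho>3: "\<rho>3 > 0" "\<And>\<epsilon>. norm \<epsilon> < \<rho>3 \<Longrightarrow>
        (\<lambda>i. Blinfun (\<lambda>v. s' (\<epsilon> ^ i) (A i v))) sums Blinfun (frechet_derivative F (at (curve s k zb \<epsilon>)))"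
    and lin: "\<And>i. bounded_linear (A i)"
    using A unfolding expansion_coeffs_def by blast
  have "expands_as s' (min \<rho>2 \<rho>3) ?f (\<lambda>i. A i v)"
  proof (rule expands_asI[OF s'.normed_space_over_axioms])
    fix \<epsilon> :: 'k assume e: "norm \<epsilon> < min \<rho>2 \<rho>3"
    have "(\<lambda>i. blinfun_apply (Blinfun (\<lambda>v. s' (\<epsilon> ^ i) (A i v))) v) sums
        blinfun_apply (Blinfun (frechet_derivative F (at (curve s k zb \<epsilon>)))) v"
      by (rule bounded_linear.sums[OF blinfun.bounded_linear_left]) (use \<rho>3 e in auto)
    moreover have "bounded_linear (frechet_derivative F (at (curve s k zb \<epsilon>)))"
      by (rule derived_sums_frechet_derivative(2)[OF \<rho>2(2)]) (use e in auto)
    moreover have "bounded_linear (\<lambda>v. s' (\<epsilon> ^ i) (A i v))" for i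
    proof -
      have "bounded_linear (s' (\<epsilon> ^ i))"
      proof (rule bounded_linear_intro[of _ "norm (\<epsilon> ^ i)"])
        show "s' (\<epsilon> ^ i) (t *\<^sub>R x) = t *\<^sub>R s' (\<epsilon> ^ i) x" for t x
          using s'.scale_left_commute[of "\<epsilon> ^ i" "of_real t" x] by (simp only: s'.scale_of_real)
      qed (auto simp: s'.scale_right_distrib s'.norm_scale)
      then show ?thesis using lin bounded_linear_compose by blast
    qed
    ultimately show "(\<lambda>i. s' (\<epsilon> ^ i) (A i v)) sums ?f \<epsilon>"
      by (simp add: bounded_linear_Blinfun_apply)
  qed
  moreover have "min \<rho>2 \<rho>3 > 0" using \<rho>2 \<rho>3 by simp
  ultimately have "(\<lambda>i. A i v)
      = series_coeff (derived a v) (\<lambda>j. if j \<le> k then s (1 / fact j) (zb j) else 0)"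
    using expands_as_unique[OF s'.normed_space_over_axioms _ _ \<rho>1] by blast
  then show ?thesis by (rule fun_cong)
qed

end

lemma analytic_near_0_power_series:
  fixes s :: "'k::real_normed_field \<Rightarrow> 'a::real_normed_vector \<Rightarrow> 'a" and s' :: "'k \<Rightarrow> 'b::banach \<Rightarrow> 'b"
  assumes "normed_space_over s" "normed_space_over s'" "analytic_near_0 s s' G"
  obtains a c r where "multilinear_power_series s s' a c r G"
proof -
  obtain a c r where r: "r > 0" "summable (\<lambda>n. c n * r ^ n)"
    and a: "\<And>n. multilinear s s' n (a n)" "\<And>n x. norm (a n x) \<le> c n * (\<Prod>i<n. norm (x i))"
    and G: "\<And>x. norm x < r \<Longrightarrow> (\<lambda>n. a n (\<lambda>_. x)) sums G x"
    using assms(3) unfolding analytic_near_0_def by blast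
  have "multilinear_power_series s s' a c r G"
  proof (intro multilinear_power_series.intro multilinear_power_series_axioms.intro)
    show "summable (\<lambda>n. c n * t ^ n)" if "\<bar>t\<bar> < r" for t
      by (rule powser_inside[OF r(2)]) (use that r in auto)
  qed (use assms r a G in auto)
  then show thesis by (rule that)
qed

text \<open>When the coefficients of a curve up to \<open>k\<close> are given and the others unknown, these are the terms
  that are not affine in the unknowns.\<close>

definition nonlinear_part ::
  "(nat \<Rightarrow> (nat \<Rightarrow> 'a) \<Rightarrow> 'b::comm_monoid_add) \<Rightarrow> nat \<Rightarrow> (nat \<Rightarrow> 'a) \<Rightarrow> nat \<Rightarrow> 'b" where
  "nonlinear_part a k y m =
     (\<Sum>(n, \<phi>)\<in>{(n, \<phi>) \<in> compositions m. 2 \<le> card {i. i < n \<and> k < \<phi> i}}. a n (\<lambda>i. y (\<phi> i)))"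

lemma ins_self: "ins i (\<phi> i) (\<lambda>j. \<phi> (skip i j)) = \<phi>"
  by (auto simp: ins_def skip_def fun_eq_iff)

lemma ins_composition:
  assumes c: "(n, \<phi>) \<in> compositions (m - b)" and i: "i \<le> n" and b: "1 \<le> b" "b \<le> m"
  shows "(Suc n, ins i b \<phi>) \<in> compositions m"
proof -
  have "ins i b \<phi> j \<ge> 1" if "j < Suc n" for j
    using compositionsD(1)[OF c, of j] compositionsD(1)[OF c, of "j - 1"] b that i
    unfolding ins_def by (cases "j < i"; cases "j = i") auto
  moreover have "ins i b \<phi> \<in> extensional {..<Suc n}"
    using compositionsD(4)[OF c] i by (auto simp: ins_def extensional_def)
  moreover have "(\<Sum>j<Suc n. ins i b \<phi> j) = m"
    using sum_ins[OF i, of "\<lambda>x. x" b \<phi>] compositionsD(5)[OF c] b by simp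
  ultimately show ?thesis
    by (simp add: compositions_def PiE_iff del: sum.lessThan_Suc)
qed

lemma skip_composition:
  assumes c: "(Suc n, \<phi>) \<in> compositions m" and i: "i \<le> n"
  shows "(n, \<lambda>j. \<phi> (skip i j)) \<in> compositions (m - \<phi> i)"
proof -
  have "1 \<le> \<phi> (skip i j)" if "j < n" for j
    using compositionsD(1)[OF c skip_less[OF that]] .
  moreover have "(\<Sum>j<Suc n. ins i (\<phi> i) (\<lambda>j. \<phi> (skip i j)) j) = \<phi> i + (\<Sum>j<n. \<phi> (skip i j))"
    using sum_ins[OF i, of "\<lambda>x. x" "\<phi> i" "\<lambda>j. \<phi> (skip i j)"] .
  then have "m = \<phi> i + (\<Sum>j<n. \<phi> (skip i j))"
    using compositionsD(5)[OF c] by (simp only: ins_self)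
  moreover have "(\<lambda>j. \<phi> (skip i j)) \<in> extensional {..<n}"
    using compositionsD(4)[OF c] i by (simp add: skip_def extensional_def)
  ultimately show ?thesis by (simp add: compositions_def PiE_iff)
qed

text \<open>Sort the compositions by the number of entries beyond \<open>k\<close>. Those with exactly one such entry
  \<open>b\<close> arise uniquely by inserting \<open>b\<close> into a composition of \<open>m - b\<close>, which is how the terms of the
  derivative along the truncated curve are indexed.\<close>

lemma series_coeff_split:
  fixes a :: "nat \<Rightarrow> (nat \<Rightarrow> 'a::ab_group_add) \<Rightarrow> 'b::ab_group_add" and k :: nat
  assumes ml: "\<And>n. multilinear s s' n (a n)"
  defines "yb \<equiv> \<lambda>y j. if j \<le> k then y j else 0"
  shows "series_coeff a y m = series_coeff a (yb y) m
    + (\<Sum>b=Suc k..m. series_coeff (derived a (y b)) (yb y) (m - b)) + nonlinear_part a k y m"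
proof -
  define large where "large n \<phi> = {i. i < n \<and> k < \<phi> i}" for n and \<phi> :: "nat \<Rightarrow> nat"
  have fin_large: "finite (large n \<phi>)" for n \<phi> by (simp add: large_def)
  define f where "f p = a (fst p) (\<lambda>i. y (snd p i))" for p :: "nat \<times> (nat \<Rightarrow> nat)"
  define L where "L p = card (large (fst p) (snd p))" for p :: "nat \<times> (nat \<Rightarrow> nat)"
  let ?C = "\<lambda>P. {p \<in> compositions m. P (L p)}"
  have fin: "finite (?C P)" for P by (rule finite_subset[OF _ finite_compositions]) auto
  have all: "compositions m = ?C (\<lambda>c. c = 0) \<union> (?C (\<lambda>c. c = 1) \<union> ?C (\<lambda>c. 2 \<le> c))"
  proof (intro equalityI subsetI)
    fix p assume "p \<in> compositions m"
    moreover have "L p = 0 \<or> L p = 1 \<or> 2 \<le> L p" by arith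
    ultimately show "p \<in> ?C (\<lambda>c. c = 0) \<union> (?C (\<lambda>c. c = 1) \<union> ?C (\<lambda>c. 2 \<le> c))" by blast
  qed blast
  have "series_coeff a y m = sum f (compositions m)"
    by (simp add: series_coeff_def f_def case_prod_unfold)
  also have "\<dots> = sum f (?C (\<lambda>c. c = 0)) + sum f (?C (\<lambda>c. c = 1) \<union> ?C (\<lambda>c. 2 \<le> c))"
    by (subst all, rule sum.union_disjoint) (use fin in \<open>auto intro!: fin\<close>)
  also have "sum f (?C (\<lambda>c. c = 1) \<union> ?C (\<lambda>c. 2 \<le> c)) = sum f (?C (\<lambda>c. c = 1)) + sum f (?C (\<lambda>c. 2 \<le> c))"
    by (rule sum.union_disjoint) (use fin in \<open>auto intro!: fin\<close>)
  finally have split: "series_coeff a y m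
      = sum f (?C (\<lambda>c. c = 0)) + (sum f (?C (\<lambda>c. c = 1)) + sum f (?C (\<lambda>c. 2 \<le> c)))" .
  have none: "sum f (?C (\<lambda>c. c = 0)) = series_coeff a (yb y) m"
  proof -
    have "series_coeff a (yb y) m = (\<Sum>p\<in>compositions m. a (fst p) (\<lambda>i. yb y (snd p i)))"
      by (simp add: series_coeff_def case_prod_unfold)
    also have "\<dots> = (\<Sum>p\<in>?C (\<lambda>c. c = 0). a (fst p) (\<lambda>i. yb y (snd p i)))"
    proof (rule sum.mono_neutral_right[OF finite_compositions])
      show "\<forall>p\<in>compositions m - ?C (\<lambda>c. c = 0). a (fst p) (\<lambda>i. yb y (snd p i)) = 0"
      proof
        fix p assume "p \<in> compositions m - ?C (\<lambda>c. c = 0)"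
        then have "large (fst p) (snd p) \<noteq> {}" by (auto simp: L_def)
        then obtain i where i: "i < fst p" "k < snd p i" by (auto simp: large_def)
        then show "a (fst p) (\<lambda>i. yb y (snd p i)) = 0"
          by (intro multilinear_eq_0[OF ml i(1)]) (simp add: yb_def)
      qed
    qed auto
    also have "\<dots> = sum f (?C (\<lambda>c. c = 0))"
    proof (rule sum.cong[OF refl])
      fix p assume "p \<in> ?C (\<lambda>c. c = 0)"
      then have "large (fst p) (snd p) = {}" using fin_large by (simp add: L_def)
      then show "a (fst p) (\<lambda>i. yb y (snd p i)) = f p"
        unfolding f_def by (intro multilinear_cong[OF ml]) (auto simp: large_def yb_def)
    qed
    finally show ?thesis by simp
  qed
  have two: "sum f (?C (\<lambda>c. 2 \<le> c)) = nonlinear_part a k y m"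
    by (simp add: nonlinear_part_def f_def L_def large_def case_prod_unfold)
  have one: "sum f (?C (\<lambda>c. c = 1)) = (\<Sum>b=Suc k..m. series_coeff (derived a (y b)) (yb y) (m - b))"
  proof -
    define J where "J = Sigma {Suc k..m} (\<lambda>b. Sigma (compositions (m - b)) (\<lambda>p. {..fst p}))"
    define J0 where "J0 = {q \<in> J. \<forall>j<fst (fst (snd q)). snd (fst (snd q)) j \<le> k}"
    define g where "g q = a (Suc (fst (fst (snd q))))
        (ins (snd (snd q)) (y (fst q)) (\<lambda>j. yb y (snd (fst (snd q)) j)))"
      for q :: "nat \<times> (nat \<times> (nat \<Rightarrow> nat)) \<times> nat"
    have inJ: "(b, (n, \<phi>), i) \<in> J \<longleftrightarrow> Suc k \<le> b \<and> b \<le> m \<and> (n, \<phi>) \<in> compositions (m - b) \<and> i \<le> n"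
      for b n \<phi> i by (simp add: J_def)
    have finJ: "finite J" unfolding J_def by (intro finite_SigmaI finite_compositions) auto
    have "(\<Sum>b=Suc k..m. series_coeff (derived a (y b)) (yb y) (m - b))
        = (\<Sum>b=Suc k..m. \<Sum>p\<in>compositions (m - b). \<Sum>i\<in>{..fst p}. g (b, p, i))"
      by (simp add: series_coeff_def derived_def g_def case_prod_unfold)
    also have "\<dots> = sum g J"
      unfolding J_def by (simp add: sum.Sigma finite_compositions case_prod_unfold)
    also have "\<dots> = sum g J0"
    proof (rule sum.mono_neutral_right[OF finJ])
      show "J0 \<subseteq> J" by (auto simp: J0_def)
      show "\<forall>q\<in>J - J0. g q = 0"
      proof
        fix q assume q: "q \<in> J - J0"
        obtain b n \<phi> i where qe: "q = (b, (n, \<phi>), i)" by (metis prod.exhaust)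
        obtain j where j: "j < n" "k < \<phi> j" using q by (auto simp: qe J0_def not_le)
        show "g q = 0" unfolding qe g_def
          using j by (auto intro!: multilinear_eq_0[OF ml skip_less[OF j(1), of i]] simp: yb_def)
      qed
    qed
    also have "\<dots> = sum f (?C (\<lambda>c. c = 1))"
    proof -
      define one where "one n \<phi> = (THE i. i < n \<and> k < \<phi> i)" for n and \<phi> :: "nat \<Rightarrow> nat"
      define up where "up q = (Suc (fst (fst (snd q))), ins (snd (snd q)) (fst q) (snd (fst (snd q))))"
        for q :: "nat \<times> (nat \<times> (nat \<Rightarrow> nat)) \<times> nat"
      define down where "down p = (case p of (n, \<phi>) \<Rightarrow>
          (\<phi> (one n \<phi>), (n - 1, \<lambda>j. \<phi> (skip (one n \<phi>) j)), one n \<phi>))" for p :: "nat \<times> (nat \<Rightarrow> nat)"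
      show ?thesis
      proof (rule sum.reindex_bij_witness[of _ down up])
        fix q assume q: "q \<in> J0"
        obtain b n \<phi> i where qe: "q = (b, (n, \<phi>), i)" by (metis prod.exhaust)
        have b: "Suc k \<le> b" "b \<le> m" and c: "(n, \<phi>) \<in> compositions (m - b)" and i: "i \<le> n"
          and small: "\<And>j. j < n \<Longrightarrow> \<phi> j \<le> k"
          using q unfolding J0_def mem_Collect_eq qe inJ by simp_all
        have big: "k < ins i b \<phi> j \<longleftrightarrow> j = i" if "j < Suc n" for j
        proof (cases j i rule: linorder_cases)
          case less
          then show ?thesis using small[of j] i by (simp add: ins_def)
        next
          case greater
          then have "j - 1 < n" using that by arith
          then show ?thesis using small[of "j - 1"] greater by (simp add: ins_def)
        qed (use b in simp)
        then have large: "large (Suc n) (ins i b \<phi>) = {i}"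
          unfolding large_def using i less_Suc_eq_le[of i n] by blast
        have o: "one (Suc n) (ins i b \<phi>) = i"
          unfolding one_def
        proof (rule the_equality)
          show "i < Suc n \<and> k < ins i b \<phi> i" using big[of i] i by simp
        qed (use big in blast)
        show "down (up q) = q" by (simp add: qe up_def down_def o)
        have "(Suc n, ins i b \<phi>) \<in> compositions m" using ins_composition[OF c i] b by simp
        then show "up q \<in> ?C (\<lambda>c. c = 1)" by (simp add: qe up_def L_def large)
        have "a (Suc n) (\<lambda>j. y (ins i b \<phi> j)) = a (Suc n) (ins i (y b) (\<lambda>j. yb y (\<phi> j)))"
          unfolding ins_comp[of y]
          using small i by (intro multilinear_cong[OF ml]) (auto simp: ins_def yb_def)
        then show "f (up q) = g q" by (simp add: f_def g_def qe up_def)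
      next
        fix p assume p: "p \<in> ?C (\<lambda>c. c = 1)"
        obtain n \<phi> where pe: "p = (n, \<phi>)" by (cases p)
        have c: "(n, \<phi>) \<in> compositions m" and "card (large n \<phi>) = 1" using p by (auto simp: pe L_def)
        then obtain i where "large n \<phi> = {i}" using card_1_singletonE by blast
        then have i: "i < n" "k < \<phi> i" and uniq: "\<And>j. j < n \<Longrightarrow> k < \<phi> j \<Longrightarrow> j = i"
          by (auto simp: large_def)
        have o: "one n \<phi> = i"
          unfolding one_def by (rule the_equality) (use i uniq in blast)+
        obtain n' where n': "n = Suc n'" using i(1) by (cases n) auto
        show "up (down p) = p" by (simp add: pe up_def down_def o ins_self n')
        have small: "\<phi> (skip i j) \<le> k" if "j < n'" for j
        proof -
          have "skip i j < n" using skip_less[OF that] n' by simp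
          moreover have "skip i j \<noteq> i" by (simp add: skip_def)
          ultimately show ?thesis using uniq not_less by blast
        qed
        have "(n', \<lambda>j. \<phi> (skip i j)) \<in> compositions (m - \<phi> i)"
          using skip_composition[of n' \<phi> m i] c i n' by simp
        then have "(\<phi> i, (n', \<lambda>j. \<phi> (skip i j)), i) \<in> J0"
          using i n' small compositionsD(2)[OF c i(1)] by (simp add: J0_def inJ)
        moreover have "down p = (\<phi> i, (n', \<lambda>j. \<phi> (skip i j)), i)" by (simp add: pe down_def o, simp add: n')
        ultimately show "down p \<in> J0" by simp
      qed
    qed
    finally show ?thesis by simp
  qed
  show ?thesis using split none one two by simp
qed

section \<open>Bounded operators\<close>

lemma (in normed_space_over) subspace_imp_real_subspace:
  "module.subspace scale U \<Longrightarrow> Real_Vector_Spaces.subspace U"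
  unfolding subspace_def Real_Vector_Spaces.subspace_def using scale_of_real by metis

text \<open>Linearity is over the scalar field, whereas \<open>bounded_linear\<close> only knows the reals.\<close>

definition bounded_operator ::
  "('k::field \<Rightarrow> 'a::real_normed_vector \<Rightarrow> 'a) \<Rightarrow> ('k \<Rightarrow> 'b::real_normed_vector \<Rightarrow> 'b) \<Rightarrow> ('a \<Rightarrow> 'b) \<Rightarrow> bool" where
  "bounded_operator s s' f \<longleftrightarrow> module_hom s s' f \<and> (\<exists>C\<ge>0. \<forall>x. norm (f x) \<le> C * norm x)"

lemma bounded_operatorI:
  assumes "module_hom s s' f" "\<And>x. norm (f x) \<le> C * norm x"
  shows "bounded_operator s s' f"
  unfolding bounded_operator_def
proof (intro conjI assms(1) exI[of _ "max C 0"] allI)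
  show "norm (f x) \<le> max C 0 * norm x" for x
    by (rule order_trans[OF assms(2)]) (intro mult_right_mono, auto)
qed simp

lemma bounded_operator_hom: "bounded_operator s s' f \<Longrightarrow> module_hom s s' f"
  by (simp add: bounded_operator_def)

lemma bounded_operatorE:
  assumes "bounded_operator s s' f"
  obtains C where "C \<ge> 0" "\<And>x. norm (f x) \<le> C * norm x"
  using assms by (auto simp: bounded_operator_def)

lemma bounded_operator_compose:
  assumes f: "bounded_operator s s' f" and g: "bounded_operator s' s'' g"
  shows "bounded_operator s s'' (\<lambda>x. g (f x))"
proof -
  obtain C D where C: "C \<ge> 0" "\<And>x. norm (f x) \<le> C * norm x" and D: "D \<ge> 0" "\<And>x. norm (g x) \<le> D * norm x"
    using bounded_operatorE[OF f] bounded_operatorE[OF g] by metis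
  have "norm (g (f x)) \<le> D * C * norm x" for x
    using D(2)[of "f x"] mult_left_mono[OF C(2)[of x] D(1)] by (simp add: mult.assoc)
  moreover have "module_hom s s'' (\<lambda>x. g (f x))"
    using bounded_operator_hom[OF f] bounded_operator_hom[OF g] by (simp add: module_hom_iff)
  ultimately show ?thesis by (rule bounded_operatorI[rotated])
qed

lemma bounded_operator_add:
  assumes f: "bounded_operator s s' f" and g: "bounded_operator s s' g"
  shows "bounded_operator s s' (\<lambda>x. f x + g x)"
proof -
  obtain C D where C: "\<And>x. norm (f x) \<le> C * norm x" and D: "\<And>x. norm (g x) \<le> D * norm x"
    using bounded_operatorE[OF f] bounded_operatorE[OF g] by metis
  have "norm (f x + g x) \<le> (C + D) * norm x" for x
    using norm_triangle_ineq[of "f x" "g x"] C[of x] D[of x] by (simp add: distrib_right)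
  moreover have "module_hom s s' (\<lambda>x. f x + g x)"
    using bounded_operator_hom[OF f] bounded_operator_hom[OF g]
    by (auto simp: module_hom_iff module.scale_right_distrib algebra_simps)
  ultimately show ?thesis by (rule bounded_operatorI[rotated])
qed

lemma (in normed_space_over) bounded_operator_scale: "bounded_operator scale scale (scale c)"
  by (rule bounded_operatorI[of _ _ _ "norm c"])
    (simp_all add: module_hom_iff module_axioms norm_scale scale_right_distrib mult.commute)

lemma (in normed_space_over) bounded_operator_id: "bounded_operator scale scale (\<lambda>x. x)"
  by (rule bounded_operatorI[of _ _ _ 1]) (simp_all add: module_hom_iff module_axioms)

locale operators = s: normed_space_over s + s': normed_space_over s'
  for s :: "'k::real_normed_field \<Rightarrow> 'a::real_normed_vector \<Rightarrow> 'a"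
    and s' :: "'k \<Rightarrow> 'b::real_normed_vector \<Rightarrow> 'b"
begin

lemma bounded_operator_0: "bounded_operator s s' (\<lambda>x. 0)"
  by (rule bounded_operatorI[of _ _ _ 0])
    (simp_all add: module_hom_iff s.module_axioms s'.module_axioms)

lemma bounded_operator_sum:
  "(\<And>i. i \<in> I \<Longrightarrow> bounded_operator s s' (f i)) \<Longrightarrow> bounded_operator s s' (\<lambda>x. \<Sum>i\<in>I. f i x)"
  by (induction I rule: infinite_finite_induct) (auto simp: bounded_operator_0 bounded_operator_add)

lemma bounded_operator_uminus: "bounded_operator s s' f \<Longrightarrow> bounded_operator s s' (\<lambda>x. - f x)"
  unfolding bounded_operator_def by (simp add: module_hom_iff)

lemma bounded_operator_diff:
  "bounded_operator s s' f \<Longrightarrow> bounded_operator s s' g \<Longrightarrow> bounded_operator s s' (\<lambda>x. f x - g x)"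
  using bounded_operator_add[of s s' f "\<lambda>x. - g x"] bounded_operator_uminus[of g] by simp

lemma bounded_operator_case_nat:
  "(\<And>j. bounded_operator s s' (f j)) \<Longrightarrow> bounded_operator s s' (\<lambda>x. case_nat 0 (\<lambda>i. f i x) j)"
  by (cases j) (simp_all add: bounded_operator_0)

end

section \<open>Triangular Toeplitz systems\<close>

text \<open>The coefficient of \<open>\<epsilon> ^ t\<close> in \<open>(\<Sum>j. \<epsilon> ^ j A j) (\<Sum>j. \<epsilon> ^ j u j)\<close>.\<close>

definition toeplitz :: "(nat \<Rightarrow> 'a \<Rightarrow> 'b::comm_monoid_add) \<Rightarrow> (nat \<Rightarrow> 'a) \<Rightarrow> nat \<Rightarrow> 'b" where
  "toeplitz A u t = (\<Sum>j=0..t. A j (u (t - j)))"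

lemma toeplitz_cong: "(\<And>j. j \<le> t \<Longrightarrow> u j = u' j) \<Longrightarrow> toeplitz A u t = toeplitz A u' t"
  by (simp add: toeplitz_def)

locale toeplitz_operators = operators s s'
  for s :: "'k::real_normed_field \<Rightarrow> 'a::real_normed_vector \<Rightarrow> 'a"
    and s' :: "'k \<Rightarrow> 'b::real_normed_vector \<Rightarrow> 'b" +
  fixes A :: "nat \<Rightarrow> 'a \<Rightarrow> 'b"
  assumes A: "\<And>i. bounded_operator s s' (A i)"
begin

abbreviation Tp :: "(nat \<Rightarrow> 'a) \<Rightarrow> nat \<Rightarrow> 'b" where "Tp \<equiv> toeplitz A"

lemmas A_hom = bounded_operator_hom[OF A]
lemmas A_linear [simp] = module_hom.zero[OF A_hom] module_hom.add[OF A_hom] module_hom.diff[OF A_hom]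
  module_hom.scale[OF A_hom] module_hom.sum[OF A_hom]

lemma toeplitz_zero [simp]: "Tp (\<lambda>_. 0) t = 0"
  and toeplitz_add: "Tp (\<lambda>j. u j + v j) t = Tp u t + Tp v t"
  and toeplitz_diff: "Tp (\<lambda>j. u j - v j) t = Tp u t - Tp v t"
  by (simp_all add: toeplitz_def sum.distrib sum_subtractf)

lemma toeplitz_sum: "Tp (\<lambda>j. \<Sum>i\<in>I. u i j) t = (\<Sum>i\<in>I. Tp (u i) t)"
  unfolding toeplitz_def A_linear by (rule sum.swap)

lemma toeplitz_shift_0 [simp]: "Tp (case_nat 0 u) 0 = 0"
  by (simp add: toeplitz_def)

lemma toeplitz_shift_Suc [simp]: "Tp (case_nat 0 u) (Suc t) = Tp u t"
  unfolding toeplitz_def by (subst sum.atLeast0_atMost_Suc) (auto intro!: sum.cong simp: Suc_diff_le)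

lemma toeplitz_tail:
  assumes "d 0 = 0"
  shows "Tp d (Suc t) = Tp (\<lambda>j. d (Suc j)) t"
proof -
  have "d = case_nat 0 (\<lambda>j. d (Suc j))" using assms by (auto simp: fun_eq_iff split: nat.split)
  then show ?thesis using toeplitz_shift_Suc[of "\<lambda>j. d (Suc j)" t] by simp
qed

lemma bounded_operator_toeplitz:
  assumes f: "\<And>j. bounded_operator s'' s (f j)" and s'': "normed_space_over s''"
  shows "bounded_operator s'' s' (\<lambda>x. Tp (\<lambda>j. f j x) t)"
proof -
  interpret o: operators s'' s' using s'' s'.normed_space_over_axioms by (rule operators.intro)
  show ?thesis unfolding toeplitz_def by (intro o.bounded_operator_sum bounded_operator_compose[OF f A])
qed

end

section \<open>The chain of operators\<close>

locale chain = toeplitz_operators s s' A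
  for s :: "'k::real_normed_field \<Rightarrow> 'a::banach \<Rightarrow> 'a"
    and s' :: "'k \<Rightarrow> 'b::banach \<Rightarrow> 'b" and A :: "nat \<Rightarrow> 'a \<Rightarrow> 'b" +
  fixes k :: nat and S :: "nat \<Rightarrow> 'a \<Rightarrow> 'b" and N Nc :: "nat \<Rightarrow> 'a set" and R Rc :: "nat \<Rightarrow> 'b set"
  assumes chain: "operator_chain s s' k A S N Nc R Rc"
begin

lemma N_0: "N 0 = UNIV" and Rc_0: "Rc 0 = UNIV" and S_1: "S (Suc 0) = A 0"
  using chain by (simp_all add: operator_chain_def)

lemma S_next: "i < k \<Longrightarrow> v \<in> N (Suc i) \<Longrightarrow> S (Suc (Suc i)) v = next_operator s' A R Rc (Suc i) v"
  using chain by (simp add: operator_chain_def)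

context
  fixes i assumes i: "i \<le> k"
begin

lemma chain_step:
  shows N_Suc: "N (Suc i) = {v \<in> N i. S (Suc i) v = 0}"
    and R_Suc: "R (Suc i) = S (Suc i) ` N i"
    and N_sum: "closed_direct_sum s (N i) (Nc (Suc i)) (N (Suc i))"
    and Rc_sum: "closed_direct_sum s' (Rc i) (R (Suc i)) (Rc (Suc i))"
    and S_cont: "continuous_on (Nc (Suc i)) (S (Suc i))"
    and S_bij: "bij_betw (S (Suc i)) (Nc (Suc i)) (R (Suc i))"
  using chain i unfolding operator_chain_def by (auto dest!: bspec[of _ _ "Suc i"])

lemma subspaces:
  "s.subspace (Nc (Suc i))" "closed (Nc (Suc i))" "s.subspace (N (Suc i))"
  "s'.subspace (R (Suc i))" "closed (R (Suc i))" "s'.subspace (Rc (Suc i))" "closed (Rc (Suc i))"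
  "R (Suc i) \<inter> Rc (Suc i) = {0}"
  using N_sum Rc_sum by (simp_all add: closed_direct_sum_def)

lemma Rc_decompose: "Rc i = {u + v |u v. u \<in> R (Suc i) \<and> v \<in> Rc (Suc i)}"
  using Rc_sum by (simp add: closed_direct_sum_def)

lemma R_subset_Rc: "R (Suc i) \<subseteq> Rc i" and Rc_Suc_subset: "Rc (Suc i) \<subseteq> Rc i"
proof -
  have "x = x + 0" "x = 0 + x" for x :: 'b by simp_all
  then show "R (Suc i) \<subseteq> Rc i" "Rc (Suc i) \<subseteq> Rc i"
    unfolding Rc_decompose using s'.subspace_0 subspaces(4,6) by blast+
qed

lemma Nc_subset_N: "Nc (Suc i) \<subseteq> N i"
proof -
  have "x = x + 0" for x :: 'a by simp
  then show ?thesis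
    using N_sum s.subspace_0[OF subspaces(3)] unfolding closed_direct_sum_def by blast
qed

end

lemma N_subspace: "i \<le> Suc k \<Longrightarrow> s.subspace (N i)"
  by (cases i) (simp_all add: N_0 subspaces(3))

lemma Rc_subspace: "i \<le> Suc k \<Longrightarrow> s'.subspace (Rc i)" and Rc_closed: "i \<le> Suc k \<Longrightarrow> closed (Rc i)"
  by (cases i; simp add: Rc_0 subspaces)+

subsection \<open>The projections along the sum of the ranges\<close>

abbreviation sumR :: "nat \<Rightarrow> 'b set" where "sumR \<equiv> sum_of_subspaces R"

lemma sumR_0: "sumR 0 = {0}"
  by (auto simp: sum_of_subspaces_def)

lemma sumR_Suc: "sumR (Suc i) = {x + y |x y. x \<in> sumR i \<and> y \<in> R (Suc i)}"
proof (intro equalityI subsetI)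
  fix z assume "z \<in> sumR (Suc i)"
  then obtain r where "\<forall>j\<in>{1..Suc i}. r j \<in> R j" "z = (\<Sum>j=1..i. r j) + r (Suc i)"
    by (auto simp: sum_of_subspaces_def)
  then show "z \<in> {x + y |x y. x \<in> sumR i \<and> y \<in> R (Suc i)}"
    unfolding sum_of_subspaces_def by fastforce
next
  fix z assume "z \<in> {x + y |x y. x \<in> sumR i \<and> y \<in> R (Suc i)}"
  then obtain r y where r: "\<forall>j\<in>{1..i}. r j \<in> R j" and y: "y \<in> R (Suc i)" "z = (\<Sum>j=1..i. r j) + y"
    by (auto simp: sum_of_subspaces_def)
  have "(\<Sum>j=1..Suc i. (r(Suc i := y)) j) = z" using y by simp
  moreover have "\<forall>j\<in>{1..Suc i}. (r(Suc i := y)) j \<in> R j" using r y by auto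
  ultimately show "z \<in> sumR (Suc i)" unfolding sum_of_subspaces_def by blast
qed

lemma sumR_SucI: "x \<in> sumR i \<Longrightarrow> y \<in> R (Suc i) \<Longrightarrow> r = x + y \<Longrightarrow> r \<in> sumR (Suc i)"
  unfolding sumR_Suc by blast

lemma sumR_subspace: "i \<le> Suc k \<Longrightarrow> s'.subspace (sumR i)"
proof (induction i)
  case (Suc i)
  then show ?case unfolding sumR_Suc using s'.subspace_sums subspaces(4) by simp
qed (simp add: sumR_0)

lemma sumR_mono: "j \<le> i \<Longrightarrow> i \<le> Suc k \<Longrightarrow> sumR j \<subseteq> sumR i"
proof (induction i rule: dec_induct)
  case (step i)
  have "sumR i \<subseteq> sumR (Suc i)"
  proof
    fix x assume "x \<in> sumR i"
    moreover have "x = x + 0" by simp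
    ultimately show "x \<in> sumR (Suc i)"
      unfolding sumR_Suc using s'.subspace_0[OF subspaces(4)[of i]] step by blast
  qed
  then show ?case using step by simp
qed simp

lemma sumR_Rc_disjoint: "i \<le> Suc k \<Longrightarrow> x \<in> sumR i \<Longrightarrow> x \<in> Rc i \<Longrightarrow> x = 0"
proof (induction i arbitrary: x)
  case 0
  then show ?case by (simp add: sumR_0)
next
  case (Suc i)
  then have i: "i \<le> k" by simp
  obtain y z where x: "x = y + z" "y \<in> sumR i" "z \<in> R (Suc i)" using Suc.prems(2) by (auto simp: sumR_Suc)
  have "x - z \<in> Rc i"
    using s'.subspace_diff[OF Rc_subspace, of i x z] i Suc.prems(3) x(3) R_subset_Rc[OF i] Rc_Suc_subset[OF i] by auto
  then have "y = 0" using Suc.IH[of y] x i by simp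
  then show ?case using x Suc.prems(3) subspaces(8)[OF i] by auto
qed

definition Q :: "nat \<Rightarrow> 'b \<Rightarrow> 'b" where
  "Q i = projection_along (Rc i) (sumR i)"

lemma Q_eqI: "i \<le> Suc k \<Longrightarrow> u \<in> Rc i \<Longrightarrow> r - u \<in> sumR i \<Longrightarrow> Q i r = u"
  unfolding Q_def projection_along_def
proof (rule the_equality, simp)
  fix w assume h: "i \<le> Suc k" "u \<in> Rc i" "r - u \<in> sumR i" "w \<in> Rc i \<and> r - w \<in> sumR i"
  have "(r - u) - (r - w) \<in> sumR i" using h s'.subspace_diff[OF sumR_subspace] by blast
  moreover have "w - u \<in> Rc i" using h s'.subspace_diff[OF Rc_subspace] by blast
  ultimately show "w = u" using sumR_Rc_disjoint[of i "w - u"] h by simp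
qed

lemma Q_props: "i \<le> Suc k \<Longrightarrow> Q i r \<in> Rc i \<and> r - Q i r \<in> sumR i"
proof (induction i)
  case 0
  have "Q 0 r = r" by (rule Q_eqI) (simp_all add: Rc_0 sumR_0)
  then show ?case by (simp add: Rc_0 sumR_0)
next
  case (Suc i)
  then have i: "i \<le> k" by simp
  obtain a b where ab: "Q i r = a + b" "a \<in> R (Suc i)" "b \<in> Rc (Suc i)"
    using Suc Rc_decompose[OF i] by auto
  have "r - b = (r - Q i r) + a" using ab by simp
  then have "r - b \<in> sumR (Suc i)"
    by (rule sumR_SucI[OF _ ab(2), rotated]) (use Suc in simp)
  then show ?case using Q_eqI[OF Suc.prems ab(3)] ab by simp
qed

lemmas Q_in = Q_props[THEN conjunct1] and Q_diff = Q_props[THEN conjunct2]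

lemma Q_0: "Q 0 r = r"
  by (rule Q_eqI) (simp_all add: Rc_0 sumR_0)

lemma Q_eq_0: "i \<le> Suc k \<Longrightarrow> r \<in> sumR i \<Longrightarrow> Q i r = 0"
  by (rule Q_eqI) (simp_all add: s'.subspace_0 Rc_subspace)

lemma Q_step:
  assumes i: "i \<le> k"
  shows "Q i r - Q (Suc i) r \<in> R (Suc i)"
proof -
  obtain a b where ab: "Q i r = a + b" "a \<in> R (Suc i)" "b \<in> Rc (Suc i)"
    using Q_in[of i r] i Rc_decompose[OF i] by auto
  have "r - b = (r - Q i r) + a" using ab by simp
  then have "r - b \<in> sumR (Suc i)"
    by (rule sumR_SucI[OF _ ab(2), rotated]) (use Q_diff[of i r] i in simp)
  then have "Q (Suc i) r = b" using Q_eqI ab i by simp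
  then show ?thesis using ab by simp
qed

text \<open>Each step splits \<open>Q i r \<in> Rc i\<close> along the closed direct sum of \<open>R (Suc i)\<close> and \<open>Rc (Suc i)\<close>, whose
  components are bounded.\<close>

lemma Q_bounded_operator: "i \<le> Suc k \<Longrightarrow> bounded_operator s' s' (Q i)"
proof (induction i)
  case 0
  have "Q 0 = (\<lambda>x. x)" by (simp add: fun_eq_iff Q_0)
  then show ?case using s'.bounded_operator_id by simp
next
  case (Suc i)
  then have i: "i \<le> k" by simp
  obtain C where C: "C \<ge> 0" "\<And>x. norm (Q i x) \<le> C * norm x"
    using bounded_operatorE Suc by (metis Suc_leD)
  have cl: "closed {u + v |u v. u \<in> Rc (Suc i) \<and> v \<in> R (Suc i)}"
  proof -
    have "{u + v |u v. u \<in> Rc (Suc i) \<and> v \<in> R (Suc i)} = Rc i"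
      unfolding Rc_decompose[OF i] by (auto, (metis add.commute)+)
    then show ?thesis using Rc_closed[of i] i by simp
  qed
  obtain D where D: "D \<ge> 0" "\<And>u v. u \<in> Rc (Suc i) \<Longrightarrow> v \<in> R (Suc i) \<Longrightarrow> norm u \<le> D * norm (u + v)"
    by (rule direct_sum_component_bounded[OF s'.subspace_imp_real_subspace[OF subspaces(6)[OF i]]
          subspaces(7)[OF i] s'.subspace_imp_real_subspace[OF subspaces(4)[OF i]] subspaces(5)[OF i] _ cl])
      (use subspaces(8)[OF i] in auto)
  show ?case
  proof (rule bounded_operatorI)
    show "norm (Q (Suc i) x) \<le> D * C * norm x" for x
    proof -
      have "norm (Q (Suc i) x) \<le> D * norm (Q (Suc i) x + (Q i x - Q (Suc i) x))"
        using D(2) Q_in Q_step i Suc.prems by blast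
      also have "\<dots> \<le> D * (C * norm x)" using C(2)[of x] D(1) by (intro mult_left_mono) auto
      finally show ?thesis by (simp add: mult.assoc)
    qed
    have "Q (Suc i) (x + y) = Q (Suc i) x + Q (Suc i) y" for x y
    proof (rule Q_eqI[OF Suc.prems])
      have "(x - Q (Suc i) x) + (y - Q (Suc i) y) \<in> sumR (Suc i)"
        by (intro s'.subspace_add sumR_subspace Q_diff Suc.prems)
      then show "x + y - (Q (Suc i) x + Q (Suc i) y) \<in> sumR (Suc i)" by (simp add: algebra_simps)
    qed (intro s'.subspace_add Rc_subspace Q_in Suc.prems)
    moreover have "Q (Suc i) (s' c x) = s' c (Q (Suc i) x)" for c x
    proof (rule Q_eqI[OF Suc.prems])
      have "s' c (x - Q (Suc i) x) \<in> sumR (Suc i)"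
        by (intro s'.subspace_scale sumR_subspace Q_diff Suc.prems)
      then show "s' c x - s' c (Q (Suc i) x) \<in> sumR (Suc i)" by (simp add: s'.scale_right_diff_distrib)
    qed (intro s'.subspace_scale Rc_subspace Q_in Suc.prems)
    ultimately show "module_hom s' s' (Q (Suc i))"
      by (simp add: module_hom_iff s'.module_axioms)
  qed
qed

lemmas Q_hom = bounded_operator_hom[OF Q_bounded_operator]

lemma Q_idem: "i \<le> Suc k \<Longrightarrow> r \<in> Rc i \<Longrightarrow> Q i r = r"
  by (rule Q_eqI) (simp_all add: s'.subspace_0 sumR_subspace)

lemma Q_Suc_eq_0:
  assumes i: "i \<le> k" and r: "Q i r \<in> R (Suc i)"
  shows "Q (Suc i) r = 0"
proof (rule Q_eq_0)
  have "r = (r - Q i r) + Q i r" by simp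
  then show "r \<in> sumR (Suc i)"
    by (rule sumR_SucI[OF _ r, rotated]) (use Q_diff[of i r] i in simp)
qed (use i in simp)

lemma Q_range_A_0: "i \<le> k \<Longrightarrow> Q (Suc i) (A 0 x) = 0"
proof (rule Q_eq_0)
  assume i: "i \<le> k"
  have "A 0 x \<in> R (Suc 0)" using R_Suc[of 0] by (simp add: S_1 N_0)
  then have "A 0 x \<in> sumR (Suc 0)" by (simp add: sumR_Suc sumR_0)
  then show "A 0 x \<in> sumR (Suc i)" using sumR_mono[of "Suc 0" "Suc i"] i by auto
qed simp

end

context chain
begin

subsection \<open>Lifts and correctors\<close>

text \<open>The inverse of the factor in the definition of the operator \<open>S (Suc i)\<close>.\<close>

definition ratio :: "nat \<Rightarrow> 'k" where
  "ratio i = fact i / fact (2 * i)"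

text \<open>For \<open>n \<in> N i\<close> a lift is a solution \<open>(n, v\<^sub>1, v\<^sub>2, \<dots>)\<close> of the first \<open>i\<close> homogeneous equations that
  depends on \<open>n\<close> by bounded operators. Requiring that its value in the next equation be exactly the
  multiple of \<open>S (Suc i) n\<close>, with no component in the earlier ranges, decouples the operators.\<close>

definition is_lift :: "nat \<Rightarrow> (nat \<Rightarrow> 'a \<Rightarrow> 'a) \<Rightarrow> bool" where
  "is_lift i L \<longleftrightarrow> (\<forall>j. bounded_operator s s (L j)) \<and> (\<forall>n. L 0 n = n) \<and>
     (\<forall>n\<in>N i. (\<forall>t<i. Tp (\<lambda>j. L j n) t = 0) \<and> Tp (\<lambda>j. L j n) i = s' (ratio i) (S (Suc i) n))"

text \<open>A corrector leaves the equations before the \<open>i\<close>-th untouched and produces there the component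
  of an arbitrary \<open>r\<close> in \<open>R 1 \<oplus> \<dots> \<oplus> R (Suc i)\<close>.\<close>

definition is_corrector :: "nat \<Rightarrow> (nat \<Rightarrow> 'b \<Rightarrow> 'a) \<Rightarrow> bool" where
  "is_corrector i \<Theta> \<longleftrightarrow> (\<forall>j. bounded_operator s' s (\<Theta> j)) \<and>
     (\<forall>r. (\<forall>t<i. Tp (\<lambda>j. \<Theta> j r) t = 0) \<and> Tp (\<lambda>j. \<Theta> j r) i = r - Q (Suc i) r)"

text \<open>The set \<open>N i\<close> will turn out to consist of the first entries of the solutions of the first \<open>i\<close>
  homogeneous equations; this is the harder inclusion.\<close>

definition kernel_heads :: "nat \<Rightarrow> bool" where
  "kernel_heads i \<longleftrightarrow> (\<forall>u. (\<forall>t<i. Tp u t = 0) \<longrightarrow> u 0 \<in> N i)"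

text \<open>This is the independence of the value \<open>S (Suc i) v\<^sub>0\<close> from the choice of \<open>v\<^sub>1, v\<^sub>2, \<dots>\<close>, applied to the
  difference of two choices.\<close>

definition headless_values :: "nat \<Rightarrow> bool" where
  "headless_values i \<longleftrightarrow> (\<forall>d. d 0 = 0 \<longrightarrow> (\<forall>t<i. Tp d t = 0) \<longrightarrow> Q i (Tp d i) = 0)"

lemma ratio_nonzero: "ratio i \<noteq> 0"
  by (simp add: ratio_def)

text \<open>Although \<open>S (Suc i)\<close> is given by a choice, it is linear on \<open>N i\<close> because a lift is.\<close>

lemma lift_S_linear:
  assumes L: "is_lift i L" and i: "i \<le> k" and x: "x \<in> N i"
  shows "y \<in> N i \<Longrightarrow> S (Suc i) (x + y) = S (Suc i) x + S (Suc i) y"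
    and "S (Suc i) (s c x) = s' c (S (Suc i) x)"
proof -
  have S: "s' (ratio i) (S (Suc i) n) = Tp (\<lambda>j. L j n) i" if "n \<in> N i" for n
    using L that by (simp add: is_lift_def)
  have hom: "module_hom s s (L j)" for j using L by (simp add: is_lift_def bounded_operator_hom)
  have N: "s.subspace (N i)" using N_subspace i by simp
  have "s' (ratio i) (S (Suc i) (s c x)) = s' (ratio i) (s' c (S (Suc i) x))"
  proof -
    have "s' (ratio i) (S (Suc i) (s c x)) = s' c (Tp (\<lambda>j. L j x) i)"
      using s.subspace_scale[OF N x]
      by (simp add: S toeplitz_def module_hom.scale[OF hom] s'.scale_sum_right)
    then show ?thesis using x by (simp add: S[symmetric] mult.commute)
  qed
  then show "S (Suc i) (s c x) = s' c (S (Suc i) x)"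
    using ratio_nonzero by (simp only: s'.scale_cancel_left) simp
  assume y: "y \<in> N i"
  have "s' (ratio i) (S (Suc i) (x + y)) = s' (ratio i) (S (Suc i) x + S (Suc i) y)"
    using s.subspace_add[OF N x y] x y
    by (simp add: S s'.scale_right_distrib toeplitz_add module_hom.add[OF hom])
  then show "S (Suc i) (x + y) = S (Suc i) x + S (Suc i) y"
    using ratio_nonzero by (simp only: s'.scale_cancel_left) simp
qed

text \<open>By the bounded inverse theorem, the component of \<open>r\<close> in \<open>R (Suc i)\<close> is attained by \<open>S (Suc i)\<close>
  at a point that depends boundedly on \<open>r\<close>.\<close>

lemma bounded_right_inverse:
  assumes i: "i \<le> k" and L: "is_lift i L"
  obtains H where "bounded_operator s' s H" "\<And>r. H r \<in> N i" "\<And>r. S (Suc i) (H r) = Q i r - Q (Suc i) r"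
proof -
  let ?U = "Nc (Suc i)" and ?V = "R (Suc i)" and ?f = "S (Suc i)"
  note sub = subspaces[OF i] and NcN = Nc_subset_N[OF i, THEN subsetD]
  note add = lift_S_linear(1)[OF L i NcN NcN] and scale = lift_S_linear(2)[OF L i NcN]
  have scaleR: "?f (c *\<^sub>R x) = c *\<^sub>R ?f x" if "x \<in> ?U" for c x
    using scale[OF that, of "of_real c"] by (simp only: s.scale_of_real s'.scale_of_real)
  have bij: "bij_betw ?f ?U ?V" by (rule S_bij[OF i])
  obtain C where C: "C \<ge> 0" "\<And>x. x \<in> ?U \<Longrightarrow> norm x \<le> C * norm (?f x)"
    using bounded_inverse[OF s.subspace_imp_real_subspace[OF sub(1)] sub(2)
        s'.subspace_imp_real_subspace[OF sub(4)] sub(5) add scaleR S_cont[OF i] bij] by metis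
  define H where "H r = inv_into ?U ?f (Q i r - Q (Suc i) r)" for r
  have im: "Q i r - Q (Suc i) r \<in> ?f ` ?U" for r
    using Q_step[OF i] bij by (simp add: bij_betw_def)
  have HU: "H r \<in> ?U" and fH: "?f (H r) = Q i r - Q (Suc i) r" for r
    unfolding H_def by (rule inv_into_into[OF im], rule f_inv_into_f[OF im])
  have H_eq: "H r = x" if "x \<in> ?U" "?f x = Q i r - Q (Suc i) r" for r x
    using bij that HU[of r] fH[of r] unfolding bij_betw_def inj_on_def by metis
  have iS: "i \<le> Suc k" "Suc i \<le> Suc k" using i by simp_all
  interpret o: operators s' s' by (rule operators.intro) (rule s'.normed_space_over_axioms)+
  have comp: "bounded_operator s' s' (\<lambda>r. Q i r - Q (Suc i) r)"
    by (intro o.bounded_operator_diff Q_bounded_operator iS)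
  obtain D where D: "D \<ge> 0" "\<And>r. norm (Q i r - Q (Suc i) r) \<le> D * norm r"
    using bounded_operatorE[OF comp] by metis
  note hom = bounded_operator_hom[OF comp]
  have "bounded_operator s' s H"
  proof (rule bounded_operatorI)
    show "norm (H r) \<le> C * D * norm r" for r
    proof -
      have "norm (H r) \<le> C * norm (Q i r - Q (Suc i) r)" using C(2)[OF HU[of r]] by (simp add: fH)
      also have "\<dots> \<le> C * (D * norm r)" using D C(1) by (intro mult_left_mono) auto
      finally show ?thesis by (simp add: mult.assoc)
    qed
    have "H (x + y) = H x + H y" for x y
      by (rule H_eq) (simp_all add: s.subspace_add sub HU add fH module_hom.add[OF hom] del: diff_add_eq)
    moreover have "H (s' c x) = s c (H x)" for c x
      by (rule H_eq) (simp_all add: s.subspace_scale sub HU scale fH module_hom.scale[OF hom])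
    ultimately show "module_hom s' s H"
      by (simp add: module_hom_iff s.module_axioms s'.module_axioms)
  qed
  then show thesis using that HU fH NcN by blast
qed

text \<open>The component of \<open>r\<close> in \<open>R (Suc i)\<close> comes from a lift, the components in the earlier ranges from a
  corrector for the preceding equation, delayed by one place.\<close>

lemma corrector_exists:
  assumes i: "i \<le> k" and L: "is_lift i L"
    and \<Theta>': "\<And>j. bounded_operator s' s (\<Theta>' j)" "\<And>t r. t < i \<Longrightarrow> Tp (case_nat 0 (\<lambda>j. \<Theta>' j r)) t = 0"
      "\<And>r. Tp (case_nat 0 (\<lambda>j. \<Theta>' j r)) i = r - Q i r"
  shows "\<exists>\<Theta>. is_corrector i \<Theta>"
proof -
  obtain H where H: "bounded_operator s' s H" "\<And>r. H r \<in> N i" "\<And>r. S (Suc i) (H r) = Q i r - Q (Suc i) r"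
    using bounded_right_inverse[OF i L] by metis
  interpret o: operators s' s using s'.normed_space_over_axioms s.normed_space_over_axioms by (rule operators.intro)
  define h where "h r = s (inverse (ratio i)) (H r)" for r
  have hN: "h r \<in> N i" for r unfolding h_def using s.subspace_scale[OF N_subspace H(2)] i by simp
  have Sh: "s' (ratio i) (S (Suc i) (h r)) = Q i r - Q (Suc i) r" for r
    unfolding h_def using lift_S_linear(2)[OF L i H(2)] ratio_nonzero by (simp add: H(3))
  have bh: "bounded_operator s' s h"
    unfolding h_def by (rule bounded_operator_compose[OF H(1) s.bounded_operator_scale])
  define \<Theta> where "\<Theta> j r = L j (h r) + case_nat 0 (\<lambda>j. \<Theta>' j r) j" for j r
  have "bounded_operator s' s (\<Theta> j)" for j
    unfolding \<Theta>_def using L \<Theta>'(1)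
    by (intro bounded_operator_add bounded_operator_compose[OF bh] o.bounded_operator_case_nat) (auto simp: is_lift_def)
  moreover have "Tp (\<lambda>j. \<Theta> j r) t = 0" if "t < i" for t r
    unfolding \<Theta>_def toeplitz_add using L hN \<Theta>'(2)[OF that, of r] that by (simp add: is_lift_def)
  moreover have "Tp (\<lambda>j. \<Theta> j r) i = r - Q (Suc i) r" for r
    unfolding \<Theta>_def toeplitz_add using L hN Sh \<Theta>'(3)[of r] by (simp add: is_lift_def)
  ultimately show ?thesis unfolding is_corrector_def by blast
qed

text \<open>Subtracting the lift of \<open>u 0\<close> from \<open>u\<close> leaves a homogeneous solution without first entry.\<close>

lemma homogeneous_value:
  assumes L: "is_lift i L" and H: "headless_values i" and i: "i \<le> k"
    and u: "u 0 \<in> N i" "\<And>t. t < i \<Longrightarrow> Tp u t = 0"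
  shows "Q i (Tp u i) = s' (ratio i) (S (Suc i) (u 0))"
proof -
  have "Q i (Tp (\<lambda>j. u j - L j (u 0)) i) = 0"
    using H L u unfolding headless_values_def is_lift_def toeplitz_diff
    by (elim allE[of _ "\<lambda>j. u j - L j (u 0)"]) (simp add: toeplitz_diff)
  then have "Q i (Tp u i) = Q i (s' (ratio i) (S (Suc i) (u 0)))"
    using L u(1) i by (simp add: toeplitz_diff is_lift_def module_hom.diff[OF Q_hom])
  moreover have "S (Suc i) (u 0) \<in> Rc i"
    using R_Suc[OF i] R_subset_Rc[OF i] u(1) by blast
  ultimately show ?thesis using Q_idem s'.subspace_scale[OF Rc_subspace] i by simp
qed

lemma kernel_heads_Suc:
  assumes "is_lift i L" "headless_values i" "kernel_heads i" and i: "i \<le> k"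
  shows "kernel_heads (Suc i)"
  unfolding kernel_heads_def
proof (intro allI impI)
  fix u assume u: "\<forall>t<Suc i. Tp u t = 0"
  then have N: "u 0 \<in> N i" using assms(3) by (simp add: kernel_heads_def)
  then have "s' (ratio i) (S (Suc i) (u 0)) = 0"
    using homogeneous_value[where u = u, OF assms(1,2) i N] u i by (simp add: module_hom.zero[OF Q_hom])
  then show "u 0 \<in> N (Suc i)" using N ratio_nonzero by (simp add: N_Suc[OF i])
qed

lemma headless_values_Suc:
  assumes "is_lift i L" "headless_values i" "kernel_heads i" and i: "i \<le> k"
  shows "headless_values (Suc i)"
  unfolding headless_values_def
proof (intro allI impI)
  fix d assume d: "d 0 = 0" "\<forall>t<Suc i. Tp d t = 0"
  define u where "u j = d (Suc j)" for j
  have tail: "Tp d (Suc t) = Tp u t" for t using toeplitz_tail[of d, OF d(1)] by (simp add: u_def[abs_def])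
  have u: "Tp u t = 0" if "t < i" for t using d(2) that tail[of t] by simp
  then have N: "u 0 \<in> N i" using assms(3) by (simp add: kernel_heads_def)
  have "S (Suc i) (u 0) \<in> R (Suc i)" using R_Suc[OF i] N by blast
  then have "Q i (Tp u i) \<in> R (Suc i)"
    using homogeneous_value[where u = u, OF assms(1,2) i N u] s'.subspace_scale[OF subspaces(4)[OF i]] by simp
  then show "Q (Suc i) (Tp d (Suc i)) = 0" unfolding tail by (rule Q_Suc_eq_0[OF i])
qed

text \<open>The value \<open>S (Suc (Suc i)) n\<close> is computed from some solution \<open>v\<close> of the homogeneous equations
  starting with \<open>n\<close>; by \<open>headless_values\<close> every solution gives the same value, in particular the
  lift at hand.\<close>

lemma S_next_eq:
  assumes i: "Suc i \<le> k" and H: "headless_values (Suc i)" and n: "n \<in> N (Suc i)"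
    and w: "w 0 = n" "\<And>t. t < Suc i \<Longrightarrow> Tp w t = 0"
  shows "s' (ratio (Suc i)) (S (Suc (Suc i)) n) = Q (Suc i) (Tp w (Suc i))"
proof -
  define P where "P v \<longleftrightarrow> v 0 = n \<and> (\<forall>t<Suc i. (\<Sum>j=0..t. A j (v (t - j))) = 0)" for v
  define v where "v = (SOME v. P v)"
  have "P w" using w by (simp add: P_def toeplitz_def)
  then have "P v" unfolding v_def by (rule someI[of P w])
  then have v: "v 0 = n" "\<And>t. t < Suc i \<Longrightarrow> Tp v t = 0" by (auto simp: P_def toeplitz_def)
  have "Q (Suc i) (Tp (\<lambda>j. v j - w j) (Suc i)) = 0"
    using H v w unfolding headless_values_def
    by (elim allE[of _ "\<lambda>j. v j - w j"]) (simp add: toeplitz_diff)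
  then have eq: "Q (Suc i) (Tp v (Suc i)) = Q (Suc i) (Tp w (Suc i))"
    using i by (simp add: toeplitz_diff module_hom.diff[OF Q_hom])
  have "Tp v (Suc i) = A 0 (v (Suc i)) + (\<Sum>j=1..Suc i. A j (v (Suc i - j)))"
    unfolding toeplitz_def by (subst sum.atLeast_Suc_atMost) simp_all
  then have "Q (Suc i) (Tp v (Suc i)) = Q (Suc i) (\<Sum>j=1..Suc i. A j (v (Suc i - j)))"
    using i Q_range_A_0[of i] by (simp add: module_hom.add[OF Q_hom] del: sum.cl_ivl_Suc)
  moreover have "S (Suc (Suc i)) n
      = s' (fact (2 * Suc i) / fact (Suc i)) (Q (Suc i) (\<Sum>j=1..Suc i. A j (v (Suc i - j))))"
    using S_next[of i n] i n unfolding next_operator_def Let_def P_def[symmetric] v_def[symmetric] Q_def by simp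
  ultimately show ?thesis
    by (simp add: eq ratio_def del: sum.cl_ivl_Suc fact_Suc mult_Suc_right)
qed

text \<open>If \<open>n \<in> N (Suc i)\<close>, the old lift already satisfies one equation more. A delayed corrector then
  removes from its value in the following equation all components in the ranges up to \<open>R (Suc i)\<close>.\<close>

lemma lift_Suc:
  assumes i: "Suc i \<le> k" and L: "is_lift i L" and \<Theta>: "is_corrector i \<Theta>" and H: "headless_values (Suc i)"
  shows "\<exists>L'. is_lift (Suc i) L'"
proof -
  define e where "e n = Tp (\<lambda>j. L j n) (Suc i)" for n
  define L' where "L' j n = L j n - case_nat 0 (\<lambda>j. \<Theta> j (e n)) j" for j n
  interpret o: operators s s by (rule operators.intro) (rule s.normed_space_over_axioms)+
  have bL: "bounded_operator s s (L j)" for j using L by (simp add: is_lift_def)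
  have be: "bounded_operator s s' e"
    unfolding e_def by (rule bounded_operator_toeplitz[OF bL s.normed_space_over_axioms])
  have b: "bounded_operator s s (L' j)" for j
    unfolding L'_def using \<Theta>
    by (intro o.bounded_operator_diff bL o.bounded_operator_case_nat bounded_operator_compose[OF be])
      (simp add: is_corrector_def)
  have 0: "L' 0 n = n" for n using L by (simp add: L'_def is_lift_def)
  have "(\<forall>t<Suc i. Tp (\<lambda>j. L' j n) t = 0) \<and>
      Tp (\<lambda>j. L' j n) (Suc i) = s' (ratio (Suc i)) (S (Suc (Suc i)) n)" if n: "n \<in> N (Suc i)" for n
  proof -
    have n': "n \<in> N i" "S (Suc i) n = 0" using n N_Suc[of i] i by simp_all
    then have L0: "Tp (\<lambda>j. L j n) t = 0" if "t < Suc i" for t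
      using L that by (cases "t = i") (auto simp: is_lift_def)
    have "Tp (case_nat 0 (\<lambda>j. \<Theta> j (e n))) t = 0" if "t < Suc i" for t
      using \<Theta> that by (cases t) (auto simp: is_corrector_def)
    moreover have "Tp (case_nat 0 (\<lambda>j. \<Theta> j (e n))) (Suc i) = e n - Q (Suc i) (e n)"
      using \<Theta> by (simp add: is_corrector_def)
    moreover have "s' (ratio (Suc i)) (S (Suc (Suc i)) n) = Q (Suc i) (e n)"
      unfolding e_def by (rule S_next_eq[OF i H n]) (use L L0 in \<open>auto simp: is_lift_def\<close>)
    moreover have "Tp (\<lambda>j. L j n) (Suc i) = e n" by (simp add: e_def)
    ultimately show ?thesis using L0 by (simp add: L'_def toeplitz_diff)
  qed
  then show ?thesis unfolding is_lift_def using b 0 by blast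
qed

text \<open>Lifts and correctors need each other: a lift of index \<open>i\<close> yields the corrector of index \<open>i\<close>, which
  yields the lift of index \<open>Suc i\<close>.\<close>

lemma lifts_and_correctors:
  "i \<le> k \<Longrightarrow> (\<exists>L. is_lift i L) \<and> (\<exists>\<Theta>. is_corrector i \<Theta>) \<and> kernel_heads i \<and> headless_values i"
proof (induction i)
  case 0
  interpret o: operators s' s using s'.normed_space_over_axioms s.normed_space_over_axioms by (rule operators.intro)
  interpret o2: operators s s by (rule operators.intro) (rule s.normed_space_over_axioms)+
  have "bounded_operator s s (\<lambda>n. if j = 0 then n else 0)" for j :: nat
    by (cases "j = 0") (simp_all add: s.bounded_operator_id o2.bounded_operator_0)
  then have L: "is_lift 0 (\<lambda>j n. if j = 0 then n else 0)"
    by (simp add: is_lift_def toeplitz_def ratio_def S_1)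
  moreover have "\<exists>\<Theta>. is_corrector 0 \<Theta>"
    by (rule corrector_exists[OF 0 L, of "\<lambda>j r. 0"]) (auto simp: o.bounded_operator_0 Q_0)
  ultimately show ?case
    by (auto simp: kernel_heads_def N_0 headless_values_def toeplitz_def Q_0)
next
  case (Suc i)
  then obtain L \<Theta> where h: "is_lift i L" "is_corrector i \<Theta>" "kernel_heads i" "headless_values i" and i: "i \<le> k"
    by auto
  have K: "kernel_heads (Suc i)" and H: "headless_values (Suc i)"
    using kernel_heads_Suc headless_values_Suc h i by blast+
  obtain L' where L': "is_lift (Suc i) L'" using lift_Suc[OF Suc.prems h(1,2) H] by blast
  have "\<exists>\<Theta>. is_corrector (Suc i) \<Theta>"
  proof (rule corrector_exists[OF Suc.prems L'])
    show "bounded_operator s' s (\<Theta> j)" for j using h(2) by (simp add: is_corrector_def)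
    show "Tp (case_nat 0 (\<lambda>j. \<Theta> j r)) t = 0" if "t < Suc i" for t r
      using h(2) that by (cases t) (auto simp: is_corrector_def)
    show "Tp (case_nat 0 (\<lambda>j. \<Theta> j r)) (Suc i) = r - Q (Suc i) r" for r
      using h(2) by (simp add: is_corrector_def)
  qed
  then show ?case using L' K H by blast
qed

subsection \<open>Solving the linear system\<close>

text \<open>Together, the next two lemmas identify \<open>N i\<close> with the first entries of homogeneous solutions.\<close>

lemma head_in_N:
  assumes "i \<le> Suc k" "\<And>t. t < i \<Longrightarrow> Tp u t = 0"
  shows "u 0 \<in> N i"
proof -
  have "kernel_heads i"
    using assms(1) lifts_and_correctors kernel_heads_Suc by (cases "i \<le> k") (auto simp: le_Suc_eq)
  then show ?thesis using assms(2) by (simp add: kernel_heads_def)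
qed

lemma N_head:
  assumes "i \<le> Suc k" "v \<in> N i"
  obtains u where "u 0 = v" "\<And>t. t < i \<Longrightarrow> Tp u t = 0"
proof (cases i)
  case 0
  then show thesis using that[of "\<lambda>_. v"] by simp
next
  case (Suc j)
  then have j: "j \<le> k" using assms by simp
  obtain L where L: "is_lift j L" using lifts_and_correctors[OF j] by blast
  have v: "v \<in> N j" "S (Suc j) v = 0" using assms(2) N_Suc[OF j] Suc by auto
  show thesis
  proof (rule that[of "\<lambda>m. L m v"])
    show "Tp (\<lambda>m. L m v) t = 0" if "t < i" for t
      using L v that Suc by (cases "t = j") (auto simp: is_lift_def)
  qed (use L in \<open>simp add: is_lift_def\<close>)
qed

text \<open>A bounded linear pseudo-inverse of the first \<open>i\<close> equations: solve the first \<open>i\<close> and let the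
  corrector absorb the defect in the next one. The defect of a solvable right-hand side lies in
  \<open>R 1 \<oplus> \<dots> \<oplus> R (Suc i)\<close>, where the corrector is exact.\<close>

lemma pseudo_inverse:
  "i \<le> Suc k \<Longrightarrow> \<exists>\<Psi>. (\<forall>j t. bounded_operator s' s (\<Psi> j t)) \<and>
     (\<forall>w. \<forall>t<i. Tp (\<lambda>j. \<Sum>\<tau><i. \<Psi> j \<tau> (Tp w \<tau>)) t = Tp w t)"
proof (induction i)
  case 0
  interpret o: operators s' s using s'.normed_space_over_axioms s.normed_space_over_axioms by (rule operators.intro)
  show ?case by (rule exI[of _ "\<lambda>_ _ _. 0"]) (simp add: o.bounded_operator_0)
next
  case (Suc i)
  interpret o: operators s' s using s'.normed_space_over_axioms s.normed_space_over_axioms by (rule operators.intro)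
  have i: "i \<le> k" using Suc by simp
  obtain \<Psi> where \<Psi>: "\<And>j t. bounded_operator s' s (\<Psi> j t)"
    "\<And>w t. t < i \<Longrightarrow> Tp (\<lambda>j. \<Sum>\<tau><i. \<Psi> j \<tau> (Tp w \<tau>)) t = Tp w t"
    using Suc by auto
  obtain L \<Theta> where h: "is_lift i L" "is_corrector i \<Theta>" "kernel_heads i" "headless_values i"
    using lifts_and_correctors[OF i] by blast
  have H: "headless_values (Suc i)" by (rule headless_values_Suc[OF h(1,4,3) i])
  have b\<Theta>: "bounded_operator s' s (\<Theta> j)" for j using h(2) by (simp add: is_corrector_def)
  define E where "E \<tau> x = Tp (\<lambda>j. \<Psi> j \<tau> x) i" for \<tau> x
  have bE: "bounded_operator s' s' (E \<tau>)" for \<tau>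
    unfolding E_def by (rule bounded_operator_toeplitz[OF \<Psi>(1) s'.normed_space_over_axioms])
  \<comment> \<open>\<open>E \<tau>\<close> collects what the right-hand side \<open>\<tau>\<close> contributes to the equation with number \<open>i\<close> through the
    solution so far; the corrector has to remove it and to supply the new right-hand side.\<close>
  define \<Psi>' where "\<Psi>' j \<tau> x = (if \<tau> < i then \<Psi> j \<tau> x - \<Theta> j (E \<tau> x) else \<Theta> j x)" for j \<tau> x
  have "bounded_operator s' s (\<Psi>' j t)" for j t
    unfolding \<Psi>'_def
    by (cases "t < i") (simp_all add: b\<Theta> \<Psi>(1) o.bounded_operator_diff bounded_operator_compose[OF bE])
  moreover have "Tp (\<lambda>j. \<Sum>\<tau><Suc i. \<Psi>' j \<tau> (Tp w \<tau>)) t = Tp w t" if t: "t < Suc i" for w t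
  proof -
    define v where "v j = (\<Sum>\<tau><i. \<Psi> j \<tau> (Tp w \<tau>))" for j
    define r where "r = Tp w i - Tp v i"
    have "Tp v i = (\<Sum>\<tau><i. E \<tau> (Tp w \<tau>))"
      unfolding v_def E_def by (rule toeplitz_sum)
    then have "(\<Sum>\<tau><Suc i. \<Psi>' j \<tau> (Tp w \<tau>)) = v j + \<Theta> j r" for j
      unfolding \<Psi>'_def v_def r_def
      by (simp add: sum_subtractf module_hom.diff[OF bounded_operator_hom[OF b\<Theta>]]
          module_hom.sum[OF bounded_operator_hom[OF b\<Theta>]])
    then have eq: "Tp (\<lambda>j. \<Sum>\<tau><Suc i. \<Psi>' j \<tau> (Tp w \<tau>)) t = Tp v t + Tp (\<lambda>j. \<Theta> j r) t"
      by (simp add: toeplitz_add)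
    have hom: "Tp (\<lambda>j. w j - v j) t = 0" if "t < i" for t
      using \<Psi>(2)[OF that, of w] by (simp add: toeplitz_diff v_def)
    have "Tp (case_nat 0 (\<lambda>j. w j - v j)) t = 0" if "t < Suc i" for t
      using hom that by (cases t) auto
    then have "Q (Suc i) (Tp (case_nat 0 (\<lambda>j. w j - v j)) (Suc i)) = 0"
      using H[unfolded headless_values_def, rule_format, of "case_nat 0 (\<lambda>j. w j - v j)"] by simp
    then have "Q (Suc i) r = 0" by (simp add: toeplitz_diff r_def)
    then have "Tp (\<lambda>j. \<Theta> j r) i = r" "\<And>t. t < i \<Longrightarrow> Tp (\<lambda>j. \<Theta> j r) t = 0"
      using h(2) by (simp_all add: is_corrector_def)
    moreover have "Tp v t = Tp w t" if "t < i" using \<Psi>(2)[OF that, of w] by (simp add: v_def[abs_def])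
    moreover have "Tp v i + r = Tp w i" by (simp add: r_def)
    ultimately show ?thesis unfolding eq using t by (cases "t = i") auto
  qed
  ultimately show ?case by blast
qed

lemma head_of_solution:
  assumes i: "i \<le> Suc k"
  shows "\<exists>\<Psi>. (\<forall>t. bounded_operator s' s (\<Psi> t)) \<and> (\<forall>w. w 0 - (\<Sum>t<i. \<Psi> t (Tp w t)) \<in> N i)"
proof -
  obtain \<Psi> where \<Psi>: "\<And>j t. bounded_operator s' s (\<Psi> j t)"
    "\<And>w t. t < i \<Longrightarrow> Tp (\<lambda>j. \<Sum>\<tau><i. \<Psi> j \<tau> (Tp w \<tau>)) t = Tp w t"
    using pseudo_inverse[OF i] by blast
  have "w 0 - (\<Sum>t<i. \<Psi> 0 t (Tp w t)) \<in> N i" for w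
    by (rule head_in_N[OF i, of "\<lambda>j. w j - (\<Sum>t<i. \<Psi> j t (Tp w t))"]) (simp add: toeplitz_diff \<Psi>(2))
  then show ?thesis using \<Psi>(1) by blast
qed

text \<open>Regularity means that \<open>Q (Suc k)\<close> vanishes, so the corrector of index \<open>k\<close> is exact everywhere.\<close>

lemma regular_solvable:
  assumes "sum_operator_surj (k + 1) S N"
  obtains u where "\<And>t. t < k \<Longrightarrow> Tp u t = 0" "Tp u k = r"
proof -
  have "r \<in> sumR (Suc k)"
  proof -
    have "r \<in> (\<lambda>n. \<Sum>i<k+1. S (Suc i) (n i)) ` Pi\<^sub>E {..<k+1} N"
      using assms unfolding sum_operator_surj_def by blast
    then obtain n where n: "n \<in> Pi\<^sub>E {..<k+1} N" "r = (\<Sum>i<k+1. S (Suc i) (n i))" by blast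
    have "r = (\<Sum>j=1..Suc k. S j (n (j - 1)))"
      unfolding n(2) by (rule sum.reindex_bij_witness[of _ "\<lambda>j. j - 1" Suc]) auto
    moreover have "\<forall>j\<in>{1..Suc k}. S j (n (j - 1)) \<in> R j"
    proof
      fix j assume j: "j \<in> {1..Suc k}"
      then obtain j' where "j = Suc j'" "j' \<le> k" by (cases j) auto
      then show "S j (n (j - 1)) \<in> R j" using R_Suc[of j'] n(1) by (auto simp: PiE_iff)
    qed
    ultimately show ?thesis unfolding sum_of_subspaces_def by blast
  qed
  then have "Q (Suc k) r = 0" by (intro Q_eq_0) auto
  moreover obtain \<Theta> where "is_corrector k \<Theta>" using lifts_and_correctors by blast
  ultimately show thesis using that[of "\<lambda>j. \<Theta> j r"] by (simp add: is_corrector_def)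
qed

text \<open>If \<open>S (Suc k)\<close> vanished on \<open>N k\<close>, it would contribute nothing to the sum operator.\<close>

lemma N_strict:
  assumes surj: "sum_operator_surj (k + 1) S N" and not: "\<not> sum_operator_surj k S N"
  obtains v where "v \<in> N k" "v \<notin> N (Suc k)"
proof (rule ccontr)
  assume "\<not> thesis"
  then have "N k \<subseteq> N (Suc k)" using that by blast
  then have S0: "S (Suc k) v = 0" if "v \<in> N k" for v using N_Suc[of k] that by auto
  have "r \<in> (\<lambda>n. \<Sum>i<k. S (Suc i) (n i)) ` Pi\<^sub>E {..<k} N" for r
  proof -
    have "r \<in> (\<lambda>n. \<Sum>i<k+1. S (Suc i) (n i)) ` Pi\<^sub>E {..<k+1} N"
      using surj unfolding sum_operator_surj_def by blast
    then obtain n where n: "n \<in> Pi\<^sub>E {..<k+1} N" "r = (\<Sum>i<k+1. S (Suc i) (n i))" by blast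
    have "n k \<in> N k" using n(1) by (simp add: PiE_iff)
    then have "r = (\<Sum>i<k. S (Suc i) (restrict n {..<k} i))" using n(2) S0 by simp
    moreover have "restrict n {..<k} \<in> Pi\<^sub>E {..<k} N" using n(1) by (auto simp: PiE_iff)
    ultimately show ?thesis by blast
  qed
  then show False using not unfolding sum_operator_surj_def by blast
qed

end

section \<open>Weighted compositions of multilinear mappings\<close>

text \<open>Compositions of multilinear mappings in which the variable \<open>i\<close> has weight \<open>i\<close>: \<open>d\<close> bounds the
  weighted degree. The bookkeeping of weights is what yields the bound on the degrees of the
  coordinate polynomials.\<close>

inductive weighted_composition ::
  "('k::field \<Rightarrow> 'a::real_normed_vector \<Rightarrow> 'a) \<Rightarrow> nat set \<Rightarrow> nat \<Rightarrow> ((nat \<Rightarrow> 'a) \<Rightarrow> 'a) \<Rightarrow> bool"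
  for s V where
  var: "i \<in> V \<Longrightarrow> i \<le> d \<Longrightarrow> weighted_composition s V d (\<lambda>p. p i)"
| add: "weighted_composition s V d f \<Longrightarrow> weighted_composition s V d g \<Longrightarrow>
     weighted_composition s V d (\<lambda>p. f p + g p)"
| comp: "bounded_multilinear s s m M \<Longrightarrow> (\<And>j. j < m \<Longrightarrow> weighted_composition s V (e j) (f j)) \<Longrightarrow>
     (\<Sum>j<m. e j) \<le> d \<Longrightarrow> weighted_composition s V d (\<lambda>p. M (\<lambda>j. f j p))"

lemma weighted_composition_imp_multilinear_composition:
  "weighted_composition s V d f \<Longrightarrow> multilinear_composition s V f"
  by (induction rule: weighted_composition.induct) (auto intro: multilinear_composition.intros)

lemma weighted_composition_subst:
  "weighted_composition s V d f \<Longrightarrow> (\<And>i d. i \<in> V \<Longrightarrow> i \<le> d \<Longrightarrow> weighted_composition s V' d (g i)) \<Longrightarrow>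
    weighted_composition s V' d (\<lambda>p. f (\<lambda>i. g i p))"
proof (induction rule: weighted_composition.induct)
  case (comp m M e f d)
  then show ?case by (intro weighted_composition.comp[of s m M V' e "\<lambda>j p. f j (\<lambda>i. g i p)"]) auto
qed (auto intro: weighted_composition.intros)

lemma weighted_composition_mono:
  assumes "weighted_composition s V d f" "V \<subseteq> V'" "d \<le> d'"
  shows "weighted_composition s V' d' f"
  using assms
proof (induction arbitrary: d' rule: weighted_composition.induct)
  case (comp m M e f d)
  then show ?case by (intro weighted_composition.comp[of s m M V' e f]) auto
qed (auto intro: weighted_composition.intros)

lemma bounded_multilinear_operator_comp:
  assumes a: "multilinear s s' n a" and bd: "\<And>x. norm (a x) \<le> c * (\<Prod>i<n. norm (x i))"
    and K: "bounded_operator s' s'' K"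
  shows "bounded_multilinear s s'' n (\<lambda>x. K (a x))"
  unfolding bounded_multilinear_def multilinear_def
proof (intro conjI allI impI)
  show "K (a x) = K (a y)" if "\<forall>i<n. x i = y i" for x y
    using multilinear_cong[OF a, of x y] that by simp
  show "Vector_Spaces.linear s s'' (\<lambda>u. K (a (x(i := u))))" if "i < n" for i x
    using multilinear_upd[OF a that, of x] bounded_operator_hom[OF K]
    unfolding module_hom_iff_linear[symmetric] by (simp add: module_hom_iff)
  obtain C where C: "C \<ge> 0" "\<And>x. norm (K x) \<le> C * norm x" using bounded_operatorE[OF K] by metis
  have "norm (K (a x)) \<le> (C * c) * (\<Prod>i<n. norm (x i))" for x
    using order_trans[OF C(2) mult_left_mono[OF bd[of x] C(1)]] by (simp add: mult.assoc)
  then show "\<exists>C. \<forall>x. norm (K (a x)) \<le> C * (\<Prod>i<n. norm (x i))" by blast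
qed

context normed_space_over
begin

lemma weighted_composition_const: "weighted_composition scale V d (\<lambda>_. c)"
proof -
  have "bounded_multilinear scale scale 0 (\<lambda>_. c)"
    by (auto simp: bounded_multilinear_def multilinear_def)
  then show ?thesis by (rule weighted_composition.comp[of scale 0 "\<lambda>_. c"]) auto
qed

lemma weighted_composition_operator:
  assumes K: "bounded_operator scale scale K" and f: "weighted_composition scale V d f"
  shows "weighted_composition scale V d (\<lambda>p. K (f p))"
proof -
  have "multilinear scale scale 1 (\<lambda>x. x 0)"
    by (auto simp: multilinear_def linear_ident)
  then have "bounded_multilinear scale scale 1 (\<lambda>x. K (x 0))"
    by (rule bounded_multilinear_operator_comp[of _ _ _ _ 1, OF _ _ K]) simp
  then show ?thesis
    by (rule weighted_composition.comp[where f = "\<lambda>_. f" and e = "\<lambda>_. d"]) (use f in auto)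
qed

lemma weighted_composition_sum:
  "(\<And>i. i \<in> I \<Longrightarrow> weighted_composition scale V d (f i)) \<Longrightarrow> weighted_composition scale V d (\<lambda>p. \<Sum>i\<in>I. f i p)"
  by (induction I rule: infinite_finite_induct)
    (auto simp: weighted_composition_const intro: weighted_composition.add)

lemma weighted_composition_uminus:
  "weighted_composition scale V d f \<Longrightarrow> weighted_composition scale V d (\<lambda>p. - f p)"
  using weighted_composition_operator[OF bounded_operator_scale[of "- 1"]] by simp

end

section \<open>Coordinates of weighted compositions\<close>

text \<open>An exponent vector may be listed under several indices.\<close>

lemma polynomial_of_degree_leI:
  assumes fin: "finite I" and deg: "\<And>i. i \<in> I \<Longrightarrow> (\<Sum>v\<in>V. ex i v) \<le> d"
    and f: "\<And>x. f x = (\<Sum>i\<in>I. c i * (\<Prod>v\<in>V. x v ^ ex i v))"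
  shows "polynomial_of_degree_le V d f"
  unfolding polynomial_of_degree_le_def
proof (intro exI[of _ "ex ` I"] exI[of _ "\<lambda>e. \<Sum>i\<in>{i\<in>I. ex i = e}. c i"] conjI allI)
  show "finite (ex ` I)" using fin by simp
  show "\<forall>e\<in>ex ` I. (\<Sum>v\<in>V. e v) \<le> d" using deg by auto
  fix x
  have "f x = (\<Sum>e\<in>ex ` I. \<Sum>i\<in>{i\<in>I. ex i = e}. c i * (\<Prod>v\<in>V. x v ^ ex i v))"
    unfolding f by (rule sum.image_gen[OF fin])
  also have "\<dots> = (\<Sum>e\<in>ex ` I. (\<Sum>i\<in>{i\<in>I. ex i = e}. c i) * (\<Prod>v\<in>V. x v ^ e v))"
    by (simp add: sum_distrib_right)
  finally show "f x = (\<Sum>e\<in>ex ` I. (\<Sum>i\<in>{i\<in>I. ex i = e}. c i) * (\<Prod>v\<in>V. x v ^ e v))" .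
qed

lemma polynomial_const: "polynomial_of_degree_le V d (\<lambda>_. c)"
  by (rule polynomial_of_degree_leI[of "{()}" "\<lambda>_ _. 0" V d _ "\<lambda>_. c"]) auto

lemma polynomial_var:
  fixes v :: 'v
  assumes V: "finite V" "v \<in> V" "1 \<le> d"
  shows "polynomial_of_degree_le V d (\<lambda>x::'v \<Rightarrow> 'k::field. x v)"
proof (rule polynomial_of_degree_leI[of "{()}" "\<lambda>_ u. if u = v then 1 else 0" V d _ "\<lambda>_. 1"])
  fix x :: "'v \<Rightarrow> 'k"
  have "(\<Prod>u\<in>V. x u ^ (if u = v then 1 else 0)) = (\<Prod>u\<in>V. if u = v then x u else 1)"
    by (rule prod.cong) auto
  then show "x v = (\<Sum>i\<in>{()}. 1 * (\<Prod>u\<in>V. x u ^ (if u = v then 1 else 0)))"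
    using V by (simp add: prod.delta)
qed (use V in auto)

lemma polynomial_mono: "polynomial_of_degree_le V d f \<Longrightarrow> d \<le> d' \<Longrightarrow> polynomial_of_degree_le V d' f"
  unfolding polynomial_of_degree_le_def by (meson order_trans)

lemma polynomial_add:
  assumes "polynomial_of_degree_le V d f" "polynomial_of_degree_le V d g"
  shows "polynomial_of_degree_le V d (\<lambda>x. f x + g x)"
proof -
  obtain E c where E: "finite E" "\<forall>e\<in>E. (\<Sum>v\<in>V. e v) \<le> d" "\<forall>x. f x = (\<Sum>e\<in>E. c e * (\<Prod>v\<in>V. x v ^ e v))"
    using assms(1) unfolding polynomial_of_degree_le_def by blast
  obtain E' c' where E': "finite E'" "\<forall>e\<in>E'. (\<Sum>v\<in>V. e v) \<le> d"
    "\<forall>x. g x = (\<Sum>e\<in>E'. c' e * (\<Prod>v\<in>V. x v ^ e v))"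
    using assms(2) unfolding polynomial_of_degree_le_def by blast
  show ?thesis
    by (rule polynomial_of_degree_leI[of "E <+> E'" "case_sum id id" V d _ "case_sum c c'"])
      (use E E' in \<open>auto simp: sum.Plus\<close>)
qed

lemma polynomial_mult:
  assumes "polynomial_of_degree_le V d f" "polynomial_of_degree_le V d' g"
  shows "polynomial_of_degree_le V (d + d') (\<lambda>x. f x * g x)"
proof -
  obtain E c where E: "finite E" "\<forall>e\<in>E. (\<Sum>v\<in>V. e v) \<le> d" "\<forall>x. f x = (\<Sum>e\<in>E. c e * (\<Prod>v\<in>V. x v ^ e v))"
    using assms(1) unfolding polynomial_of_degree_le_def by blast
  obtain E' c' where E': "finite E'" "\<forall>e\<in>E'. (\<Sum>v\<in>V. e v) \<le> d'"
    "\<forall>x. g x = (\<Sum>e\<in>E'. c' e * (\<Prod>v\<in>V. x v ^ e v))"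
    using assms(2) unfolding polynomial_of_degree_le_def by blast
  show ?thesis
  proof (rule polynomial_of_degree_leI[of "E \<times> E'" "\<lambda>(e, e') v. e v + e' v" V _ _ "\<lambda>(e, e'). c e * c' e'"])
    fix x
    have "f x * g x = (\<Sum>e\<in>E. \<Sum>e'\<in>E'. (c e * (\<Prod>v\<in>V. x v ^ e v)) * (c' e' * (\<Prod>v\<in>V. x v ^ e' v)))"
      using E(3) E'(3) by (simp add: sum_product)
    also have "\<dots> = (\<Sum>(e, e')\<in>E \<times> E'. (c e * (\<Prod>v\<in>V. x v ^ e v)) * (c' e' * (\<Prod>v\<in>V. x v ^ e' v)))"
      by (rule sum.cartesian_product)
    also have "\<dots> = (\<Sum>i\<in>E \<times> E'. (case i of (e, e') \<Rightarrow> c e * c' e') *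
        (\<Prod>v\<in>V. x v ^ (case i of (e, e') \<Rightarrow> \<lambda>v. e v + e' v) v))"
      by (rule sum.cong) (auto simp: power_add prod.distrib)
    finally show "f x * g x = (\<Sum>i\<in>E \<times> E'. (case i of (e, e') \<Rightarrow> c e * c' e') *
        (\<Prod>v\<in>V. x v ^ (case i of (e, e') \<Rightarrow> \<lambda>v. e v + e' v) v))" .
  next
    fix i assume "i \<in> E \<times> E'"
    then show "(\<Sum>v\<in>V. (case i of (e, e') \<Rightarrow> \<lambda>v. e v + e' v) v) \<le> d + d'"
      using E(2) E'(2) by (auto simp: sum.distrib intro!: add_mono)
  qed (use E E' in auto)
qed

lemma polynomial_sum:
  "(\<And>i. i \<in> I \<Longrightarrow> polynomial_of_degree_le V d (f i)) \<Longrightarrow> polynomial_of_degree_le V d (\<lambda>x. \<Sum>i\<in>I. f i x)"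
  by (induction I rule: infinite_finite_induct) (auto simp: polynomial_const polynomial_add)

lemma polynomial_prod:
  "(\<And>j. j < (m::nat) \<Longrightarrow> polynomial_of_degree_le V (e j) (f j)) \<Longrightarrow>
    polynomial_of_degree_le V (\<Sum>j<m. e j) (\<lambda>x. \<Prod>j<m. f j x)"
proof (induction m)
  case (Suc m)
  then show ?case using polynomial_mult[OF Suc.IH Suc.prems[of m]] by simp
qed (simp add: polynomial_const)

text \<open>Expanding every argument of a multilinear mapping in the basis turns its coordinates into sums of
  products of coordinates of the arguments. A variable of weight \<open>i\<close> has degree one, which is at most
  its weight if \<open>i \<noteq> 0\<close>; so the weighted degree bounds the degree.\<close>

lemma (in normed_space_over) weighted_composition_coordinates:
  assumes E: "finite E" "independent E" "span E = UNIV"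
    and V: "finite V" "0 \<notin> V"
    and f: "weighted_composition scale V d f" and b: "b \<in> E"
  shows "\<exists>g. polynomial_of_degree_le (V \<times> E) d g \<and>
    (\<forall>p. representation E (f p) b = g (\<lambda>(m, e). representation E (p m) e))"
  using f b
proof (induction arbitrary: b rule: weighted_composition.induct)
  case (var i d)
  then have "1 \<le> d" using V by (cases i) auto
  then show ?case
    using var V E by (intro exI[of _ "\<lambda>x. x (i, b)"]) (auto intro!: polynomial_var)
next
  case (add d f g)
  then obtain F G where "polynomial_of_degree_le (V \<times> E) d F" "polynomial_of_degree_le (V \<times> E) d G"
    "\<And>p. representation E (f p) b = F (\<lambda>(m, e). representation E (p m) e)"
    "\<And>p. representation E (g p) b = G (\<lambda>(m, e). representation E (p m) e)"
    by metis
  then show ?case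
    using E by (intro exI[of _ "\<lambda>x. F x + G x"]) (auto intro: polynomial_add simp: representation_add)
next
  case (comp m M e f d)
  have M: "multilinear scale scale m M" using comp.hyps by (simp add: bounded_multilinear_def)
  obtain F where F: "\<And>j u. j < m \<Longrightarrow> u \<in> E \<Longrightarrow> polynomial_of_degree_le (V \<times> E) (e j) (F j u)"
    "\<And>j u p. j < m \<Longrightarrow> u \<in> E \<Longrightarrow> representation E (f j p) u = F j u (\<lambda>(m, e). representation E (p m) e)"
    using comp.IH by metis
  let ?\<Phi> = "PiE {..<m} (\<lambda>_. E)"
  define g where "g x = (\<Sum>\<phi>\<in>?\<Phi>. (\<Prod>j<m. F j (\<phi> j) x) * representation E (M \<phi>) b)" for x
  have "polynomial_of_degree_le (V \<times> E) (\<Sum>j<m. e j) g"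
    unfolding g_def
  proof (rule polynomial_sum)
    fix \<phi> assume "\<phi> \<in> ?\<Phi>"
    then have "polynomial_of_degree_le (V \<times> E) (\<Sum>j<m. e j) (\<lambda>x. \<Prod>j<m. F j (\<phi> j) x)"
      by (intro polynomial_prod F(1)) auto
    then show "polynomial_of_degree_le (V \<times> E) (\<Sum>j<m. e j) (\<lambda>x. (\<Prod>j<m. F j (\<phi> j) x) * representation E (M \<phi>) b)"
      using polynomial_mult[OF _ polynomial_const[of _ 0]] by fastforce
  qed
  then have "polynomial_of_degree_le (V \<times> E) d g" using polynomial_mono comp.hyps by blast
  moreover have "representation E (M (\<lambda>j. f j p)) b = g (\<lambda>(m, e). representation E (p m) e)" for p
  proof -
    have "(\<lambda>j. f j p) = (\<lambda>j. \<Sum>u\<in>E. scale (representation E (f j p) u) u)"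
      using E by (simp add: sum_representation_eq)
    then have "M (\<lambda>j. f j p) = M (\<lambda>j. \<Sum>u\<in>E. scale (representation E (f j p) u) u)" by simp
    also have "\<dots> = (\<Sum>\<phi>\<in>?\<Phi>. M (\<lambda>j. scale (representation E (f j p) (\<phi> j)) (\<phi> j)))"
      by (rule multilinear_sum[OF M])
    also have "\<dots> = (\<Sum>\<phi>\<in>?\<Phi>. scale (\<Prod>j<m. representation E (f j p) (\<phi> j)) (M \<phi>))"
      by (simp add: multilinear_scale[OF M vector_space_axioms])
    finally have "representation E (M (\<lambda>j. f j p)) b
        = (\<Sum>\<phi>\<in>?\<Phi>. (\<Prod>j<m. representation E (f j p) (\<phi> j)) * representation E (M \<phi>) b)"
      using E by (simp add: representation_sum representation_scale)
    also have "\<dots> = (\<Sum>\<phi>\<in>?\<Phi>. (\<Prod>j<m. F j (\<phi> j) (\<lambda>(m, e). representation E (p m) e)) * representation E (M \<phi>) b)"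
      using F(2) by (intro sum.cong refl arg_cong2[of _ _ _ _ "(*)"] prod.cong) auto
    finally show ?thesis by (simp add: g_def)
  qed
  ultimately show ?case by blast
qed

section \<open>Triangular systems with a regular linear part\<close>

text \<open>The equation with number \<open>m\<close> reads \<open>A 0 w\<^sub>m + A 1 w\<^sub>m\<^sub>-\<^sub>1 + \<dots> = b m w\<close>, where the right-hand side
  only involves the unknowns that lie more than \<open>k\<close> places before \<open>m\<close>.\<close>

locale regular_system = chain s s' A k S N Nc R Rc
  for s :: "'k::real_normed_field \<Rightarrow> 'a::banach \<Rightarrow> 'a"
    and s' :: "'k \<Rightarrow> 'b::banach \<Rightarrow> 'b" and A :: "nat \<Rightarrow> 'a \<Rightarrow> 'b" and k S N Nc R Rc +
  fixes b :: "nat \<Rightarrow> (nat \<Rightarrow> 'a) \<Rightarrow> 'b"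
  assumes regular: "sum_operator_surj (k + 1) S N"
    and b_cong: "\<And>m w w'. (\<And>j. 1 \<le> j \<Longrightarrow> j + k < m \<Longrightarrow> w j = w' j) \<Longrightarrow> b m w = b m w'"
    and b_weighted: "\<And>m K. bounded_operator s' s K \<Longrightarrow>
      weighted_composition s {1..<m - k} (m - k) (\<lambda>w. K (b m w))"
    and start: "\<exists>w. \<forall>m\<in>{1..k}. toeplitz A (\<lambda>j. w (Suc j)) (m - 1) = b m w"
begin

definition solves :: "(nat \<Rightarrow> 'a) \<Rightarrow> nat \<Rightarrow> bool" where
  "solves w m \<longleftrightarrow> Tp (\<lambda>j. w (Suc j)) (m - 1) = b m w"

lemma solves_cong:
  assumes m: "m \<ge> 1" and w: "\<And>j. 1 \<le> j \<Longrightarrow> j \<le> m \<Longrightarrow> w j = w' j"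
  shows "solves w m \<longleftrightarrow> solves w' m"
proof -
  have "Tp (\<lambda>j. w (Suc j)) (m - 1) = Tp (\<lambda>j. w' (Suc j)) (m - 1)"
    using m w by (intro toeplitz_cong) simp
  moreover have "b m w = b m w'" using w by (intro b_cong) simp
  ultimately show ?thesis by (simp add: solves_def)
qed

text \<open>The terms of equation \<open>m + t\<close> that contain unknowns before \<open>w m\<close>.\<close>

definition known_part :: "(nat \<Rightarrow> 'a) \<Rightarrow> nat \<Rightarrow> nat \<Rightarrow> 'b" where
  "known_part w m t = (\<Sum>j=Suc t..<m + t. A j (w (m + t - j)))"

lemma solves_iff:
  assumes "m \<ge> 1"
  shows "solves w (m + t) \<longleftrightarrow> Tp (\<lambda>j. w (m + j)) t = b (m + t) w - known_part w m t"
proof -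
  have "Tp (\<lambda>j. w (Suc j)) (m + t - 1) = (\<Sum>j\<in>{0..<Suc t} \<union> {Suc t..<m + t}. A j (w (m + t - j)))"
    unfolding toeplitz_def using assms by (intro sum.cong) (auto intro!: arg_cong[of _ _ w] arg_cong[of _ _ "A _"])
  also have "\<dots> = (\<Sum>j\<in>{0..<Suc t}. A j (w (m + t - j))) + known_part w m t"
    unfolding known_part_def by (rule sum.union_disjoint) auto
  also have "(\<Sum>j\<in>{0..<Suc t}. A j (w (m + t - j))) = Tp (\<lambda>j. w (m + j)) t"
    unfolding toeplitz_def by (intro sum.cong) auto
  finally show ?thesis by (auto simp: solves_def algebra_simps)
qed

lemma known_part_cong: "(\<And>j. 1 \<le> j \<Longrightarrow> j < m \<Longrightarrow> w j = w' j) \<Longrightarrow> known_part w m t = known_part w' m t"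
  unfolding known_part_def by (intro sum.cong refl arg_cong[of _ _ "A _"]) auto

definition \<Psi> :: "nat \<Rightarrow> nat \<Rightarrow> 'b \<Rightarrow> 'a" where
  "\<Psi> i = (SOME \<Psi>. (\<forall>t. bounded_operator s' s (\<Psi> t)) \<and> (\<forall>w. w 0 - (\<Sum>t<i. \<Psi> t (Tp w t)) \<in> N i))"

lemma \<Psi>:
  assumes "i \<le> Suc k"
  shows "bounded_operator s' s (\<Psi> i t)" and "w 0 - (\<Sum>t<i. \<Psi> i t (Tp w t)) \<in> N i"
  using someI_ex[OF head_of_solution[OF assms]] unfolding \<Psi>_def by blast+

text \<open>The value that equations \<open>m, \<dots>, m + i - 1\<close> prescribe for \<open>w m\<close> up to an element of \<open>N i\<close>,
  in terms of the earlier unknowns.\<close>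

definition prescribed :: "nat \<Rightarrow> nat \<Rightarrow> (nat \<Rightarrow> 'a) \<Rightarrow> 'a" where
  "prescribed i m w = (\<Sum>t<i. \<Psi> i t (b (m + t) w - known_part w m t))"

lemma prescribed_cong:
  assumes "i \<le> Suc k" "\<And>j. 1 \<le> j \<Longrightarrow> j < m \<Longrightarrow> w j = w' j"
  shows "prescribed i m w = prescribed i m w'"
  unfolding prescribed_def
proof (rule sum.cong[OF refl])
  fix t assume "t \<in> {..<i}"
  then have "b (m + t) w = b (m + t) w'" using assms by (intro b_cong) auto
  then show "\<Psi> i t (b (m + t) w - known_part w m t) = \<Psi> i t (b (m + t) w' - known_part w' m t)"
    using known_part_cong[OF assms(2)] by simp
qed

lemma prescribed_of_solution:
  assumes i: "i \<le> Suc k" and m: "m \<ge> 1" and w: "\<And>t. t < i \<Longrightarrow> solves w (m + t)"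
  shows "w m - prescribed i m w \<in> N i"
proof -
  have "(\<Sum>t<i. \<Psi> i t (Tp (\<lambda>j. w (m + j)) t)) = prescribed i m w"
    unfolding prescribed_def using w by (intro sum.cong refl) (simp add: solves_iff[OF m])
  then show ?thesis using \<Psi>(2)[OF i, of "\<lambda>j. w (m + j)"] by simp
qed

text \<open>The right-hand sides \<open>b (m + t)\<close> with \<open>t \<le> k\<close> have weight \<open>m + t - k \<le> m\<close>.\<close>

lemma prescribed_weighted:
  assumes i: "i \<le> Suc k" and m: "m \<ge> 1"
  shows "weighted_composition s {1..<m} m (prescribed i m)"
proof -
  have "weighted_composition s {1..<m} m (\<lambda>w. \<Psi> i t (b (m + t) w - known_part w m t))" if t: "t < i" for t
  proof -
    note hom = bounded_operator_hom[OF \<Psi>(1)[OF i, of t]]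
    have "weighted_composition s {1..<m} m (\<lambda>w. \<Psi> i t (b (m + t) w))"
      by (rule weighted_composition_mono[OF b_weighted[OF \<Psi>(1)[OF i]]]) (use t i in auto)
    moreover have "weighted_composition s {1..<m} m (\<lambda>w. - (\<Sum>j=Suc t..<m + t. \<Psi> i t (A j (w (m + t - j)))))"
    proof (intro s.weighted_composition_uminus s.weighted_composition_sum)
      fix j assume "j \<in> {Suc t..<m + t}"
      then have v: "weighted_composition s {1..<m} m (\<lambda>w. w (m + t - j))"
        by (intro weighted_composition.var) auto
      show "weighted_composition s {1..<m} m (\<lambda>w. \<Psi> i t (A j (w (m + t - j))))"
        by (rule s.weighted_composition_operator[OF bounded_operator_compose[OF A \<Psi>(1)[OF i]] v])
    qed
    ultimately have "weighted_composition s {1..<m} m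
        (\<lambda>w. \<Psi> i t (b (m + t) w) + - (\<Sum>j=Suc t..<m + t. \<Psi> i t (A j (w (m + t - j)))))"
      by (rule weighted_composition.add)
    then show ?thesis
      by (simp add: module_hom.diff[OF hom] module_hom.sum[OF hom] known_part_def)
  qed
  then have "weighted_composition s {1..<m} m (\<lambda>w. \<Sum>t<i. \<Psi> i t (b (m + t) w - known_part w m t))"
    by (intro s.weighted_composition_sum) auto
  then show ?thesis by (simp only: prescribed_def[abs_def])
qed

subsection \<open>Extending initial segments of solutions\<close>

definition modify :: "nat \<Rightarrow> (nat \<Rightarrow> 'a) \<Rightarrow> (nat \<Rightarrow> 'a) \<Rightarrow> nat \<Rightarrow> 'a" where
  "modify m u w j = (if j < m then w j else w j + u (j - m))"

lemma solves_modify_before: "1 \<le> e \<Longrightarrow> e < m \<Longrightarrow> solves (modify m u w) e \<longleftrightarrow> solves w e"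
  by (rule solves_cong) (auto simp: modify_def)

lemma solves_modify:
  assumes "m \<ge> 1" "t \<le> k"
  shows "solves (modify m u w) (m + t)
    \<longleftrightarrow> Tp (\<lambda>j. w (m + j)) t + Tp u t = b (m + t) w - known_part w m t"
proof -
  have "b (m + t) (modify m u w) = b (m + t) w"
    using assms by (intro b_cong) (auto simp: modify_def)
  moreover have "known_part (modify m u w) m t = known_part w m t"
    by (rule known_part_cong) (simp add: modify_def)
  moreover have "Tp (\<lambda>j. modify m u w (m + j)) t = Tp (\<lambda>j. w (m + j)) t + Tp u t"
    by (simp add: modify_def toeplitz_add)
  ultimately show ?thesis by (simp add: solves_iff[OF assms(1)])
qed

text \<open>Adding the homogeneous solution that starts with \<open>v\<close> changes none of these equations, because their
  right-hand sides only see unknowns before \<open>w m\<close>.\<close>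

lemma change_unknown:
  assumes i: "i \<le> Suc k" and m: "m \<ge> 1" and v: "v \<in> N i"
  obtains w' where "\<And>j. j < m \<Longrightarrow> w' j = w j" "w' m = w m + v"
    "\<And>e. 1 \<le> e \<Longrightarrow> e < m + i \<Longrightarrow> solves w e \<Longrightarrow> solves w' e"
proof -
  obtain u where u: "u 0 = v" "\<And>t. t < i \<Longrightarrow> Tp u t = 0" using N_head[OF i v] by metis
  show thesis
  proof (rule that[of "modify m u w"])
    fix e assume e: "1 \<le> e" "e < m + i" "solves w e"
    show "solves (modify m u w) e"
    proof (cases "e < m")
      case False
      then obtain t where t: "e = m + t" using le_Suc_ex not_less by blast
      then have "t < i" "t \<le> k" using e i by auto
      then show ?thesis
        using e(3) u(2)[OF \<open>t < i\<close>] solves_modify[OF m \<open>t \<le> k\<close>, of u w] solves_iff[OF m, of w t]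
        unfolding t by simp
    qed (use e in \<open>simp add: solves_modify_before\<close>)
  qed (simp_all add: modify_def u)
qed

text \<open>By regularity, the last \<open>k + 1\<close> unknowns can be changed so as to satisfy one equation more.\<close>

lemma solve_next:
  assumes m: "m \<ge> 1"
  obtains w' where "\<And>j. j < m \<Longrightarrow> w' j = w j" "solves w' (m + k)"
    "\<And>e. 1 \<le> e \<Longrightarrow> e < m + k \<Longrightarrow> solves w e \<Longrightarrow> solves w' e"
proof -
  define r where "r = b (m + k) w - known_part w m k - Tp (\<lambda>j. w (m + j)) k"
  obtain u where u: "\<And>t. t < k \<Longrightarrow> Tp u t = 0" "Tp u k = r"
    using regular_solvable[OF regular] by metis
  show thesis
  proof (rule that[of "modify m u w"])
    show "solves (modify m u w) (m + k)" by (simp add: solves_modify[OF m] u r_def)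
    fix e assume e: "1 \<le> e" "e < m + k" "solves w e"
    show "solves (modify m u w) e"
    proof (cases "e < m")
      case False
      then obtain t where t: "e = m + t" using le_Suc_ex not_less by blast
      then have "t < k" using e by simp
      then show ?thesis
        using e(3) u(1)[OF \<open>t < k\<close>] solves_modify[OF m less_imp_le[OF \<open>t < k\<close>], of u w] solves_iff[OF m, of w t]
        unfolding t by simp
    qed (use e in \<open>simp add: solves_modify_before\<close>)
  qed (simp add: modify_def)
qed

text \<open>Among \<open>M\<close> equations, the number of those from \<open>m\<close> on that restrict \<open>w m\<close>: by regularity, equations
  more than \<open>k\<close> places after \<open>m\<close> can be solved with later unknowns.\<close>

definition order_at :: "nat \<Rightarrow> nat \<Rightarrow> nat" where
  "order_at M m = min (Suc k) (Suc M - m)"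

lemma order_at_le: "order_at M m \<le> Suc k"
  by (simp add: order_at_def)

text \<open>An initial segment of length \<open>m\<close> whose entries have the prescribed values modulo \<open>N\<close> can be continued
  to satisfy \<open>k\<close> equations beyond its length, as far as these are among the first \<open>M\<close>. In the induction step, take a continuation of the shorter
  segment, make it satisfy the next equation, and observe that its entry \<open>m\<close> has the same prescribed
  value as the given one; the difference lies in \<open>N\<close> and can be added.\<close>

lemma extend_solution:
  assumes M: "k \<le> M"
  shows "m \<le> M \<Longrightarrow> (\<And>j. 1 \<le> j \<Longrightarrow> j \<le> m \<Longrightarrow> w j - prescribed (order_at M j) j w \<in> N (order_at M j)) \<Longrightarrow>
    \<exists>w'. (\<forall>j. 1 \<le> j \<and> j \<le> m \<longrightarrow> w' j = w j) \<and> (\<forall>e. 1 \<le> e \<and> e \<le> min M (m + k) \<longrightarrow> solves w' e)"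
proof (induction m)
  case 0
  obtain w0 where "\<forall>m\<in>{1..k}. solves w0 m" using start by (auto simp: solves_def)
  then show ?case using M by (intro exI[of _ w0]) auto
next
  case (Suc m)
  let ?m = "Suc m" and ?i = "order_at M (Suc m)"
  obtain w0 where w0: "\<And>j. 1 \<le> j \<Longrightarrow> j \<le> m \<Longrightarrow> w0 j = w j"
    "\<And>e. 1 \<le> e \<Longrightarrow> e \<le> min M (m + k) \<Longrightarrow> solves w0 e"
    using Suc by auto
  obtain w1 where w1: "\<And>j. 1 \<le> j \<Longrightarrow> j < ?m \<Longrightarrow> w1 j = w0 j"
    "\<And>e. 1 \<le> e \<Longrightarrow> e \<le> min M (?m + k) \<Longrightarrow> solves w1 e"
  proof (cases "?m + k \<le> M")
    case True
    obtain w1 where h: "\<And>j. j < ?m \<Longrightarrow> w1 j = w0 j" "solves w1 (?m + k)"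
      "\<And>e. 1 \<le> e \<Longrightarrow> e < ?m + k \<Longrightarrow> solves w0 e \<Longrightarrow> solves w1 e"
      using solve_next[of ?m w0] by auto
    have "solves w1 e" if "1 \<le> e" "e \<le> min M (?m + k)" for e
      using h(2,3) w0(2)[of e] that True by (cases "e = ?m + k") auto
    then show thesis using that h(1) by blast
  next
    case False
    then have "min M (?m + k) = min M (m + k)" by simp
    then show thesis using that[of w0] w0(2) by simp
  qed
  have i: "?m + ?i = Suc (min M (?m + k))" using Suc.prems(1) by (auto simp: order_at_def)
  have w1w: "w1 j = w j" if "1 \<le> j" "j < ?m" for j using w1(1) w0(1) that by simp
  have old: "w1 ?m - prescribed ?i ?m w1 \<in> N ?i"
  proof (rule prescribed_of_solution[OF order_at_le])
    fix t assume "t < ?i"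
    then have "?m + t \<le> min M (?m + k)" using i by linarith
    then show "solves w1 (?m + t)" using w1(2) by simp
  qed simp
  have new: "w ?m - prescribed ?i ?m w \<in> N ?i" by (rule Suc.prems(2)) auto
  have eq: "prescribed ?i ?m w1 = prescribed ?i ?m w"
    by (rule prescribed_cong[OF order_at_le w1w])
  have "(w ?m - prescribed ?i ?m w) - (w1 ?m - prescribed ?i ?m w) \<in> N ?i"
    using s.subspace_diff[OF N_subspace[OF order_at_le] new old] by (simp only: eq)
  then have "w ?m - w1 ?m \<in> N ?i" by simp
  then obtain w2 where w2: "\<And>j. j < ?m \<Longrightarrow> w2 j = w1 j" "w2 ?m = w1 ?m + (w ?m - w1 ?m)"
    "\<And>e. 1 \<le> e \<Longrightarrow> e < ?m + ?i \<Longrightarrow> solves w1 e \<Longrightarrow> solves w2 e"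
    using change_unknown[OF order_at_le[of M ?m], of ?m "w ?m - w1 ?m" w1] by auto
  have "w2 j = w j" if "1 \<le> j" "j \<le> ?m" for j
    using w2(1,2) w1w that by (cases "j = ?m") auto
  moreover have "solves w2 e" if "1 \<le> e" "e \<le> min M (?m + k)" for e
    using w2(3)[of e] w1(2)[of e] that i by simp
  ultimately show ?case by blast
qed

text \<open>The system is thus equivalent to conditions that are triangular in the strict sense: each restricts
  one unknown to a coset determined by the earlier ones.\<close>

theorem solves_all_iff:
  assumes M: "k \<le> M"
  shows "(\<forall>e. 1 \<le> e \<and> e \<le> M \<longrightarrow> solves w e) \<longleftrightarrow>
    (\<forall>m. 1 \<le> m \<and> m \<le> M \<longrightarrow> w m - prescribed (order_at M m) m w \<in> N (order_at M m))"
proof (intro iffI allI impI)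
  fix m assume w: "\<forall>e. 1 \<le> e \<and> e \<le> M \<longrightarrow> solves w e" and m: "1 \<le> m \<and> m \<le> M"
  show "w m - prescribed (order_at M m) m w \<in> N (order_at M m)"
    by (rule prescribed_of_solution[OF order_at_le]) (use w m in \<open>auto simp: order_at_def\<close>)
next
  fix e assume "\<forall>m. 1 \<le> m \<and> m \<le> M \<longrightarrow> w m - prescribed (order_at M m) m w \<in> N (order_at M m)"
    and e: "1 \<le> e \<and> e \<le> M"
  then obtain w' where w': "\<forall>j. 1 \<le> j \<and> j \<le> M \<longrightarrow> w' j = w j" "\<forall>e. 1 \<le> e \<and> e \<le> min M (M + k) \<longrightarrow> solves w' e"
    using extend_solution[OF M, of M w] by blast
  have "solves w' e" using w'(2) e by simp
  moreover have "solves w' e \<longleftrightarrow> solves w e" by (rule solves_cong) (use w'(1) e in auto)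
  ultimately show "solves w e" by simp
qed

subsection \<open>Solutions from parameters\<close>

text \<open>The orders \<open>i m\<close> are a parameter, since both finite systems, with \<open>order_at M\<close>, and the infinite one,
  with the constant \<open>Suc k\<close>, are solved in this way.\<close>

function solution :: "(nat \<Rightarrow> nat) \<Rightarrow> (nat \<Rightarrow> 'a) \<Rightarrow> nat \<Rightarrow> 'a" where
  "solution i p m = prescribed (i m) m (\<lambda>j. if j < m then solution i p j else 0) + p m"
  by auto
termination by (relation "Wellfounded.measure (\<lambda>(i, p, m). m)") auto

declare solution.simps [simp del]

lemma solution_eq:
  assumes i: "\<And>j. i j \<le> Suc k"
  shows "solution i p m = prescribed (i m) m (solution i p) + p m"
proof -
  have "prescribed (i m) m (\<lambda>j. if j < m then solution i p j else 0) = prescribed (i m) m (solution i p)"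
    by (rule prescribed_cong[OF i]) simp
  then show ?thesis by (subst solution.simps) simp
qed

lemma solution_unique:
  assumes i: "\<And>j. i j \<le> Suc k" and w: "\<And>j. 1 \<le> j \<Longrightarrow> j \<le> M \<Longrightarrow> w j = prescribed (i j) j w + p j"
  shows "1 \<le> m \<Longrightarrow> m \<le> M \<Longrightarrow> w m = solution i p m"
proof (induction m rule: less_induct)
  case (less m)
  have "prescribed (i m) m w = prescribed (i m) m (solution i p)"
    by (rule prescribed_cong[OF i]) (use less in auto)
  then show ?case using w less.prems solution_eq[OF i] by simp
qed

lemma solution_weighted:
  assumes i: "\<And>j. i j \<le> Suc k"
  shows "m \<ge> 1 \<Longrightarrow> weighted_composition s {1..<m} m (\<lambda>p. prescribed (i m) m (solution i p))"
proof (induction m rule: less_induct)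
  case (less m)
  have "weighted_composition s {1..<m} d (\<lambda>p. solution i p j)" if j: "j \<in> {1..<m}" "j \<le> d" for j d
  proof -
    have "weighted_composition s {1..<m} d (\<lambda>p. prescribed (i j) j (solution i p))"
      by (rule weighted_composition_mono[OF less.IH[of j]]) (use j in auto)
    moreover have "weighted_composition s {1..<m} d (\<lambda>p. p j)"
      using j by (intro weighted_composition.var)
    ultimately have "weighted_composition s {1..<m} d (\<lambda>p. prescribed (i j) j (solution i p) + p j)"
      by (rule weighted_composition.add)
    moreover have "solution i p j = prescribed (i j) j (solution i p) + p j" for p
      by (rule solution_eq[OF i])
    ultimately show ?thesis by presburger
  qed
  then show ?case
    by (rule weighted_composition_subst[OF prescribed_weighted[OF i less.prems], where g = "\<lambda>j p. solution i p j"])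
qed

text \<open>Keep the first \<open>l\<close> unknowns and give all later ones exactly their prescribed values.\<close>

lemma extend_to_full_solution:
  assumes w: "\<And>e. 1 \<le> e \<Longrightarrow> e \<le> k + l \<Longrightarrow> solves w e"
  obtains w' where "\<And>j. 1 \<le> j \<Longrightarrow> j \<le> l \<Longrightarrow> w' j = w j" "\<And>e. 1 \<le> e \<Longrightarrow> solves w' e"
proof -
  define i where "i = (\<lambda>_::nat. Suc k)"
  define p where "p m = (if m \<le> l then w m - prescribed (Suc k) m w else 0)" for m
  have i: "i j \<le> Suc k" for j by (simp add: i_def)
  let ?w = "solution i p"
  have agree: "w j = ?w j" if "1 \<le> j" "j \<le> l" for j
    by (rule solution_unique[OF i _ that, of w]) (simp add: p_def i_def)
  have full: "?w m - prescribed (Suc k) m ?w \<in> N (Suc k)" if "1 \<le> m" for m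
  proof -
    have "w m - prescribed (Suc k) m w \<in> N (Suc k)" if "m \<le> l"
      by (rule prescribed_of_solution) (use w \<open>1 \<le> m\<close> that in auto)
    then show ?thesis
      using solution_eq[of i p m, OF i] s.subspace_0[OF N_subspace[of "Suc k"]] by (simp add: p_def i_def)
  qed
  have "solves ?w e" if e: "1 \<le> e" for e
  proof -
    have ord: "order_at (e + k) j = Suc k" if "j \<le> e" for j using that by (simp add: order_at_def)
    obtain w' where w': "\<forall>j. 1 \<le> j \<and> j \<le> e \<longrightarrow> w' j = ?w j"
      "\<forall>e'. 1 \<le> e' \<and> e' \<le> min (e + k) (e + k) \<longrightarrow> solves w' e'"
      using extend_solution[of "e + k" e ?w] full ord by auto
    have "solves w' e" using w'(2) e by simp
    moreover have "solves w' e \<longleftrightarrow> solves ?w e" by (rule solves_cong) (use w'(1) e in auto)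
    ultimately show ?thesis by simp
  qed
  then show thesis using that[of ?w] agree by simp
qed

text \<open>If the chain is minimal, dropping the last equation lets \<open>w l\<close> move in directions of \<open>N k\<close> that
  are not in \<open>N (Suc k)\<close>.\<close>

lemma last_equation_restricts:
  assumes l: "l \<ge> 1" and not: "\<not> sum_operator_surj k S N"
  obtains w where "\<And>e. 1 \<le> e \<Longrightarrow> e < k + l \<Longrightarrow> solves w e"
    "\<And>w'. (\<And>j. 1 \<le> j \<Longrightarrow> j \<le> l \<Longrightarrow> w' j = w j) \<Longrightarrow> \<not> (\<forall>e. 1 \<le> e \<and> e \<le> k + l \<longrightarrow> solves w' e)"
proof -
  have "\<exists>w. \<forall>m\<in>{1..k}. solves w m" using start by (simp add: solves_def)
  then obtain w0 where w0: "\<And>e. 1 \<le> e \<Longrightarrow> solves w0 e"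
    using extend_to_full_solution[of 0] by (metis add_0_right atLeastAtMost_iff)
  obtain v where v: "v \<in> N k" "v \<notin> N (Suc k)" using N_strict[OF regular not] by metis
  obtain w where w: "\<And>j. j < l \<Longrightarrow> w j = w0 j" "w l = w0 l + v"
    "\<And>e. 1 \<le> e \<Longrightarrow> e < l + k \<Longrightarrow> solves w0 e \<Longrightarrow> solves w e"
    using change_unknown[of k l v w0] l v(1) by auto
  show thesis
  proof (rule that[of w])
    show "solves w e" if "1 \<le> e" "e < k + l" for e using w(3)[of e] w0 that by simp
    fix w' assume agree: "\<And>j. 1 \<le> j \<Longrightarrow> j \<le> l \<Longrightarrow> w' j = w j"
    show "\<not> (\<forall>e. 1 \<le> e \<and> e \<le> k + l \<longrightarrow> solves w' e)"
    proof
      assume all: "\<forall>e. 1 \<le> e \<and> e \<le> k + l \<longrightarrow> solves w' e"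
      have "prescribed (Suc k) l w' = prescribed (Suc k) l w0"
        by (rule prescribed_cong) (use agree w(1) in auto)
      moreover have new: "w' l - prescribed (Suc k) l w' \<in> N (Suc k)"
        by (rule prescribed_of_solution) (use all l in auto)
      moreover have old: "w0 l - prescribed (Suc k) l w0 \<in> N (Suc k)"
        by (rule prescribed_of_solution) (use w0 l in auto)
      ultimately have "(w' l - prescribed (Suc k) l w0) - (w0 l - prescribed (Suc k) l w0) \<in> N (Suc k)"
        using s.subspace_diff[OF N_subspace[of "Suc k"] new old] by simp
      then have "v \<in> N (Suc k)" using agree[of l] l w(2) by simp
      then show False using v by simp
    qed
  qed
qed

end

section \<open>The system of undetermined coefficients\<close>

text \<open>Next to any entry there is another one beyond \<open>k\<close>, which takes up at least \<open>k + 1\<close> of the total \<open>m\<close>;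
  and two entries beyond \<open>k\<close> use up \<open>2 * k\<close> before they contribute to the sum of excesses over \<open>k\<close>.\<close>

lemma nonlinear_composition_bounds:
  assumes c: "(n, \<phi>) \<in> compositions m" and large: "2 \<le> card {i. i < n \<and> k < \<phi> i}"
  shows "i < n \<Longrightarrow> \<phi> i + k < m" and "(\<Sum>i<n. \<phi> i - k) + 2 * k \<le> m"
proof -
  let ?L = "{i. i < n \<and> k < \<phi> i}"
  show "\<phi> i + k < m" if i: "i < n"
  proof -
    have "\<not> ?L \<subseteq> {i}"
      using large card_mono[of "{i}" ?L] by fastforce
    then obtain j where j: "j < n" "k < \<phi> j" "j \<noteq> i" by blast
    have "\<phi> i + \<phi> j = sum \<phi> {i, j}" using j by simp
    also have "\<dots> \<le> sum \<phi> {..<n}" using i j by (intro sum_mono2) auto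
    finally show ?thesis using compositionsD(5)[OF c] j by simp
  qed
  have "2 * k \<le> card ?L * k" using large by (intro mult_right_mono) auto
  then have "(\<Sum>i<n. \<phi> i - k) + 2 * k \<le> (\<Sum>i<n. \<phi> i - k) + (\<Sum>i\<in>?L. k)" by simp
  also have "(\<Sum>i\<in>?L. k) = (\<Sum>i<n. if k < \<phi> i then k else 0)"
    by (rule sum.mono_neutral_cong_left) auto
  also have "(\<Sum>i<n. \<phi> i - k) + \<dots> = (\<Sum>i<n. (\<phi> i - k) + (if k < \<phi> i then k else 0))"
    by (rule sum.distrib[symmetric])
  also have "\<dots> \<le> (\<Sum>i<n. \<phi> i)" by (intro sum_mono) auto
  finally show "(\<Sum>i<n. \<phi> i - k) + 2 * k \<le> m" using compositionsD(5)[OF c] by simp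
qed

lemma nonlinear_part_cong:
  assumes ml: "\<And>n. multilinear s s' n (a n)" and y: "\<And>j. 1 \<le> j \<Longrightarrow> j + k < m \<Longrightarrow> y j = y' j"
  shows "nonlinear_part a k y m = nonlinear_part a k y' m"
  unfolding nonlinear_part_def
proof (intro sum.cong refl, clarify)
  fix n \<phi> assume "(n, \<phi>) \<in> compositions m" "2 \<le> card {i. i < n \<and> k < \<phi> i}"
  then show "a n (\<lambda>i. y (\<phi> i)) = a n (\<lambda>i. y' (\<phi> i))"
    using compositionsD(1) nonlinear_composition_bounds(1) by (intro multilinear_cong[OF ml] y) blast+
qed

text \<open>The Taylor coefficients of a curve: given ones up to \<open>k\<close>, unknown ones \<open>w 1, w 2, \<dots>\<close> from there.\<close>

definition continue :: "nat \<Rightarrow> (nat \<Rightarrow> 'a) \<Rightarrow> (nat \<Rightarrow> 'a) \<Rightarrow> nat \<Rightarrow> 'a" where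
  "continue k y w j = (if j \<le> k then y j else w (j - k))"

context multilinear_power_series
begin

definition taylor_start :: "nat \<Rightarrow> (nat \<Rightarrow> 'a) \<Rightarrow> nat \<Rightarrow> 'a" where
  "taylor_start k zb j = (if j \<le> k then s (1 / fact j) (zb j) else 0)"

text \<open>With this right-hand side the coefficient of \<open>\<epsilon> ^ (k + m)\<close> vanishes if and only if equation \<open>m\<close> of the
  triangular system holds. The right-hand side is constant for \<open>m \<le> k\<close>.\<close>

definition rhs :: "nat \<Rightarrow> (nat \<Rightarrow> 'a) \<Rightarrow> nat \<Rightarrow> (nat \<Rightarrow> 'a) \<Rightarrow> 'b" where
  "rhs k zb m w = - series_coeff a (taylor_start k zb) (k + m)
     - nonlinear_part a k (continue k (taylor_start k zb) w) (k + m)"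

lemma series_coeff_continue:
  assumes A: "expansion_coeffs s s' F k zb A" and m: "m \<ge> 1"
  shows "series_coeff a (continue k (taylor_start k zb) w) (k + m)
    = toeplitz A (\<lambda>j. w (Suc j)) (m - 1) - rhs k zb m w"
proof -
  let ?y = "continue k (taylor_start k zb) w"
  have start: "(\<lambda>j. if j \<le> k then ?y j else 0) = taylor_start k zb"
    by (auto simp: continue_def taylor_start_def)
  have "(\<Sum>b=Suc k..k+m. series_coeff (derived a (?y b)) (taylor_start k zb) (k + m - b))
      = (\<Sum>b=Suc k..k+m. A (k + m - b) (?y b))"
    using expansion_coeffs_eq[OF A] by (simp add: taylor_start_def[abs_def])
  also have "\<dots> = (\<Sum>j=0..m-1. A j (w (Suc (m - 1 - j))))"
    by (rule sum.reindex_bij_witness[of _ "\<lambda>j. k + m - j" "\<lambda>b. k + m - b"])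
      (use m in \<open>auto simp: continue_def intro!: arg_cong[of _ _ w] arg_cong[of _ _ "A _"]\<close>)
  finally have "(\<Sum>b=Suc k..k+m. series_coeff (derived a (?y b)) (taylor_start k zb) (k + m - b))
      = toeplitz A (\<lambda>j. w (Suc j)) (m - 1)"
    by (simp add: toeplitz_def)
  then show ?thesis
    using series_coeff_split[OF ml, of ?y "k + m" k] unfolding start rhs_def by simp
qed

lemma rhs_cong:
  assumes "\<And>j. 1 \<le> j \<Longrightarrow> j + k < m \<Longrightarrow> w j = w' j"
  shows "rhs k zb m w = rhs k zb m w'"
proof -
  have "nonlinear_part a k (continue k (taylor_start k zb) w) (k + m)
      = nonlinear_part a k (continue k (taylor_start k zb) w') (k + m)"
    by (rule nonlinear_part_cong[OF ml]) (auto simp: continue_def intro!: assms)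
  then show ?thesis by (simp add: rhs_def)
qed

text \<open>In a nonlinear term of degree \<open>k + m\<close> at least two arguments are unknowns \<open>w\<^sub>i\<close>, of degree
  \<open>k + i\<close>, so their weights \<open>i\<close> sum to at most \<open>m - k\<close>.\<close>

lemma rhs_weighted:
  assumes K: "bounded_operator s' s K"
  shows "weighted_composition s {1..<m - k} (m - k) (\<lambda>w. K (rhs k zb m w))"
proof -
  let ?W = "weighted_composition s {1..<m - k}" and ?y = "continue k (taylor_start k zb)"
  let ?C = "{(n, \<phi>) \<in> compositions (k + m). 2 \<le> card {i. i < n \<and> k < \<phi> i}}"
  have summand: "?W (m - k) (\<lambda>w. K (a (fst p) (\<lambda>i. ?y w (snd p i))))" if p: "p \<in> ?C" for p
  proof -
    obtain n \<phi> where pe: "p = (n, \<phi>)" by (cases p)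
    have c: "(n, \<phi>) \<in> compositions (k + m)" "2 \<le> card {i. i < n \<and> k < \<phi> i}" using p pe by auto
    note bounds = nonlinear_composition_bounds[OF c]
    have M: "bounded_multilinear s s n (\<lambda>x. K (a n x))"
      by (rule bounded_multilinear_operator_comp[OF ml bd K])
    have "?W (m - k) (\<lambda>w. K (a n (\<lambda>i. ?y w (\<phi> i))))"
    proof (rule weighted_composition.comp[OF M, of "{1..<m - k}" "\<lambda>i. \<phi> i - k" "\<lambda>i w. ?y w (\<phi> i)"])
      show "(\<Sum>i<n. \<phi> i - k) \<le> m - k" using bounds(2) by simp
      fix i assume i: "i < n"
      show "?W (\<phi> i - k) (\<lambda>w. ?y w (\<phi> i))"
      proof (cases "\<phi> i \<le> k")
        case True
        then show ?thesis by (simp add: continue_def s.weighted_composition_const)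
      next
        case False
        then have "\<phi> i - k \<in> {1..<m - k}" using bounds(1)[OF i] by auto
        then have "?W (\<phi> i - k) (\<lambda>w. w (\<phi> i - k))" by (rule weighted_composition.var) simp
        then show ?thesis using False by (simp add: continue_def)
      qed
    qed
    then show ?thesis by (simp add: pe)
  qed
  have "?W (m - k) (\<lambda>w. - K (series_coeff a (taylor_start k zb) (k + m))
      + - (\<Sum>p\<in>?C. K (a (fst p) (\<lambda>i. ?y w (snd p i)))))"
    by (intro weighted_composition.add s.weighted_composition_const s.weighted_composition_uminus
        s.weighted_composition_sum summand)
  moreover have "K (rhs k zb m w) = - K (series_coeff a (taylor_start k zb) (k + m))
      + - (\<Sum>p\<in>?C. K (a (fst p) (\<lambda>i. ?y w (snd p i))))" for w
    using bounded_operator_hom[OF K]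
    by (simp add: rhs_def nonlinear_part_def case_prod_unfold module_hom.diff module_hom.neg module_hom.sum)
  ultimately show ?thesis by presburger
qed

end

text \<open>Passage between tuples \<open>z\<close> and the rescaled unknowns \<open>w m = z (k + m) / (k + m)!\<close>.\<close>

definition tail :: "('k::field_char_0 \<Rightarrow> 'a \<Rightarrow> 'a) \<Rightarrow> nat \<Rightarrow> (nat \<Rightarrow> 'a) \<Rightarrow> nat \<Rightarrow> 'a" where
  "tail s k z m = s (1 / fact (k + m)) (z (k + m))"

definition assemble ::
  "('k::field_char_0 \<Rightarrow> 'a \<Rightarrow> 'a) \<Rightarrow> nat \<Rightarrow> (nat \<Rightarrow> 'a) \<Rightarrow> nat set \<Rightarrow> (nat \<Rightarrow> 'a) \<Rightarrow> nat \<Rightarrow> 'a" where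
  "assemble s k zb I w = restrict (\<lambda>j. if j \<le> k then zb j else s (fact j) (w (j - k))) I"

locale undetermined_coefficients =
  regular_system s s' A k S N Nc R Rc "multilinear_power_series.rhs s a k zb" +
  multilinear_power_series s s' a c r G
  for s :: "'k::real_normed_field \<Rightarrow> 'a::banach \<Rightarrow> 'a" and s' :: "'k \<Rightarrow> 'b::banach \<Rightarrow> 'b"
    and A k S N Nc R Rc a c r G and zb :: "nat \<Rightarrow> 'a" +
  assumes expansion: "expansion_coeffs s s' G k zb A"
    and start_solves: "\<And>i. 1 \<le> i \<Longrightarrow> i \<le> k \<Longrightarrow> series_coeff a (taylor_start k zb) i = 0"
begin

lemma T_eq_0_iff:
  "T s s' G i z = 0 \<longleftrightarrow> series_coeff a (\<lambda>j. s (1 / fact j) (z j)) i = 0"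
  by (simp add: T_eq_series_coeff)

lemma T_start:
  assumes z: "\<And>j. 1 \<le> j \<Longrightarrow> j \<le> k \<Longrightarrow> z j = zb j" and i: "1 \<le> i" "i \<le> k"
  shows "T s s' G i z = 0"
proof -
  have "series_coeff a (\<lambda>j. s (1 / fact j) (z j)) i = series_coeff a (taylor_start k zb) i"
    by (rule series_coeff_cong[OF ml]) (use z i in \<open>auto simp: taylor_start_def\<close>)
  then show ?thesis using start_solves[OF i] by (simp add: T_eq_0_iff)
qed

lemma T_beyond:
  assumes z: "\<And>j. 1 \<le> j \<Longrightarrow> j \<le> k \<Longrightarrow> z j = zb j" and m: "1 \<le> m"
  shows "T s s' G (k + m) z = 0 \<longleftrightarrow> solves (tail s k z) m"
proof -
  have "series_coeff a (\<lambda>j. s (1 / fact j) (z j)) (k + m)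
      = series_coeff a (continue k (taylor_start k zb) (tail s k z)) (k + m)"
    by (rule series_coeff_cong[OF ml]) (use z in \<open>auto simp: taylor_start_def continue_def tail_def\<close>)
  then show ?thesis
    by (simp add: T_eq_0_iff series_coeff_continue[OF expansion m] solves_def)
qed

lemma T_all_iff:
  assumes z: "\<And>j. 1 \<le> j \<Longrightarrow> j \<le> k \<Longrightarrow> z j = zb j"
  shows "(\<forall>i. 1 \<le> i \<and> i \<le> k + M \<longrightarrow> T s s' G i z = 0) \<longleftrightarrow> (\<forall>m. 1 \<le> m \<and> m \<le> M \<longrightarrow> solves (tail s k z) m)"
proof (intro iffI allI impI)
  fix m assume h: "\<forall>i. 1 \<le> i \<and> i \<le> k + M \<longrightarrow> T s s' G i z = 0" and m: "1 \<le> m \<and> m \<le> M"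
  then have "T s s' G (k + m) z = 0" by simp
  then show "solves (tail s k z) m" using T_beyond[OF z] m by blast
next
  fix i assume h: "\<forall>m. 1 \<le> m \<and> m \<le> M \<longrightarrow> solves (tail s k z) m" and i: "1 \<le> i \<and> i \<le> k + M"
  show "T s s' G i z = 0"
  proof (cases "i \<le> k")
    case True
    then show ?thesis using T_start[OF z] i by blast
  next
    case False
    then have eq: "i = k + (i - k)" and "1 \<le> i - k" "i - k \<le> M" using i by auto
    then have "T s s' G (k + (i - k)) z = 0" using T_beyond[OF z] h by blast
    then show ?thesis using eq by simp
  qed
qed

lemma Xbar_iff:
  "z \<in> Xbar s s' G k zb (k + M) \<longleftrightarrow> z \<in> {1..k + M} \<rightarrow>\<^sub>E UNIV \<and> (\<forall>i\<in>{1..k}. z i = zb i) \<and>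
     (\<forall>m. 1 \<le> m \<and> m \<le> M \<longrightarrow> solves (tail s k z) m)"
proof -
  have "(\<forall>i\<in>{1..k + M}. T s s' G i z = 0) \<longleftrightarrow> (\<forall>m. 1 \<le> m \<and> m \<le> M \<longrightarrow> solves (tail s k z) m)"
    if "\<forall>i\<in>{1..k}. z i = zb i"
    using T_all_iff[of z M] that by (simp add: Ball_def)
  then show ?thesis unfolding Xbar_def X_def by blast
qed

lemma Xbar_inf_iff:
  "z \<in> Xbar_inf s s' G k zb \<longleftrightarrow> z \<in> {1..} \<rightarrow>\<^sub>E UNIV \<and> (\<forall>i\<in>{1..k}. z i = zb i) \<and>
     (\<forall>m\<ge>1. solves (tail s k z) m)"
proof -
  have "(\<forall>i\<ge>1. T s s' G i z = 0) \<longleftrightarrow> (\<forall>m\<ge>1. solves (tail s k z) m)" if z: "\<forall>i\<in>{1..k}. z i = zb i"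
  proof -
    have "(\<forall>i\<ge>1. T s s' G i z = 0) \<longleftrightarrow> (\<forall>M i. 1 \<le> i \<and> i \<le> k + M \<longrightarrow> T s s' G i z = 0)"
      by (meson le_add2)
    also have "\<dots> \<longleftrightarrow> (\<forall>M m. 1 \<le> m \<and> m \<le> M \<longrightarrow> solves (tail s k z) m)"
      using T_all_iff[of z] z by simp
    also have "\<dots> \<longleftrightarrow> (\<forall>m\<ge>1. solves (tail s k z) m)" by blast
    finally show ?thesis .
  qed
  then show ?thesis unfolding Xbar_inf_def X_inf_def by blast
qed

lemma tail_assemble: "k + m \<in> I \<Longrightarrow> 1 \<le> m \<Longrightarrow> tail s k (assemble s k zb I w) m = w m"
  by (simp add: tail_def assemble_def)

lemma assemble_in:
  "assemble s k zb I w \<in> I \<rightarrow>\<^sub>E UNIV" "{1..k} \<subseteq> I \<Longrightarrow> \<forall>i\<in>{1..k}. assemble s k zb I w i = zb i"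
  by (auto simp: assemble_def)

lemma trunc_eq_assemble:
  assumes "\<forall>i\<in>{1..k}. z i = zb i"
  shows "trunc n z = assemble s k zb {1..n} (tail s k z)"
  using assms by (auto simp: trunc_def assemble_def tail_def fun_eq_iff restrict_def)

lemma trunc_assemble: "{1..n} \<subseteq> I \<Longrightarrow> trunc n (assemble s k zb I w) = assemble s k zb {1..n} w"
  unfolding trunc_def by (rule ext) (simp add: assemble_def restrict_def subset_iff)

lemma assemble_eq_iff:
  "assemble s k zb {1..k + l} w = assemble s k zb {1..k + l} w' \<longleftrightarrow> (\<forall>j. 1 \<le> j \<and> j \<le> l \<longrightarrow> w j = w' j)"
proof
  assume eq: "assemble s k zb {1..k + l} w = assemble s k zb {1..k + l} w'"
  show "\<forall>j. 1 \<le> j \<and> j \<le> l \<longrightarrow> w j = w' j"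
  proof (intro allI impI)
    fix j assume j: "1 \<le> j \<and> j \<le> l"
    then show "w j = w' j" using fun_cong[OF eq, of "k + j"] by (simp add: assemble_def)
  qed
next
  assume eq: "\<forall>j. 1 \<le> j \<and> j \<le> l \<longrightarrow> w j = w' j"
  have "w (j - k) = w' (j - k)" if "j \<in> {1..k + l}" "\<not> j \<le> k" for j
  proof -
    have "1 \<le> j - k \<and> j - k \<le> l" using that by auto
    then show ?thesis using eq by blast
  qed
  then show "assemble s k zb {1..k + l} w = assemble s k zb {1..k + l} w'"
    unfolding assemble_def by (intro restrict_ext) auto
qed

lemma trunc_Xbar:
  assumes "l \<le> M"
  shows "trunc (k + l) ` Xbar s s' G k zb (k + M)
    = assemble s k zb {1..k + l} ` {w. \<forall>m. 1 \<le> m \<and> m \<le> M \<longrightarrow> solves w m}"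
proof (intro equalityI subsetI)
  fix f assume "f \<in> trunc (k + l) ` Xbar s s' G k zb (k + M)"
  then obtain z where "f = trunc (k + l) z" "z \<in> Xbar s s' G k zb (k + M)" by blast
  then show "f \<in> assemble s k zb {1..k + l} ` {w. \<forall>m. 1 \<le> m \<and> m \<le> M \<longrightarrow> solves w m}"
    unfolding Xbar_iff using trunc_eq_assemble by blast
next
  fix f assume "f \<in> assemble s k zb {1..k + l} ` {w. \<forall>m. 1 \<le> m \<and> m \<le> M \<longrightarrow> solves w m}"
  then obtain w where w: "f = assemble s k zb {1..k + l} w" "\<forall>m. 1 \<le> m \<and> m \<le> M \<longrightarrow> solves w m" by blast
  let ?z = "assemble s k zb {1..k + M} w"
  have "solves (tail s k ?z) m" if m: "1 \<le> m \<and> m \<le> M" for m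
    using w(2) m solves_cong[of m "tail s k ?z" w] by (simp add: tail_assemble)
  then have "?z \<in> Xbar s s' G k zb (k + M)"
    unfolding Xbar_iff using assemble_in(1) assemble_in(2)[of "{1..k + M}" w] by auto
  moreover have "f = trunc (k + l) ?z" using w(1) assms by (simp add: trunc_assemble)
  ultimately show "f \<in> trunc (k + l) ` Xbar s s' G k zb (k + M)" by blast
qed

lemma trunc_Xbar_inf:
  "trunc (k + l) ` Xbar_inf s s' G k zb = assemble s k zb {1..k + l} ` {w. \<forall>m\<ge>1. solves w m}"
proof (intro equalityI subsetI)
  fix f assume "f \<in> trunc (k + l) ` Xbar_inf s s' G k zb"
  then obtain z where "f = trunc (k + l) z" "z \<in> Xbar_inf s s' G k zb" by blast
  then show "f \<in> assemble s k zb {1..k + l} ` {w. \<forall>m\<ge>1. solves w m}"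
    unfolding Xbar_inf_iff using trunc_eq_assemble by blast
next
  fix f assume "f \<in> assemble s k zb {1..k + l} ` {w. \<forall>m\<ge>1. solves w m}"
  then obtain w where w: "f = assemble s k zb {1..k + l} w" "\<forall>m\<ge>1. solves w m" by blast
  let ?z = "assemble s k zb {1..} w"
  have "solves (tail s k ?z) m" if m: "m \<ge> 1" for m
    using w(2) m solves_cong[of m "tail s k ?z" w] by (simp add: tail_assemble)
  then have "?z \<in> Xbar_inf s s' G k zb"
    unfolding Xbar_inf_iff using assemble_in(1) assemble_in(2)[of "{1..}" w] by auto
  moreover have "f = trunc (k + l) ?z" using w(1) trunc_assemble[of "k + l" "{1..}" w] by auto
  ultimately show "f \<in> trunc (k + l) ` Xbar_inf s s' G k zb" by blast
qed

text \<open>The truncation records \<open>w 1, \<dots>, w l\<close>, which the first \<open>k + l\<close> equations already restrict as much as all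
  equations do.\<close>

theorem truncations_stabilize:
  assumes "k + l \<le> M"
  shows "trunc (k + l) ` Xbar s s' G k zb (k + M) = trunc (k + l) ` Xbar_inf s s' G k zb"
proof -
  have "l \<le> M" using assms by simp
  show ?thesis unfolding trunc_Xbar[OF \<open>l \<le> M\<close>] trunc_Xbar_inf
  proof (intro equalityI image_subsetI)
    fix w assume "w \<in> {w. \<forall>m. 1 \<le> m \<and> m \<le> M \<longrightarrow> solves w m}"
    then have "\<And>e. 1 \<le> e \<Longrightarrow> e \<le> k + l \<Longrightarrow> solves w e" using assms by simp
    then obtain w' where "\<And>j. 1 \<le> j \<Longrightarrow> j \<le> l \<Longrightarrow> w' j = w j" "\<And>e. 1 \<le> e \<Longrightarrow> solves w' e"
      using extend_to_full_solution by metis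
    then show "assemble s k zb {1..k + l} w \<in> assemble s k zb {1..k + l} ` {w. \<forall>m\<ge>1. solves w m}"
      using assemble_eq_iff[of l w w'] by auto
  qed auto
qed

theorem truncations_strict:
  assumes l: "l \<ge> 1" and k: "k \<ge> 1" and not: "\<not> sum_operator_surj k S N"
  shows "trunc (k + l) ` Xbar s s' G k zb (k + (k + l)) \<subset> trunc (k + l) ` Xbar s s' G k zb (k + (k + l - 1))"
proof -
  have le: "l \<le> k + l" "l \<le> k + l - 1" using k by auto
  obtain w where w: "\<And>e. 1 \<le> e \<Longrightarrow> e < k + l \<Longrightarrow> solves w e"
    "\<And>w'. (\<And>j. 1 \<le> j \<Longrightarrow> j \<le> l \<Longrightarrow> w' j = w j) \<Longrightarrow> \<not> (\<forall>e. 1 \<le> e \<and> e \<le> k + l \<longrightarrow> solves w' e)"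
    using last_equation_restricts[OF l not] by metis
  let ?f = "assemble s k zb {1..k + l} w"
  have "?f \<in> trunc (k + l) ` Xbar s s' G k zb (k + (k + l - 1))"
    unfolding trunc_Xbar[OF le(2)] using w(1) l by (intro imageI) auto
  moreover have "?f \<notin> trunc (k + l) ` Xbar s s' G k zb (k + (k + l))"
  proof
    assume "?f \<in> trunc (k + l) ` Xbar s s' G k zb (k + (k + l))"
    then obtain w' where w': "?f = assemble s k zb {1..k + l} w'" "\<forall>m. 1 \<le> m \<and> m \<le> k + l \<longrightarrow> solves w' m"
      unfolding trunc_Xbar[OF le(1)] by blast
    then have "\<And>j. 1 \<le> j \<Longrightarrow> j \<le> l \<Longrightarrow> w' j = w j" using assemble_eq_iff[of l w w'] by simp
    then show False using w(2)[of w'] w'(2) by blast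
  qed
  moreover have "trunc (k + l) ` Xbar s s' G k zb (k + (k + l)) \<subseteq> trunc (k + l) ` Xbar s s' G k zb (k + (k + l - 1))"
    unfolding trunc_Xbar[OF le(1)] trunc_Xbar[OF le(2)] by (intro image_mono) auto
  ultimately show ?thesis by blast
qed

subsection \<open>The parametrization\<close>

text \<open>The factorials translate between \<open>z (k + m)\<close> and \<open>w m\<close>; the parameters \<open>p m\<close> are on the scale of \<open>z\<close>.\<close>

definition param :: "nat \<Rightarrow> nat \<Rightarrow> (nat \<Rightarrow> 'a) \<Rightarrow> 'a" where
  "param M m p = s (fact (k + m))
     (prescribed (order_at M m) m (solution (order_at M) (\<lambda>j. s (1 / fact (k + j)) (p j))))"

lemma param_weighted:
  assumes "m \<ge> 1"
  shows "weighted_composition s {1..<m} m (param M m)"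
proof -
  have "weighted_composition s {1..<m} d (\<lambda>p. s (1 / fact (k + j)) (p j))" if "j \<in> {1..<m}" "j \<le> d" for j d
    by (rule s.weighted_composition_operator[OF s.bounded_operator_scale weighted_composition.var[OF that]])
  from weighted_composition_subst[OF solution_weighted[of "order_at M", OF order_at_le assms] this]
  have "weighted_composition s {1..<m} m
      (\<lambda>p. prescribed (order_at M m) m (solution (order_at M) (\<lambda>j. s (1 / fact (k + j)) (p j))))"
    by simp
  from s.weighted_composition_operator[OF s.bounded_operator_scale this]
  show ?thesis by (simp only: param_def[abs_def])
qed

lemma solves_iff_param:
  assumes M: "k \<le> M"
  shows "(\<forall>e. 1 \<le> e \<and> e \<le> M \<longrightarrow> solves (tail s k z) e) \<longleftrightarrow>
    (\<exists>p. \<forall>m. 1 \<le> m \<and> m \<le> M \<longrightarrow> p m \<in> N (order_at M m) \<and> z (k + m) = param M m p + p m)"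
proof
  let ?w = "tail s k z"
  assume "\<forall>e. 1 \<le> e \<and> e \<le> M \<longrightarrow> solves ?w e"
  then have w: "?w m - prescribed (order_at M m) m ?w \<in> N (order_at M m)" if "1 \<le> m" "m \<le> M" for m
    using solves_all_iff[OF M] that by blast
  define p where "p m = s (fact (k + m)) (?w m - prescribed (order_at M m) m ?w)" for m
  let ?p = "\<lambda>j. s (1 / fact (k + j)) (p j)"
  have p: "?p j = ?w j - prescribed (order_at M j) j ?w" for j by (simp add: p_def)
  have sol: "?w m = solution (order_at M) ?p m" if "1 \<le> m" "m \<le> M" for m
    by (rule solution_unique[OF order_at_le _ that]) (simp add: p)
  have "p m \<in> N (order_at M m) \<and> z (k + m) = param M m p + p m" if m: "1 \<le> m \<and> m \<le> M" for m
  proof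
    show "p m \<in> N (order_at M m)"
      unfolding p_def using s.subspace_scale[OF N_subspace[OF order_at_le] w] m by blast
    have "prescribed (order_at M m) m (solution (order_at M) ?p) = prescribed (order_at M m) m ?w"
      by (rule prescribed_cong[OF order_at_le]) (use sol m in auto)
    then have "param M m p + p m = s (fact (k + m)) (?w m)"
      by (simp add: param_def p_def s.scale_right_diff_distrib)
    then show "z (k + m) = param M m p + p m" by (simp add: tail_def)
  qed
  then show "\<exists>p. \<forall>m. 1 \<le> m \<and> m \<le> M \<longrightarrow> p m \<in> N (order_at M m) \<and> z (k + m) = param M m p + p m" by blast
next
  let ?w = "tail s k z"
  assume "\<exists>p. \<forall>m. 1 \<le> m \<and> m \<le> M \<longrightarrow> p m \<in> N (order_at M m) \<and> z (k + m) = param M m p + p m"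
  then obtain p where p: "\<And>m. 1 \<le> m \<Longrightarrow> m \<le> M \<Longrightarrow> p m \<in> N (order_at M m)"
    "\<And>m. 1 \<le> m \<Longrightarrow> m \<le> M \<Longrightarrow> z (k + m) = param M m p + p m" by blast
  let ?p = "\<lambda>j. s (1 / fact (k + j)) (p j)" and ?sol = "solution (order_at M) (\<lambda>j. s (1 / fact (k + j)) (p j))"
  have w: "?w m = ?sol m" if "1 \<le> m" "m \<le> M" for m
    unfolding tail_def p(2)[OF that] solution_eq[of "order_at M" ?p m, OF order_at_le]
    by (simp add: param_def s.scale_right_distrib)
  have "?w m - prescribed (order_at M m) m ?w \<in> N (order_at M m)" if m: "1 \<le> m \<and> m \<le> M" for m
  proof -
    have "prescribed (order_at M m) m ?w = prescribed (order_at M m) m ?sol"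
      by (rule prescribed_cong[OF order_at_le]) (use w m in auto)
    then have "?w m - prescribed (order_at M m) m ?w = ?p m"
      using w[of m] m solution_eq[of "order_at M" ?p m, OF order_at_le] by simp
    then show ?thesis using s.subspace_scale[OF N_subspace[OF order_at_le] p(1)] m by metis
  qed
  then show "\<forall>e. 1 \<le> e \<and> e \<le> M \<longrightarrow> solves ?w e" using solves_all_iff[OF M] by blast
qed

text \<open>The parameters \<open>p 1, \<dots>, p (k + l)\<close> are listed as \<open>q 1, \<dots>, q l, n k, \<dots>, n 1\<close>.\<close>

theorem Xbar_parametrized:
  "Xbar s s' G k zb (2 * k + l) =
    {z \<in> {1..2*k+l} \<rightarrow>\<^sub>E UNIV. (\<forall>i\<in>{1..k}. z i = zb i) \<and>
      (\<exists>q n. (\<forall>j\<in>{1..l}. q j \<in> N (k + 1)) \<and> (\<forall>j\<in>{1..k}. n j \<in> N j) \<and>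
        (let p = (\<lambda>m. if m \<le> l then q m else n (k + l + 1 - m)) in
          (\<forall>j\<in>{1..l}. z (k + j) = param (k + l) j p + q j) \<and>
          (\<forall>j\<in>{1..k}. z (k + l + j) = param (k + l) (l + j) p + n (k + 1 - j))))}"
proof -
  have eq: "2 * k + l = k + (k + l)" by simp
  have ord: "order_at (k + l) m = (if m \<le> l then Suc k else Suc (k + l) - m)" for m
    by (auto simp: order_at_def)
  have "(\<forall>m. 1 \<le> m \<and> m \<le> k + l \<longrightarrow> solves (tail s k z) m) \<longleftrightarrow>
      (\<exists>q n. (\<forall>j\<in>{1..l}. q j \<in> N (k + 1)) \<and> (\<forall>j\<in>{1..k}. n j \<in> N j) \<and>
        (let p = (\<lambda>m. if m \<le> l then q m else n (k + l + 1 - m)) in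
          (\<forall>j\<in>{1..l}. z (k + j) = param (k + l) j p + q j) \<and>
          (\<forall>j\<in>{1..k}. z (k + l + j) = param (k + l) (l + j) p + n (k + 1 - j))))"
    (is "?solves \<longleftrightarrow> ?params") for z
  proof
    assume ?solves
    then obtain p where p: "\<And>m. 1 \<le> m \<Longrightarrow> m \<le> k + l \<Longrightarrow> p m \<in> N (order_at (k + l) m)"
      "\<And>m. 1 \<le> m \<Longrightarrow> m \<le> k + l \<Longrightarrow> z (k + m) = param (k + l) m p + p m"
      unfolding solves_iff_param[OF le_add1] by blast
    define q where "q = p"
    define n where "n j = p (k + l + 1 - j)" for j
    let ?p = "\<lambda>m. if m \<le> l then q m else n (k + l + 1 - m)"
    have agree: "?p m = p m" if "m \<le> k + l" for m using that by (simp add: q_def n_def)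
    have param: "param (k + l) m ?p = param (k + l) m p" if "m \<le> k + l" for m
    proof -
      have "solution (order_at (k + l)) (\<lambda>j. s (1 / fact (k + j)) (p j)) j
          = solution (order_at (k + l)) (\<lambda>j. s (1 / fact (k + j)) (?p j)) j" if "1 \<le> j" "j \<le> k + l" for j
      proof (rule solution_unique[OF order_at_le _ that])
        fix j assume "1 \<le> j" "j \<le> k + l"
        then show "solution (order_at (k + l)) (\<lambda>j. s (1 / fact (k + j)) (p j)) j
            = prescribed (order_at (k + l) j) j (solution (order_at (k + l)) (\<lambda>j. s (1 / fact (k + j)) (p j)))
              + s (1 / fact (k + j)) (?p j)"
          unfolding agree[OF \<open>j \<le> k + l\<close>] by (intro solution_eq order_at_le)
      qed
      then show ?thesis
        unfolding param_def using that by (intro arg_cong[of _ _ "s _"] prescribed_cong[OF order_at_le]) simp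
    qed
    show ?params
    proof (rule exI[of _ q], rule exI[of _ n], intro conjI)
      show "\<forall>j\<in>{1..l}. q j \<in> N (k + 1)"
      proof
        fix j assume "j \<in> {1..l}"
        then show "q j \<in> N (k + 1)" using p(1)[of j] ord[of j] by (simp add: q_def)
      qed
      show "\<forall>j\<in>{1..k}. n j \<in> N j"
      proof
        fix j assume j: "j \<in> {1..k}"
        have "order_at (k + l) (k + l + 1 - j) = j" using j by (auto simp: order_at_def)
        moreover have "p (k + l + 1 - j) \<in> N (order_at (k + l) (k + l + 1 - j))"
          using j by (intro p(1)) auto
        ultimately show "n j \<in> N j" by (simp only: n_def)
      qed
      have "z (k + j) = param (k + l) j ?p + q j" if "j \<in> {1..l}" for j
        using p(2)[of j] param[of j] that by (simp add: q_def)
      moreover have "z (k + l + j) = param (k + l) (l + j) ?p + n (k + 1 - j)" if j: "j \<in> {1..k}" for j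
      proof -
        have "n (k + 1 - j) = p (l + j)" using j by (simp add: n_def)
        then show ?thesis using p(2)[of "l + j"] param[of "l + j"] j by (simp add: add.assoc)
      qed
      ultimately show "let p = ?p in (\<forall>j\<in>{1..l}. z (k + j) = param (k + l) j p + q j) \<and>
          (\<forall>j\<in>{1..k}. z (k + l + j) = param (k + l) (l + j) p + n (k + 1 - j))"
        unfolding Let_def by blast
    qed
  next
    assume ?params
    then obtain q n where qn: "\<forall>j\<in>{1..l}. q j \<in> N (k + 1)" "\<forall>j\<in>{1..k}. n j \<in> N j" and
      z: "let p = (\<lambda>m. if m \<le> l then q m else n (k + l + 1 - m)) in
          (\<forall>j\<in>{1..l}. z (k + j) = param (k + l) j p + q j) \<and>
          (\<forall>j\<in>{1..k}. z (k + l + j) = param (k + l) (l + j) p + n (k + 1 - j))"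
      by blast
    define p where "p m = (if m \<le> l then q m else n (k + l + 1 - m))" for m
    have z': "\<forall>j\<in>{1..l}. z (k + j) = param (k + l) j p + q j"
      "\<forall>j\<in>{1..k}. z (k + l + j) = param (k + l) (l + j) p + n (k + 1 - j)"
      using z unfolding Let_def p_def[abs_def] by blast+
    have "p m \<in> N (order_at (k + l) m) \<and> z (k + m) = param (k + l) m p + p m" if m: "1 \<le> m \<and> m \<le> k + l" for m
    proof (cases "m \<le> l")
      case True
      then show ?thesis using m qn z' ord by (simp add: p_def)
    next
      case False
      define j where "j = m - l"
      have j: "j \<in> {1..k}" "m = l + j" using False m by (auto simp: j_def)
      then have "p m = n (k + 1 - j)" "order_at (k + l) m = k + 1 - j" using False by (simp_all add: p_def ord)
      moreover have "k + 1 - j \<in> {1..k}" using j by auto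
      ultimately show ?thesis using qn z'(2) j by (simp add: add.assoc)
    qed
    then show ?solves unfolding solves_iff_param[OF le_add1] by blast
  qed
  then show ?thesis unfolding eq by (intro set_eqI) (simp only: Xbar_iff mem_Collect_eq)
qed

end

theorem corollary2:
  fixes s :: "'k::real_normed_field \<Rightarrow> 'a::banach \<Rightarrow> 'a"
    and s' :: "'k \<Rightarrow> 'b::banach \<Rightarrow> 'b"
    and G :: "'a \<Rightarrow> 'b"
    and k :: nat
    and zb :: "nat \<Rightarrow> 'a"
    and A S :: "nat \<Rightarrow> 'a \<Rightarrow> 'b"
    and N Nc :: "nat \<Rightarrow> 'a set"
    and R Rc :: "nat \<Rightarrow> 'b set"
  assumes "normed_space_over s"
    and "normed_space_over s'"
    and "analytic_near_0 s s' G"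
    and "G 0 = 0"
    and "k \<ge> 1"
    and "zb \<in> trunc k ` X s s' G (2 * k)"
    and "expansion_coeffs s s' G k zb A"
    and "operator_chain s s' k A S N Nc R Rc"
    and "sum_operator_surj (k + 1) S N"
    and "\<not> sum_operator_surj k S N"
  shows "\<forall>l\<ge>1.
    (trunc (k + l) ` Xbar s s' G k zb (2 * k + l) \<subset> trunc (k + l) ` Xbar s s' G k zb (2 * k + l - 1) \<and>
     (\<forall>i\<ge>2 * k + l. trunc (k + l) ` Xbar s s' G k zb i = trunc (k + l) ` Xbar_inf s s' G k zb)) \<and>
    (\<exists>P :: nat \<Rightarrow> (nat \<Rightarrow> 'a) \<Rightarrow> 'a.
      (\<forall>i\<in>{1..l+k}. multilinear_composition s {1..<i} (P i)) \<and>
      Xbar s s' G k zb (2 * k + l) =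
        {z \<in> {1..2*k+l} \<rightarrow>\<^sub>E UNIV. (\<forall>i\<in>{1..k}. z i = zb i) \<and>
          (\<exists>q n. (\<forall>j\<in>{1..l}. q j \<in> N (k + 1)) \<and> (\<forall>j\<in>{1..k}. n j \<in> N j) \<and>
            (let p = (\<lambda>m. if m \<le> l then q m else n (k + l + 1 - m)) in
              (\<forall>j\<in>{1..l}. z (k + j) = P j p + q j) \<and>
              (\<forall>j\<in>{1..k}. z (k + l + j) = P (l + j) p + n (k + 1 - j))))} \<and>
      (\<forall>E. finite E \<and> \<not> module.dependent s E \<and> module.span s E = UNIV \<and>
           (\<exists>F. finite F \<and> module.span s' F = UNIV) \<longrightarrow>
        (\<forall>i\<in>{1..l+k}. \<forall>b\<in>E. \<exists>f. polynomial_of_degree_le ({1..<i} \<times> E) i f \<and>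
           (\<forall>p. module.representation s E (P i p) b =
                 f (\<lambda>(m, e). module.representation s E (p m) e)))))"
proof -
  obtain a c r where "multilinear_power_series s s' a c r G"
    using analytic_near_0_power_series[OF assms(1-3)] by metis
  then interpret P: multilinear_power_series s s' a c r G .
  note expansion = assms(7)
  obtain z0 where z0: "z0 \<in> X s s' G (2 * k)" "zb = trunc k z0" using assms(6) by blast
  have zb: "zb j = z0 j" if "1 \<le> j" "j \<le> k" for j using z0(2) that by (simp add: trunc_def)
  have z0_eq: "series_coeff a (\<lambda>j. s (1 / fact j) (z0 j)) i = 0" if "1 \<le> i" "i \<le> 2 * k" for i
  proof -
    have "T s s' G i z0 = 0" using z0(1) that by (simp add: X_def)
    then show ?thesis by (simp add: P.T_eq_series_coeff)
  qed
  have A: "bounded_operator s s' (A i)" for i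
  proof -
    have "bounded_linear (A i)" "module_hom s s' (A i)"
      using expansion by (simp_all add: expansion_coeffs_def module_hom_iff_linear)
    then show ?thesis
      using bounded_linear.bounded[of "A i"] by (metis bounded_operatorI mult.commute)
  qed
  have start_solves: "series_coeff a (P.taylor_start k zb) i = 0" if i: "1 \<le> i" "i \<le> k" for i
  proof -
    have "series_coeff a (P.taylor_start k zb) i = series_coeff a (\<lambda>j. s (1 / fact j) (z0 j)) i"
      by (rule series_coeff_cong[OF P.ml]) (use zb i in \<open>auto simp: P.taylor_start_def\<close>)
    then show ?thesis using z0_eq i by simp
  qed
  have start: "\<exists>w. \<forall>m\<in>{1..k}. toeplitz A (\<lambda>j. w (Suc j)) (m - 1) = P.rhs k zb m w"
  proof (intro exI[of _ "tail s k z0"] ballI)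
    fix m assume m: "m \<in> {1..k}"
    have "series_coeff a (continue k (P.taylor_start k zb) (tail s k z0)) (k + m)
        = series_coeff a (\<lambda>j. s (1 / fact j) (z0 j)) (k + m)"
      by (rule series_coeff_cong[OF P.ml]) (use zb in \<open>auto simp: continue_def P.taylor_start_def tail_def\<close>)
    then show "toeplitz A (\<lambda>j. tail s k z0 (Suc j)) (m - 1) = P.rhs k zb m (tail s k z0)"
      using z0_eq[of "k + m"] P.series_coeff_continue[OF expansion, of m "tail s k z0"] m by simp
  qed
  interpret U: undetermined_coefficients s s' A k S N Nc R Rc a c r G zb
  proof unfold_locales
    show "bounded_operator s s' (A i)" for i by (rule A)
    show "operator_chain s s' k A S N Nc R Rc" "sum_operator_surj (k + 1) S N" by fact+
    show "P.rhs k zb m w = P.rhs k zb m w'" if "\<And>j. 1 \<le> j \<Longrightarrow> j + k < m \<Longrightarrow> w j = w' j" for m w w'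
      by (rule P.rhs_cong) (rule that)
    show "weighted_composition s {1..<m - k} (m - k) (\<lambda>w. K (P.rhs k zb m w))"
      if "bounded_operator s' s K" for m K
      by (rule P.rhs_weighted[OF that])
    show "\<exists>w. \<forall>m\<in>{1..k}. toeplitz A (\<lambda>j. w (Suc j)) (m - 1) = P.rhs k zb m w" by (rule start)
    show "expansion_coeffs s s' G k zb A" by (rule expansion)
    show "series_coeff a (P.taylor_start k zb) i = 0" if "1 \<le> i" "i \<le> k" for i
      by (rule start_solves[OF that])
  qed
  show ?thesis
  proof (intro allI impI, goal_cases)
    case (1 l)
    then have l: "l \<ge> 1" .
    have idx: "2 * k + l = k + (k + l)" "2 * k + l - 1 = k + (k + l - 1)" using l by auto
    have strict: "trunc (k + l) ` Xbar s s' G k zb (2 * k + l) \<subset> trunc (k + l) ` Xbar s s' G k zb (2 * k + l - 1)"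
      by (subst idx(2), subst idx(1), rule U.truncations_strict[OF l assms(5) assms(10)])
    have stable: "trunc (k + l) ` Xbar s s' G k zb i = trunc (k + l) ` Xbar_inf s s' G k zb"
      if "i \<ge> 2 * k + l" for i
      using U.truncations_stabilize[of l "i - k"] that by simp
    have composition: "multilinear_composition s {1..<i} (U.param (k + l) i)" if "i \<in> {1..l+k}" for i
      using U.param_weighted[of i "k + l"] that weighted_composition_imp_multilinear_composition by auto
    have polynomial: "\<exists>f. polynomial_of_degree_le ({1..<i} \<times> E) i f \<and>
         (\<forall>p. module.representation s E (U.param (k + l) i p) b =
               f (\<lambda>(m, e). module.representation s E (p m) e))"
      if "finite E \<and> \<not> module.dependent s E \<and> module.span s E = UNIV" "i \<in> {1..l+k}" "b \<in> E" for E i b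
      by (rule P.s.weighted_composition_coordinates) (use that U.param_weighted[of i "k + l"] in auto)
    show ?case
      by (intro conjI exI[of _ "U.param (k + l)"] strict allI[OF impI, OF stable] U.Xbar_parametrized
          ballI composition allI[of _, OF impI] polynomial) simp_all
  qed
qed

end
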